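(* Fix $k\ge1$. There exist constants $C_k'$ and $c_k$, depending only on $k$, such that for all $x\ge1$ and $C_k'\le y_1\le\cdots\le y_k$ with $2^ky_1\cdots y_k\le x/y_k$, $$\frac{H^{(k+1)}(x,\mathbf{y},2\mathbf{y})}{x}\ll_k\left(\prod_{i=1}^k(\log y_i)^{-e_{k,i}}\right)\sum_{\substack{\mathbf{a}\in\mathscr{P}_*^k(\mathbf{y})\\ a_i\le y_i^{c_k}\ (1\le i\le k)}}\frac{L^{(k+1)}(\mathbf{a})}{a_1\cdots a_k}.$$
   Context: $H^{(k+1)}(x,\mathbf{y},\mathbf{z})$ is the number of positive integers $n\le x$ for which there exist positive integers $d_1,\dots,d_k$ with $d_1\cdots d_k\mid n$ and $y_i<d_i\le z_i$; $2\mathbf{y}=(2y_1,\dots,2y_k)$. $(e_{k,1},\dots,e_{k,k})=(1,\dots,1,2)$ (the first $k-1$ entries equal $1$, the last equals $2$). $L^{(k+1)}(\mathbf{a})$ is the $k$-dimensional Lebesgue measure of $\bigcup[\log(d_1/2),\log d_1)\times\cdots\times[\log(d_k/2),\log d_k)$ over all $(d_1,\dots,d_k)\in\mathbb{N}^k$ with $d_1\cdots d_i\mid a_1\cdots a_i$ for all $i$. $\mathscr{P}_*(y,z)$ is the set of squarefree positive integers whose prime factors all lie in $(y,z]$; with $t_0=1$, $\mathscr{P}_*^k(\mathbf{t})=\{\mathbf{a}\in\mathbb{N}^k: a_i\in\mathscr{P}_*(t_{i-1},t_i)\ (1\le i\le k)\}$. *)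

theory Defs
  imports "HOL-Analysis.Analysis" "HOL-Computational_Algebra.Squarefree"
begin

text \<open>Vectors in N^k / R^k are functions on nat, indexed by i in {1..k}.\<close>

definition H :: "nat \<Rightarrow> real \<Rightarrow> (nat \<Rightarrow> real) \<Rightarrow> (nat \<Rightarrow> real) \<Rightarrow> nat" where
  "H k x y z = card {n::nat. 1 \<le> n \<and> real n \<le> x \<and>
     (\<exists>d::nat \<Rightarrow> nat. (\<forall>i\<in>{1..k}. 1 \<le> d i \<and> y i < real (d i) \<and> real (d i) \<le> z i)
        \<and> (\<Prod>i=1..k. d i) dvd n)}"

definition e :: "nat \<Rightarrow> nat \<Rightarrow> real" where
  "e k i = (if i = k then 2 else 1)"

definition L :: "nat \<Rightarrow> (nat \<Rightarrow> nat) \<Rightarrow> real" where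
  "L k a = measure (Pi\<^sub>M {1..k} (\<lambda>_. lborel))
     (\<Union>d \<in> {d::nat \<Rightarrow> nat. (\<forall>i\<in>{1..k}. 1 \<le> d i) \<and>
                 (\<forall>i\<in>{1..k}. (\<Prod>j=1..i. d j) dvd (\<Prod>j=1..i. a j))}.
        PiE {1..k} (\<lambda>i. {ln (real (d i) / 2) ..< ln (real (d i))}))"

definition P_star :: "real \<Rightarrow> real \<Rightarrow> nat set" where
  "P_star y z = {n::nat. 0 < n \<and> squarefree n \<and>
      (\<forall>p\<in>prime_factors n. y < real p \<and> real p \<le> z)}"

text \<open>P_*^k(t) with t_0 = 1; tuples a are functions equal to 1 outside {1..k}.\<close>
definition P_star_k :: "nat \<Rightarrow> (nat \<Rightarrow> real) \<Rightarrow> (nat \<Rightarrow> nat) set" where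
  "P_star_k k t = {a::nat \<Rightarrow> nat.
      (\<forall>i\<in>{1..k}. a i \<in> P_star (if i = 1 then 1 else t (i - 1)) (t i)) \<and>
      (\<forall>i. i \<notin> {1..k} \<longrightarrow> a i = 1)}"

end

theory Submission
  imports Defs "HOL-Number_Theory.Prime_Powers" "HOL-Real_Asymp.Real_Asymp"
begin

text \<open>
  Put n = d_1 ... d_k d_{k+1} with n in (X/2, X], let P_1 \<le> ... \<le> P_{k+1} be the largest prime factors
  of the d_i in increasing order, and write n = P_1 ... P_k m b, where m is P_k-smooth and b is
  P_k-rough. Unless the square of the largest prime of n divides n, which is rare, b > 1 and a sieve
  bound leaves X / (m P_1 ... P_k ln P_k) choices for b. Dividing the d_i by their largest primes
  gives a tuple whose partial products divide the smooth parts of m, so the point with coordinates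
  ln y_i - ln P_i lies in the union of boxes whose volume is L; as the primes have bounded logarithmic
  density on intervals of bounded logarithmic length, the sum over the P_i is bounded by L(m).

  If P_i is much smaller than y_i, then the P_i-smooth part of m exceeds roughly sqrt(y_i) / P_i.
  Rankin's trick turns this into a factor decaying exponentially in ln y_i / ln P_i, which pays for
  replacing (ln P_i)^(-e_i) by (ln y_i)^(-e_i). The Rankin weights are harmless since multiplying m by
  a prime power q^v increases L(m) by a factor at most (v+1)^k, which gives a convergent Euler product.
  The same device removes the large a_i.
\<close>

section \<open>Chebyshev bounds and a sieve estimate\<close>

text \<open>The exponents \<open>e k i\<close> have a direct origin: prime density is bounded only
  for the weight ln p / p, so each factor 1 / P_i leaves one factor (ln P_i)^(-1), and the sieve
  adds a second one for P_k.

  The complementary divisor takes part in the sorting on the same terms as d_1, ..., d_k, so it must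
  be large too. This is where 2^k y_1 ... y_k \<le> x / y_k enters. The ranges (X/2, X] are followed
  from X = x only down to about x / sqrt(y_k), where that divisor is still at least sqrt(y_k) / 2;
  hence the square root in the lower bound for the smooth part of m. Whatever is discarded is
  compared with x / (ln y_k)^(k+1), which the tuple a = (1, ..., 1) alone shows to be at most a
  constant times the main term.

  The integers m that arise are not those of the right-hand side: they may contain prime powers, and
  primes in (y_i, 2 y_i]. L is therefore extended to arbitrary integers as \<open>L_smooth\<close>,
  and both defects are removed as Euler factors. A cap on the exponents keeps all sums finite, with
  bounds independent of the cap.\<close>

definition psi :: "nat \<Rightarrow> real" where
  "psi n = (\<Sum>d=1..n. mangoldt d)"

text \<open>The upper limit \<open>N\<close> is decoupled from \<open>n\<close>, the terms with d >
  n being zero. Thus ln (2n)! and 2 ln n! can be subtracted term by term over one range.\<close>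

lemma ln_fact_eq_sum_mangoldt:
  assumes "n \<le> N"
  shows "ln (fact n) = (\<Sum>d=1..N. mangoldt d * real (n div d))"
  using assms
proof (induction n)
  case (Suc n)
  have div_Suc: "real (Suc n div d) = real (n div d) + (if d dvd Suc n then 1 else 0)" if "d \<in> {1..N}" for d
    using that by (auto simp: div_Suc dvd_eq_mod_eq_0)
  have "(\<Sum>d=1..N. mangoldt d * real (Suc n div d)) =
    (\<Sum>d=1..N. mangoldt d * real (n div d) + (if d dvd Suc n then mangoldt d else 0))"
    by (intro sum.cong) (auto simp: div_Suc algebra_simps)
  also have "\<dots> = ln (fact n) + (\<Sum>d=1..N. if d dvd Suc n then mangoldt d else 0)"
    using Suc by (simp add: sum.distrib)
  also have "(\<Sum>d=1..N. if d dvd Suc n then mangoldt d else 0) = (\<Sum>d | d dvd Suc n. mangoldt d :: real)"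
  proof (intro sum.mono_neutral_cong_right)
    show "{d. d dvd Suc n} \<subseteq> {1..N}"
    proof
      fix d assume "d \<in> {d. d dvd Suc n}"
      then have "d \<le> Suc n" "d > 0" by (auto dest: dvd_imp_le intro: dvd_pos_nat)
      then show "d \<in> {1..N}" using Suc.prems by auto
    qed
  qed auto
  also have "\<dots> = ln (real (Suc n))"
    using mangoldt_sum[of "Suc n", where ?'a = real] by simp
  also have "ln (fact n) + ln (real (Suc n)) = ln (fact (Suc n))"
    by (simp add: ln_mult flip: of_nat_Suc)
  finally show ?case by simp
qed auto

text \<open>Chebyshev's argument: the coefficient of \<open>mangoldt d\<close> in the logarithm of
  the central binomial coefficient is never negative and is at least 1 for n < d \<le> 2n, while the
  coefficient itself is at most 2^(2n).\<close>

lemma psi_double: "psi (2 * n) - psi n \<le> 2 * real n * ln 2"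
proof -
  have "psi (2 * n) - psi n = (\<Sum>d\<in>{n<..2*n}. mangoldt d)"
  proof -
    have "{1..2*n} = {1..n} \<union> {n<..2*n}" by auto
    then have "psi (2 * n) = sum mangoldt {1..n} + sum mangoldt {n<..2*n}"
      unfolding psi_def by (metis (no_types, lifting) finite_atLeastAtMost finite_greaterThanAtMost
          ivl_disj_int_two(8) sum.union_disjoint)
    then show ?thesis unfolding psi_def by simp
  qed
  also have "\<dots> \<le> (\<Sum>d\<in>{n<..2*n}. mangoldt d * (real (2*n div d) - 2 * real (n div d)))"
  proof (intro sum_mono)
    fix d assume d: "d \<in> {n<..2*n}"
    then have "n div d = 0" "2 * n div d \<ge> 1"
      by (auto simp: div_greater_zero_iff Suc_le_eq)
    then have "1 \<le> real (2*n div d) - 2 * real (n div d)" by simp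
    then show "mangoldt d \<le> mangoldt d * (real (2*n div d) - 2 * real (n div d))"
      using mangoldt_nonneg[of d] by (simp add: mult_le_cancel_left1)
  qed
  also have "\<dots> \<le> (\<Sum>d=1..2*n. mangoldt d * (real (2*n div d) - 2 * real (n div d)))"
  proof (intro sum_mono2)
    fix d assume "d \<in> {1..2*n} - {n<..2*n}"
    have "2 * (n div d) \<le> 2 * n div d"
    proof (cases "d = 0")
      case False
      have "2 * (n div d) * d \<le> 2 * n"
        using div_times_less_eq_dividend[of n d] by linarith
      then show ?thesis using False by (simp add: less_eq_div_iff_mult_less_eq)
    qed auto
    then have "2 * real (n div d) \<le> real (2*n div d)" by linarith
    then show "0 \<le> mangoldt d * (real (2*n div d) - 2 * real (n div d))"
      using mangoldt_nonneg[of d] by simp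
  qed auto
  also have "\<dots> = ln (fact (2*n)) - 2 * ln (fact n)"
    unfolding ln_fact_eq_sum_mangoldt[of "2*n" "2*n", OF order_refl] ln_fact_eq_sum_mangoldt[of n "2*n", OF le_add2[of n n, folded mult_2]]
    by (simp add: sum_subtractf sum_distrib_left algebra_simps)
  also have "\<dots> = ln (real ((2 * n) choose n))"
  proof -
    have "fact (2*n) = (fact n * fact n * real ((2*n) choose n))"
      using binomial_fact_lemma[of n "2*n"] by (metis add_diff_cancel_left' mult_2 le_add1 of_nat_fact of_nat_mult)
    then show ?thesis by (simp add: ln_mult)
  qed
  also have "\<dots> \<le> ln (2 ^ (2 * n))"
  proof -
    have "real ((2 * n) choose n) \<le> 2 ^ (2 * n)"
      using binomial_le_pow2[of "2*n" n] by (metis of_nat_le_iff of_nat_numeral of_nat_power)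
    then show ?thesis by (subst ln_le_cancel_iff) auto
  qed
  finally show ?thesis by (simp add: ln_realpow)
qed

lemma psi_mono: "m \<le> n \<Longrightarrow> psi m \<le> psi n"
  unfolding psi_def by (intro sum_mono2) (auto simp: mangoldt_nonneg)

text \<open>Halving with \<open>h\<close> = n/2 rounded up gives 6h + 2h = 8h \<le> 4n + 4, which is
  at most 6n as soon as n \<ge> 2. The rounding is what makes the constant as large as 6.\<close>

lemma psi_le: "psi n \<le> 6 * real n"
proof (induction n rule: less_induct)
  case (less n)
  show ?case
  proof (cases "n \<le> 1")
    case True
    then have "n = 0 \<or> n = 1" by auto
    then show ?thesis by (auto simp: psi_def)
  next
    case False
    define h where "h = (n + 1) div 2"
    have h: "h < n" "n \<le> 2 * h" "2 * h \<le> n + 1" using False by (auto simp: h_def)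
    have "psi n \<le> psi (2 * h)" using h by (intro psi_mono)
    also have "\<dots> \<le> psi h + 2 * real h * ln 2" using psi_double[of h] by simp
    also have "\<dots> \<le> 6 * real h + 2 * real h * 1"
      using less[OF h(1)] ln_2_less_1 by (intro add_mono mult_left_mono) auto
    also have "\<dots> \<le> 6 * real n" using h False by linarith
    finally show ?thesis .
  qed
qed

text \<open>The upper half of Mertens' first theorem: replacing n/d by its integer part turns n
  times the sum into ln n!, and the rounding error is at most \<open>psi n\<close>.\<close>

lemma sum_mangoldt_over_id_le:
  assumes "n \<ge> 1"
  shows "(\<Sum>d=1..n. mangoldt d / real d) \<le> ln (real n) + 6"
proof -
  have "real n * (\<Sum>d=1..n. mangoldt d / real d) = (\<Sum>d=1..n. mangoldt d * (real n / real d))"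
    by (simp add: sum_distrib_left algebra_simps)
  also have "\<dots> \<le> (\<Sum>d=1..n. mangoldt d * (real (n div d) + 1))"
    by (intro sum_mono mult_left_mono mangoldt_nonneg)
       (metis add.commute floor_divide_of_nat_eq less_eq_real_def of_int_of_nat_eq real_of_int_floor_add_one_gt)
  also have "\<dots> = ln (fact n) + psi n"
    using ln_fact_eq_sum_mangoldt[of n n] by (simp add: psi_def sum.distrib algebra_simps)
  also have "\<dots> \<le> real n * ln (real n) + 6 * real n"
  proof (intro add_mono psi_le)
    have "(fact n :: real) \<le> real n ^ n" using fact_le_power[of n, where ?'a = real] by simp
    then have "ln (fact n) \<le> ln (real n ^ n)" using assms by (subst ln_le_cancel_iff) auto
    then show "ln (fact n) \<le> real n * ln (real n)" using assms by (simp add: ln_realpow)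
  qed
  also have "\<dots> = real n * (ln (real n) + 6)" by (simp add: algebra_simps)
  finally show ?thesis using assms by (simp add: mult_le_cancel_left_pos)
qed

lemma sum_primes_ln_over_id_le:
  assumes "T \<ge> 1" "finite Q" "\<And>q. q \<in> Q \<Longrightarrow> prime q \<and> real q \<le> T"
  shows "(\<Sum>q\<in>Q. ln (real q) / real q) \<le> ln T + 6"
proof -
  define n where "n = nat \<lfloor>T\<rfloor>"
  have n: "n \<ge> 1" "real n \<le> T" using assms(1) by (auto simp: n_def le_nat_floor)
  have "(\<Sum>q\<in>Q. ln (real q) / real q) = (\<Sum>q\<in>Q. mangoldt q / real q)"
    using assms(3) by (intro sum.cong) auto
  also have "\<dots> \<le> (\<Sum>d=1..n. mangoldt d / real d)"
    using assms by (intro sum_mono2) (auto simp: mangoldt_nonneg n_def le_nat_floor intro!: prime_ge_Suc_0_nat)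
  also have "\<dots> \<le> ln (real n) + 6" by (rule sum_mangoldt_over_id_le[OF n(1)])
  also have "\<dots> \<le> ln T + 6" using n by simp
  finally show ?thesis .
qed

text \<open>The ratio 4 = exp (2 ln 2) is the width of the cubes of radius ln 2 used later for
  spreading point masses. On such an interval 1/q is at most 1/u, and \<open>psi_le\<close> at 4u
  gives 24 = 6 * 4.\<close>

lemma sum_primes_ln_over_id_interval_le:
  assumes "u > 0" "finite Q" "\<And>q. q \<in> Q \<Longrightarrow> prime q \<and> u \<le> real q \<and> real q \<le> 4 * u"
  shows "(\<Sum>q\<in>Q. ln (real q) / real q) \<le> 24"
proof -
  define n where "n = nat \<lfloor>4 * u\<rfloor>"
  have n: "real n \<le> 4 * u" using assms(1) by (auto simp: n_def)
  have "(\<Sum>q\<in>Q. ln (real q) / real q) \<le> (\<Sum>q\<in>Q. mangoldt q / u)"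
  proof (intro sum_mono)
    fix q assume "q \<in> Q"
    then have q: "prime q" "u \<le> real q" using assms(3) by auto
    then have "real q \<ge> 1" using prime_ge_1_nat[of q] by simp
    then show "ln (real q) / real q \<le> mangoldt q / u"
      using q assms(1) by (auto intro!: divide_left_mono ln_ge_zero)
  qed
  also have "\<dots> = (\<Sum>q\<in>Q. mangoldt q) / u" by (simp add: sum_divide_distrib)
  also have "\<dots> \<le> psi n / u" unfolding psi_def
    using assms by (intro divide_right_mono sum_mono2)
      (auto simp: mangoldt_nonneg n_def le_nat_floor intro!: prime_ge_Suc_0_nat)
  also have "\<dots> \<le> 6 * (4 * u) / u" using psi_le[of n] n assms(1) by (intro divide_right_mono) auto
  also have "\<dots> = 24" using assms(1) by simp
  finally show ?thesis .
qed

section \<open>Rough integers and a sieve upper bound\<close>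

definition rough :: "real \<Rightarrow> real \<Rightarrow> nat set" where
  "rough p X = {b. 0 < b \<and> real b \<le> X \<and> (\<forall>q\<in>prime_factors b. p < real q)}"

lemma finite_rough [simp]: "finite (rough p X)"
  by (rule finite_subset[of _ "{..nat \<lfloor>X\<rfloor>}"]) (auto simp: rough_def le_nat_floor)

lemma harm_le: "n \<ge> 1 \<Longrightarrow> harm n \<le> (1 + ln (real n) :: real)"
proof (induction n rule: nat_induct_at_least)
  case base
  then show ?case by (simp add: harm_expand)
next
  case (Suc n)
  have "ln (real n / real (Suc n)) \<le> real n / real (Suc n) - 1"
    using Suc by (intro ln_le_minus_one) auto
  then have "ln (real n) - ln (real (Suc n)) \<le> - inverse (real (Suc n))"
    using Suc by (simp add: ln_div field_simps)
  then show ?case using Suc by (simp add: harm_Suc)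
qed

text \<open>The products of a rough integer and an integer up to p are distinct integers up to p X:
  unique factorisation replaces Mertens' product formula.\<close>
lemma sum_inverse_rough_le:
  assumes "p \<ge> 2" "X \<ge> 1"
  shows "(\<Sum>c\<in>rough p X. 1 / real c) * ln p \<le> 1 + ln X + ln p"
proof -
  define n where "n = nat \<lfloor>p\<rfloor>"
  define N where "N = nat \<lfloor>X * p\<rfloor>"
  have n: "real n \<le> p" "p < real n + 1" using assms(1) by (auto simp: n_def)
  have Xp: "X * p \<ge> 2" using assms mult_mono[of 1 X 2 p] by simp
  have N: "real N \<le> X * p" "N \<ge> 1" using Xp by (auto simp: N_def le_nat_floor)
  have inj: "inj_on (\<lambda>(c, m). c * m) (rough p X \<times> {1..n})"
  proof (intro inj_onI, clarify)
    fix c m c' m'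
    assume c: "c \<in> rough p X" "c' \<in> rough p X" and m: "m \<in> {1..n}" "m' \<in> {1..n}" and eq: "c * m = c' * m'"
    have cop: "coprime a b" if "a \<in> rough p X" "b \<in> {1..n}" for a b
    proof (rule ccontr)
      assume "\<not> coprime a b"
      then have "gcd a b \<noteq> 1" by (simp add: coprime_iff_gcd_eq_1)
      then obtain q where "prime q" "q dvd gcd a b" using prime_factor_nat by blast
      then have q: "prime q" "q dvd a" "q dvd b" by auto
      then have "p < real q" using that by (auto simp: rough_def prime_factors_dvd)
      moreover have "q \<le> b" using q that by (auto intro: dvd_imp_le)
      ultimately show False using that n by (simp add: order_less_le_trans not_less)
    qed
    have "c dvd c'" using cop[OF c(1) m(2)] eq by (metis coprime_dvd_mult_left_iff dvd_triv_left)
    moreover have "c' dvd c" using cop[OF c(2) m(1)] eq by (metis coprime_dvd_mult_left_iff dvd_triv_left)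
    ultimately have "c = c'" by (rule dvd_antisym)
    then show "c = c' \<and> m = m'" using eq c by (auto simp: rough_def)
  qed
  have "(\<Sum>c\<in>rough p X. 1 / real c) * ln p \<le> (\<Sum>c\<in>rough p X. 1 / real c) * harm n"
    using n assms(1) order_trans[OF _ ln_le_harm[of n], of "ln p"] by (intro mult_left_mono sum_nonneg) auto
  also have "\<dots> = (\<Sum>(c,m)\<in>rough p X \<times> {1..n}. 1 / real (c * m))"
    by (simp add: harm_def sum_product sum.cartesian_product inverse_eq_divide)
  also have "\<dots> = (\<Sum>j\<in>(\<lambda>(c, m). c * m) ` (rough p X \<times> {1..n}). 1 / real j)"
    by (subst sum.reindex[OF inj]) (auto intro!: sum.cong)
  also have "\<dots> \<le> (\<Sum>j=1..N. 1 / real j)"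
  proof (intro sum_mono2)
    show "(\<lambda>(c, m). c * m) ` (rough p X \<times> {1..n}) \<subseteq> {1..N}"
    proof clarify
      fix c m assume c: "c \<in> rough p X" and m: "m \<in> {1..n}"
      have "real c * real m \<le> X * p" using c m n assms by (intro mult_mono) (auto simp: rough_def)
      then show "c * m \<in> {1..N}" using c m by (auto simp: rough_def N_def le_nat_floor Suc_leI)
    qed
  qed auto
  also have "\<dots> = harm N" by (simp add: harm_def inverse_eq_divide)
  also have "\<dots> \<le> 1 + ln (real N)" by (rule harm_le[OF N(2)])
  also have "\<dots> \<le> 1 + ln (X * p)" using N by simp
  also have "\<dots> = 1 + ln X + ln p" using assms by (simp add: ln_mult)
  finally show ?thesis .
qed

text \<open>Weighting each b by ln b and expanding ln b as a sum of \<open>mangoldt d\<close> over b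
  = c * d leaves a rough cofactor c, so Chebyshev's bound for d reduces the count to the sum of 1/c.
  Since ln b is at least ln X / 2 for b > sqrt X, the weight can be divided out. For X near 1 the
  integer 1 alone would break the bound, hence X > p.\<close>

lemma card_rough_le:
  assumes "p \<ge> 2" "X > p"
  shows "real (card (rough p X)) \<le> 50 * X / ln p"
proof -
  have lnp: "ln p > 0" and X: "X > 2" and le: "ln p \<le> ln X" using assms by auto
  have "ln 2 \<le> ln X" using X by simp
  then have lnX: "ln X > 1/2" using ln2_ge_two_thirds by linarith
  define R where "R = rough p X"
  have finR: "finite R" and Rpos: "\<And>b. b \<in> R \<Longrightarrow> b > 0" by (simp add: R_def, simp add: R_def rough_def)
  define S where "S = (\<Sum>c\<in>R. 1 / real c)"
  have S: "S \<le> 4 * ln X / ln p"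
  proof -
    have "S * ln p \<le> 1 + ln X + ln p" using sum_inverse_rough_le[of p X] assms X by (simp add: S_def R_def)
    \<comment> \<open>The three terms cost 2, 1 and 1 times ln X, because ln X > 1/2 and p <
      X.\<close>
    also have "\<dots> \<le> 4 * ln X" using lnX le by linarith
    finally show ?thesis using lnp by (simp only: pos_le_divide_eq)
  qed
  have "(\<Sum>b\<in>R. ln (real b)) = (\<Sum>b\<in>R. \<Sum>d | d dvd b. mangoldt d)"
  proof (intro sum.cong refl)
    fix b assume "b \<in> R"
    then show "ln (real b) = (\<Sum>d | d dvd b. mangoldt d)"
      using mangoldt_sum[of b, where ?'a = real] by (auto simp: R_def rough_def)
  qed
  also have "\<dots> = (\<Sum>z\<in>Sigma R (\<lambda>b. {d. d dvd b}). mangoldt (snd z))"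
    by (subst sum.Sigma) (use finR Rpos in \<open>auto simp: split_def\<close>)
  \<comment> \<open>The map (b, d) \<mapsto> (b div d, d) is inverted by (c, d) \<mapsto> (c * d,
    d). The roughness of d is dropped: d ranges over all integers up to X/c, so that the inner sum
    becomes a value of \<open>psi\<close>.\<close>
  also have "\<dots> \<le> (\<Sum>z\<in>Sigma R (\<lambda>c. {1..nat \<lfloor>X / real c\<rfloor>}). mangoldt (snd z))"
  proof (rule sum_le_included[where i = "\<lambda>(c,d). (c * d, d)"])
    show "finite (Sigma R (\<lambda>b. {d. d dvd b}))" using finR Rpos by (intro finite_SigmaI) auto
    show "\<forall>x\<in>Sigma R (\<lambda>b. {d. d dvd b}). \<exists>z\<in>Sigma R (\<lambda>c. {1..nat \<lfloor>X / real c\<rfloor>}).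
      (case z of (c, d) \<Rightarrow> (c * d, d)) = x \<and> mangoldt (snd x) \<le> (mangoldt (snd z) :: real)"
    proof clarify
      fix b d assume b: "b \<in> R" and d: "d dvd b"
      have pos: "b > 0" "d > 0" using b d by (auto simp: R_def rough_def intro: dvd_pos_nat)
      have c: "b div d > 0" "(b div d) * d = b" using d pos by (auto simp: dvd_imp_le div_greater_zero_iff)
      then have bc: "real (b div d) * real d = real b" by (metis of_nat_mult)
      have "b div d \<in> R"
      proof -
        have "real (b div d) \<le> real b" using div_le_dividend by (simp only: of_nat_le_iff)
        also have "\<dots> \<le> X" using b by (simp add: R_def rough_def)
        finally have "real (b div d) \<le> X" .
        moreover have "prime_factors (b div d) \<subseteq> prime_factors b"
          using c pos by (metis dvd_prime_factors dvd_triv_left neq0_conv)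
        ultimately show ?thesis using b c by (auto simp: R_def rough_def)
      qed
      moreover have "d \<le> nat \<lfloor>X / real (b div d)\<rfloor>"
        using b c bc by (intro le_nat_floor) (auto simp: field_simps R_def rough_def)
      ultimately show "\<exists>z\<in>Sigma R (\<lambda>c. {1..nat \<lfloor>X / real c\<rfloor>}).
          (case z of (c, d) \<Rightarrow> (c * d, d)) = (b, d) \<and> mangoldt (snd (b, d)) \<le> (mangoldt (snd z) :: real)"
        using pos c by (intro bexI[of _ "(b div d, d)"]) auto
    qed
  qed (auto simp: mangoldt_nonneg R_def)
  also have "\<dots> = (\<Sum>c\<in>R. psi (nat \<lfloor>X / real c\<rfloor>))"
    unfolding psi_def by (subst sum.Sigma) (use finR in \<open>auto simp: split_def\<close>)
  also have "\<dots> \<le> (\<Sum>c\<in>R. 6 * X * (1 / real c))"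
  proof (intro sum_mono)
    fix c assume "c \<in> R"
    have "psi (nat \<lfloor>X / real c\<rfloor>) \<le> 6 * real (nat \<lfloor>X / real c\<rfloor>)" by (rule psi_le)
    also have "\<dots> \<le> 6 * (X / real c)" using X by (intro mult_left_mono) auto
    finally show "psi (nat \<lfloor>X / real c\<rfloor>) \<le> 6 * X * (1 / real c)" by simp
  qed
  also have "\<dots> = 6 * X * S" by (simp add: S_def sum_distrib_left)
  also have "\<dots> \<le> 6 * X * (4 * ln X / ln p)" using S X by (intro mult_left_mono) auto
  finally have lnsum: "(\<Sum>b\<in>R. ln (real b)) \<le> 24 * X * ln X / ln p" by simp
  have "real (card R) \<le> real (card {b\<in>R. real b \<le> sqrt X}) + real (card {b\<in>R. real b > sqrt X})"
  proof -
    have "R = {b\<in>R. real b \<le> sqrt X} \<union> {b\<in>R. real b > sqrt X}" by auto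
    then show ?thesis by (metis card_Un_le of_nat_add of_nat_mono)
  qed
  moreover have "real (card {b\<in>R. real b \<le> sqrt X}) \<le> sqrt X"
  proof -
    have "card {b\<in>R. real b \<le> sqrt X} \<le> card {1..nat \<lfloor>sqrt X\<rfloor>}"
      by (intro card_mono) (auto simp: R_def rough_def le_nat_floor)
    then have "real (card {b\<in>R. real b \<le> sqrt X}) \<le> real (nat \<lfloor>sqrt X\<rfloor>)" by simp
    also have "\<dots> \<le> sqrt X" using X by (intro of_nat_floor) auto
    finally show ?thesis .
  qed
  \<comment> \<open>The b up to sqrt X, where ln b may be small, are counted trivially; ln p \<le> 2
    sqrt p \<le> 2 sqrt X makes them affordable.\<close>
  moreover have "sqrt X \<le> 2 * X / ln p"
  proof -
    have "ln p \<le> 2 * sqrt p" using ln_less_self[of "sqrt p"] assms by (simp add: ln_sqrt)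
    also have "\<dots> \<le> 2 * sqrt X" using assms by simp
    finally have "sqrt X * ln p \<le> sqrt X * (2 * sqrt X)" using X by (intro mult_left_mono) auto
    also have "\<dots> = 2 * X" using X by simp
    finally show ?thesis using lnp by (simp add: field_simps)
  qed
  moreover have "real (card {b\<in>R. real b > sqrt X}) \<le> 48 * X / ln p"
  proof -
    have "real (card {b\<in>R. real b > sqrt X}) * (ln X / 2) = (\<Sum>b\<in>{b\<in>R. real b > sqrt X}. ln X / 2)" by simp
    also have "\<dots> \<le> (\<Sum>b\<in>{b\<in>R. real b > sqrt X}. ln (real b))"
    proof (intro sum_mono)
      fix b assume "b \<in> {b\<in>R. real b > sqrt X}"
      then have "ln (sqrt X) \<le> ln (real b)" using X Rpos by (subst ln_le_cancel_iff) auto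
      then show "ln X / 2 \<le> ln (real b)" using X by (simp add: ln_sqrt)
    qed
    also have "\<dots> \<le> (\<Sum>b\<in>R. ln (real b))"
      by (intro sum_mono2) (use finR Rpos in \<open>auto intro!: ln_ge_zero simp: Suc_le_eq\<close>)
    also note lnsum
    finally show ?thesis using lnX lnp by (simp add: field_simps)
  qed
  moreover have "2 * X / ln p + 48 * X / ln p = 50 * X / ln p" by (simp add: add_divide_distrib[symmetric])
  ultimately show ?thesis unfolding R_def by linarith
qed

section \<open>Euler products and Rankin weights\<close>

definition ints_over :: "nat set \<Rightarrow> nat \<Rightarrow> nat set" where
  "ints_over Q V = {m. 0 < m \<and> prime_factors m \<subseteq> Q \<and> (\<forall>q\<in>Q. multiplicity q m \<le> V)}"

lemma ints_over_empty [simp]: "ints_over {} V = {1}"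
  by (auto simp: ints_over_def prime_factorization_empty_iff)

lemma not_dvd_ints_over:
  assumes "m \<in> ints_over Q V" "prime q" "q \<notin> Q"
  shows "\<not> q dvd m"
  using assms by (auto simp: ints_over_def prime_factors_dvd)

lemma multiplicity_mult_prime_power:
  assumes "prime (q::nat)" "\<not> q dvd m" "m > 0" "prime r"
  shows "multiplicity r (m * q ^ v) = (if r = q then v else multiplicity r m)"
proof -
  have "multiplicity r (m * q ^ v) = multiplicity r m + v * multiplicity r q"
    using assms by (simp add: prime_elem_multiplicity_mult_distrib prime_elem_multiplicity_power_distrib)
  then show ?thesis using assms
    by (auto simp: not_dvd_imp_multiplicity_0 prime_multiplicity_other)
qed

lemma bij_betw_ints_over_insert:
  assumes "prime q" "q \<notin> Q" "\<And>r. r \<in> Q \<Longrightarrow> prime r"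
  shows "bij_betw (\<lambda>(m, v). m * q ^ v) (ints_over Q V \<times> {0..V}) (ints_over (insert q Q) V)"
proof (rule bij_betwI[where g = "\<lambda>m. (m div q ^ multiplicity q m, multiplicity q m)"])
  show "(\<lambda>(m, v). m * q ^ v) \<in> ints_over Q V \<times> {0..V} \<rightarrow> ints_over (insert q Q) V"
  proof clarify
    fix m v assume m: "m \<in> ints_over Q V" and v: "v \<in> {0..V}"
    have nd: "\<not> q dvd m" using not_dvd_ints_over[OF m] assms by blast
    have m0: "m > 0" using m by (auto simp: ints_over_def)
    have "prime_factors (m * q ^ v) \<subseteq> insert q Q"
    proof
      fix r assume "r \<in> prime_factors (m * q ^ v)"
      then have r: "prime r" "r dvd m \<or> r dvd q ^ v" by (auto simp: in_prime_factors_iff prime_dvd_mult_iff)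
      then consider "r dvd m" | "r = q"
        using assms(1) by (meson prime_dvd_power primes_dvd_imp_eq)
      then show "r \<in> insert q Q"
        by cases (use m m0 r in \<open>auto simp: ints_over_def in_prime_factors_iff\<close>)
    qed
    then show "m * q ^ v \<in> ints_over (insert q Q) V"
      using m v m0 assms nd
      by (auto simp: ints_over_def multiplicity_mult_prime_power prime_gt_0_nat)
  qed
  show "(\<lambda>m. (m div q ^ multiplicity q m, multiplicity q m)) \<in> ints_over (insert q Q) V \<rightarrow> ints_over Q V \<times> {0..V}"
  proof
    fix m assume m: "m \<in> ints_over (insert q Q) V"
    then have m0: "m > 0" by (auto simp: ints_over_def)
    obtain x where x: "m = q ^ multiplicity q m * x" "\<not> q dvd x"
      using multiplicity_decompose'[of m q] m0 assms(1) by (metis neq0_conv not_prime_unit)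
    have x0: "x > 0" using x m0 by (cases x) auto
    have x': "m div q ^ multiplicity q m = x"
      using x assms(1) by (metis nonzero_mult_div_cancel_left not_prime_0 power_not_zero)
    have mult: "multiplicity r m = multiplicity r x" if "r \<in> Q" for r
      using multiplicity_mult_prime_power[OF assms(1) x(2) x0 assms(3)[OF that], of "multiplicity q m"] x(1) that assms(2)
      by (metis mult.commute)
    have "prime_factors x \<subseteq> Q"
    proof
      fix r assume r: "r \<in> prime_factors x"
      then have "r \<noteq> q" using x by (auto simp: in_prime_factors_iff)
      moreover have "r \<in> prime_factors m" using r m0 x(1) by (metis dvd_prime_factors dvd_triv_right neq0_conv subsetD)
      ultimately show "r \<in> Q" using m by (auto simp: ints_over_def)
    qed
    then have "x \<in> ints_over Q V"
      using x0 mult m by (auto simp: ints_over_def)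
    then show "(m div q ^ multiplicity q m, multiplicity q m) \<in> ints_over Q V \<times> {0..V}"
      using x' m by (auto simp: ints_over_def)
  qed
next
  fix x assume "x \<in> ints_over Q V \<times> {0..V}"
  then obtain m v where x: "x = (m, v)" "m \<in> ints_over Q V" "v \<le> V" by auto
  have nd: "\<not> q dvd m" using not_dvd_ints_over[OF x(2)] assms by blast
  have "m > 0" using x by (auto simp: ints_over_def)
  then have "multiplicity q (m * q ^ v) = v"
    using multiplicity_mult_prime_power[OF assms(1) nd _ assms(1)] by simp
  then show "((case x of (m, v) \<Rightarrow> m * q ^ v) div q ^ multiplicity q (case x of (m, v) \<Rightarrow> m * q ^ v),
      multiplicity q (case x of (m, v) \<Rightarrow> m * q ^ v)) = x"
    using x assms(1) by (simp add: prime_gt_0_nat)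
next
  fix m assume "m \<in> ints_over (insert q Q) V"
  show "(case (m div q ^ multiplicity q m, multiplicity q m) of (m, v) \<Rightarrow> m * q ^ v) = m"
    by (simp add: multiplicity_dvd)
qed

lemma finite_ints_over:
  assumes "finite Q" "\<And>q. q \<in> Q \<Longrightarrow> prime q"
  shows "finite (ints_over Q V)"
  using assms
proof (induction Q rule: finite_induct)
  case (insert q Q)
  then show ?case
    using bij_betw_finite[OF bij_betw_ints_over_insert[of q Q V]] by auto
qed auto

text \<open>Peeling off one prime q replaces the weight \<Lambda> by m \<mapsto> \<Lambda> (m * q ^ v), to which the induction
  hypothesis applies again.\<close>
lemma sum_ints_over_le:
  fixes \<Lambda> :: "nat \<Rightarrow> real" and g :: "nat \<Rightarrow> nat \<Rightarrow> real" and \<epsilon> :: "nat \<Rightarrow> real"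
  assumes "finite Q" "\<And>q. q \<in> Q \<Longrightarrow> prime q" "V \<ge> 1"
    and nonneg: "\<And>m. \<Lambda> m \<ge> 0" "\<And>q v. g q v \<ge> 0"
    and g0: "\<And>q. g q 0 = 1" and g1: "\<And>q. g q 1 \<ge> 1"
    and \<epsilon>1: "\<And>q. q \<in> Q \<Longrightarrow> q \<notin> B \<Longrightarrow> (\<Sum>v=1..V. real (v+1) ^ k * g q v / real q ^ v) \<le> \<epsilon> q"
    and \<epsilon>2: "\<And>q. q \<in> Q \<Longrightarrow> q \<in> B \<Longrightarrow>
        2 ^ k * (g q 1 - 1) / real q + (\<Sum>v=2..V. real (v+1) ^ k * g q v / real q ^ v) \<le> \<epsilon> q"
    and \<Lambda>: "\<And>m q v. q \<in> Q \<Longrightarrow> m > 0 \<Longrightarrow> \<not> q dvd m \<Longrightarrow> \<Lambda> (m * q ^ v) \<le> real (v+1) ^ k * \<Lambda> m"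
  shows "(\<Sum>m\<in>ints_over Q V. (\<Prod>q\<in>Q. g q (multiplicity q m)) * \<Lambda> m / real m)
     \<le> (\<Prod>q\<in>Q. 1 + \<epsilon> q) * (\<Sum>m\<in>ints_over (Q \<inter> B) 1. \<Lambda> m / real m)"
  using assms(1,2) \<epsilon>1 \<epsilon>2 \<Lambda> nonneg(1)
proof (induction Q arbitrary: \<Lambda> rule: finite_induct)
  case empty
  then show ?case by simp
next
  case (insert p Q)
  note \<Lambda>_mult = insert.prems(4) and \<Lambda>_nonneg = insert.prems(5)
  have p: "prime p" and p0: "real p > 0" and primes: "\<And>q. q \<in> Q \<Longrightarrow> prime q"
    using insert.prems(1) by (auto simp: prime_gt_0_nat)
  define w where "w m = (\<Prod>q\<in>Q. g q (multiplicity q m))" for m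
  define P where "P = (\<Prod>q\<in>Q. 1 + \<epsilon> q)"
  define base where "base v = (\<Sum>m\<in>ints_over (Q \<inter> B) 1. \<Lambda> (m * p ^ v) / real m)" for v
  have \<epsilon>_nonneg: "\<epsilon> q \<ge> 0" if "q \<in> insert p Q" for q
  proof (cases "q \<in> B")
    case True
    have "0 \<le> 2 ^ k * (g q 1 - 1) / real q + (\<Sum>v=2..V. real (v+1) ^ k * g q v / real q ^ v)"
      using g1[of q] nonneg(2) by (intro add_nonneg_nonneg sum_nonneg) auto
    also have "\<dots> \<le> \<epsilon> q" using insert.prems(3)[OF that True] .
    finally show ?thesis .
  next
    case False
    have "0 \<le> (\<Sum>v=1..V. real (v+1) ^ k * g q v / real q ^ v)"
      using nonneg(2) by (intro sum_nonneg) auto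
    also have "\<dots> \<le> \<epsilon> q" using insert.prems(2)[OF that False] .
    finally show ?thesis .
  qed
  have P: "P \<ge> 0" unfolding P_def using \<epsilon>_nonneg by (intro prod_nonneg) (auto intro: add_nonneg_nonneg)
  have base_nonneg: "base v \<ge> 0" for v
    unfolding base_def using \<Lambda>_nonneg by (intro sum_nonneg) auto
  have base_le: "base v \<le> real (v+1) ^ k * base 0" for v
    unfolding base_def sum_distrib_left
  proof (intro sum_mono)
    fix m assume m: "m \<in> ints_over (Q \<inter> B) 1"
    have "\<not> p dvd m" using not_dvd_ints_over[OF m p] insert.hyps by blast
    then have "\<Lambda> (m * p ^ v) \<le> real (v+1) ^ k * \<Lambda> m"
      using m by (intro \<Lambda>_mult) (auto simp: ints_over_def)
    then show "\<Lambda> (m * p ^ v) / real m \<le> real (v+1) ^ k * (\<Lambda> (m * p ^ 0) / real m)"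
      by (simp add: divide_right_mono)
  qed
  have IH: "(\<Sum>m\<in>ints_over Q V. w m * \<Lambda> (m * p ^ v) / real m) \<le> P * base v" for v
    unfolding w_def P_def base_def
  proof (rule insert.IH[of "\<lambda>m. \<Lambda> (m * p ^ v)"])
    fix m q u assume q: "q \<in> Q" and m: "m > 0" "\<not> q dvd m"
    have "\<not> q dvd m * p ^ v"
      using q m p primes[OF q] insert.hyps by (metis prime_dvd_mult_iff prime_dvd_power primes_dvd_imp_eq)
    then have "\<Lambda> (m * p ^ v * q ^ u) \<le> real (u + 1) ^ k * \<Lambda> (m * p ^ v)"
      using q m p by (intro \<Lambda>_mult) (auto simp: prime_gt_0_nat)
    then show "\<Lambda> (m * q ^ u * p ^ v) \<le> real (u + 1) ^ k * \<Lambda> (m * p ^ v)"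
      by (simp add: ac_simps)
  qed (use insert.prems in auto)
  have "(\<Sum>m\<in>ints_over (insert p Q) V. (\<Prod>q\<in>insert p Q. g q (multiplicity q m)) * \<Lambda> m / real m)
      = (\<Sum>(m,v)\<in>ints_over Q V \<times> {0..V}.
          (\<Prod>q\<in>insert p Q. g q (multiplicity q (m * p ^ v))) * \<Lambda> (m * p ^ v) / real (m * p ^ v))"
    by (subst sum.reindex_bij_betw[OF bij_betw_ints_over_insert[OF p insert.hyps(2) primes], symmetric])
       (auto simp: split_def)
  also have "\<dots> = (\<Sum>(m,v)\<in>ints_over Q V \<times> {0..V}.
          g p v / real p ^ v * (w m * \<Lambda> (m * p ^ v) / real m))"
  proof (intro sum.cong refl, clarify)
    fix m v assume m: "m \<in> ints_over Q V"
    have nd: "\<not> p dvd m" using not_dvd_ints_over[OF m p] insert.hyps by blast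
    have "m > 0" using m by (auto simp: ints_over_def)
    then have mult: "multiplicity r (m * p ^ v) = (if r = p then v else multiplicity r m)" if "prime r" for r
      using multiplicity_mult_prime_power[OF p nd _ that] by simp
    have "(\<Prod>q\<in>insert p Q. g q (multiplicity q (m * p ^ v))) = g p v * w m"
      using insert.hyps p primes unfolding w_def by (auto simp: mult intro!: prod.cong arg_cong2[where f = "(*)"])
    then show "(\<Prod>q\<in>insert p Q. g q (multiplicity q (m * p ^ v))) * \<Lambda> (m * p ^ v) / real (m * p ^ v)
      = g p v / real p ^ v * (w m * \<Lambda> (m * p ^ v) / real m)"
      by (simp add: mult_ac)
  qed
  also have "\<dots> = (\<Sum>v=0..V. g p v / real p ^ v * (\<Sum>m\<in>ints_over Q V. w m * \<Lambda> (m * p ^ v) / real m))"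
    by (simp add: sum.cartesian_product[symmetric] sum_distrib_left) (subst sum.swap, simp)
  also have "\<dots> \<le> (\<Sum>v=0..V. g p v / real p ^ v * (P * base v))"
    using IH nonneg(2) p0 by (intro sum_mono mult_left_mono) auto
  also have "\<dots> = P * (\<Sum>v=0..V. g p v / real p ^ v * base v)"
    by (simp add: sum_distrib_left ac_simps)
  also have "\<dots> \<le> P * ((1 + \<epsilon> p) * (\<Sum>m\<in>ints_over (insert p Q \<inter> B) 1. \<Lambda> m / real m))"
  proof (rule mult_left_mono[OF _ P])
    have term_le: "g p v / real p ^ v * base v \<le> real (v+1) ^ k * g p v / real p ^ v * base 0" for v
      using mult_left_mono[OF base_le[of v], of "g p v / real p ^ v"] nonneg(2)[of p v] by (simp add: mult_ac)
    have split0: "(\<Sum>v=0..V. f v) = f 0 + (\<Sum>v=1..V. f v)" for f :: "nat \<Rightarrow> real"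
      by (simp add: sum.atLeast_Suc_atMost)
    have split1: "(\<Sum>v=1..V. f v) = f 1 + (\<Sum>v=2..V. f v)" for f :: "nat \<Rightarrow> real"
      using \<open>V \<ge> 1\<close> by (simp add: sum.atLeast_Suc_atMost numeral_2_eq_2)
    show "(\<Sum>v=0..V. g p v / real p ^ v * base v)
        \<le> (1 + \<epsilon> p) * (\<Sum>m\<in>ints_over (insert p Q \<inter> B) 1. \<Lambda> m / real m)"
    \<comment> \<open>A prime outside \<open>B\<close> vanishes from the right-hand side, so all
      powers v \<ge> 1 are charged to \<epsilon>. For a prime in \<open>B\<close> the term v = 0 and
      the part of v = 1 with weight 1 rebuild the squarefree sum in which p is allowed; only the
      excess \<open>g p 1 - 1\<close> and the powers v \<ge> 2 are charged.\<close>
    proof (cases "p \<in> B")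
      case False
      have "(\<Sum>v=0..V. g p v / real p ^ v * base v) \<le> base 0 + (\<Sum>v=1..V. real (v+1) ^ k * g p v / real p ^ v * base 0)"
        unfolding split0 using term_le g0 by (intro add_mono sum_mono) auto
      also have "\<dots> = (1 + (\<Sum>v=1..V. real (v+1) ^ k * g p v / real p ^ v)) * base 0"
        by (simp add: sum_distrib_right distrib_right)
      also have "\<dots> \<le> (1 + \<epsilon> p) * base 0"
        using insert.prems(2)[of p] False base_nonneg by (intro mult_right_mono) auto
      finally show ?thesis using False by (simp add: base_def)
    next
      case True
      have bij: "bij_betw (\<lambda>(m, v). m * p ^ v) (ints_over (Q \<inter> B) 1 \<times> {0..1})
          (ints_over (insert p Q \<inter> B) 1)"
        using bij_betw_ints_over_insert[of p "Q \<inter> B" 1] p primes insert.hyps True by simp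
      have new: "(\<Sum>m\<in>ints_over (insert p Q \<inter> B) 1. \<Lambda> m / real m) = base 0 + base 1 / real p"
      proof -
        have "(\<Sum>m\<in>ints_over (insert p Q \<inter> B) 1. \<Lambda> m / real m)
          = (\<Sum>(m,v)\<in>ints_over (Q \<inter> B) 1 \<times> {0..1}. \<Lambda> (m * p ^ v) / real (m * p ^ v))"
          by (subst sum.reindex_bij_betw[OF bij, symmetric]) (auto simp: split_def)
        also have "\<dots> = (\<Sum>m\<in>ints_over (Q \<inter> B) 1. \<Sum>v=0..1. \<Lambda> (m * p ^ v) / real (m * p ^ v))"
          by (subst sum.cartesian_product) simp
        also have "\<dots> = base 0 + base 1 / real p"
          by (simp add: base_def sum.distrib sum_divide_distrib)
        finally show ?thesis .
      qed
      have "(\<Sum>v=0..V. g p v / real p ^ v * base v)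
          = base 0 + base 1 / real p + ((g p 1 - 1) / real p * base 1 + (\<Sum>v=2..V. g p v / real p ^ v * base v))"
        unfolding split0 split1 using g0 p0 by (simp add: field_simps)
      also have "(g p 1 - 1) / real p * base 1 + (\<Sum>v=2..V. g p v / real p ^ v * base v)
          \<le> (g p 1 - 1) / real p * (2 ^ k * base 0) + (\<Sum>v=2..V. real (v+1) ^ k * g p v / real p ^ v * base 0)"
        using term_le base_le[of 1] g1[of p] p0 by (intro add_mono sum_mono mult_left_mono) auto
      also have "\<dots> = (2 ^ k * (g p 1 - 1) / real p + (\<Sum>v=2..V. real (v+1) ^ k * g p v / real p ^ v)) * base 0"
        by (simp only: distrib_right sum_distrib_right) (simp add: mult_ac)
      also have "\<dots> \<le> \<epsilon> p * base 0"
        using insert.prems(3)[of p] True base_nonneg by (intro mult_right_mono) auto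
      also have "\<dots> \<le> \<epsilon> p * (base 0 + base 1 / real p)"
        using \<epsilon>_nonneg base_nonneg[of 1] p0 by (intro mult_left_mono) auto
      finally show ?thesis unfolding new by (simp add: algebra_simps add_divide_distrib)
    qed
  qed
  finally show ?case using insert.hyps by (simp add: P_def mult_ac)
qed

section \<open>Rankin weights in Euler products\<close>

lemma sum_inverse_squares_tail_le:
  assumes "1 \<le> a" "a \<le> b"
  shows "(\<Sum>j\<in>{a<..b}. 1 / real j ^ 2) \<le> 1 / real a - 1 / real b"
  using assms(2)
proof (induction b rule: dec_induct)
  case (step b)
  have "1 / real (Suc b) ^ 2 \<le> 1 / real b - 1 / real (Suc b)"
  proof -
    have b: "real b > 0" using assms(1) step by simp
    have "1 / real (Suc b) ^ 2 \<le> 1 / (real b * real (Suc b))"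
      using b by (intro divide_left_mono) (auto simp: power2_eq_square)
    also have "\<dots> = 1 / real b - 1 / real (Suc b)" using b by (simp add: field_simps)
    finally show ?thesis .
  qed
  moreover have "{a<..Suc b} = insert (Suc b) {a<..b}" using step by auto
  ultimately show ?case using step by simp
qed auto

lemma sum_inverse_squares_le_2: "(\<Sum>j\<in>{1..n}. 1 / real j ^ 2) \<le> 2"
proof (cases "n = 0")
  case False
  then have "{1..n} = insert 1 {1<..n}" by auto
  then have "(\<Sum>j\<in>{1..n}. 1 / real j ^ 2) = 1 + (\<Sum>j\<in>{1<..n}. 1 / real j ^ 2)" by simp
  moreover have "1 / real n \<ge> 0" by simp
  moreover have "(\<Sum>j\<in>{1<..n}. 1 / real j ^ 2) \<le> 1 - 1 / real n"
    using sum_inverse_squares_tail_le[of 1 n] False by simp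
  ultimately show ?thesis by linarith
qed auto

lemma exp_minus_one_le: "0 \<le> (z::real) \<Longrightarrow> z \<le> 1/4 \<Longrightarrow> exp z \<le> 1 + 2 * z"
  using exp_bound[of z] mult_left_mono[of z 1 z] by (simp add: power2_eq_square)

text \<open>The first summand pays for v = 1 on \<open>B\<close>: a factor 2^k from \<Lambda> and 2
  from exp z - 1 \<le> 2z. The series bounds the higher powers, its ratio 3/4 being (3/2)/2, the
  worst case q = 2. The factor 8 is 4 * 2, from (2/q)^2 and from the sum of 1/q^2.\<close>

definition Rankin_const :: "nat \<Rightarrow> real" where
  "Rankin_const k = 2 * 2 ^ k + 8 * (\<Sum>v. real (v+1) ^ k * (3/4) ^ v)"

lemma summable_Rankin_const: "summable (\<lambda>v. real (v+1) ^ k * (3/4::real) ^ v)"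
proof (rule summable_comparison_test_bigo)
  show "summable (\<lambda>n. norm ((7/8::real) ^ n))" by simp
  show "(\<lambda>v. real (v+1) ^ k * (3/4::real) ^ v) \<in> O(\<lambda>n. (7/8) ^ n)" by real_asymp
qed

lemma Rankin_const_pos: "Rankin_const k > 0"
proof -
  have "(\<Sum>v. real (v+1) ^ k * (3/4::real) ^ v) \<ge> 0"
    by (intro suminf_nonneg summable_Rankin_const) auto
  then show ?thesis by (auto simp: Rankin_const_def intro: add_pos_nonneg)
qed

text \<open>The bound 1/4 keeps the factor at each prime at most exp (1/4) < 3/2, so that the powers of the
  prime 2 still contribute a convergent series.\<close>
lemma sum_Rankin_weight_le:
  fixes \<Lambda> :: "nat \<Rightarrow> real"
  assumes Q: "finite Q" "\<forall>q\<in>Q. prime q" and V: "V \<ge> 1" and \<Lambda>_nonneg: "\<forall>m. \<Lambda> m \<ge> 0"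
    and \<beta>: "\<forall>q. 0 \<le> \<beta> q \<and> \<beta> q * ln (real q) \<le> 1/4"
    and \<Lambda>: "\<forall>m q v. q \<in> Q \<longrightarrow> m > 0 \<longrightarrow> \<not> q dvd m \<longrightarrow> \<Lambda> (m * q ^ v) \<le> real (v+1) ^ k * \<Lambda> m"
  shows "(\<Sum>m\<in>ints_over Q V. (\<Prod>q\<in>Q. exp (\<beta> q * ln (real q) * real (multiplicity q m))) * \<Lambda> m / real m)
     \<le> exp (Rankin_const k * ((\<Sum>q\<in>Q \<inter> B. \<beta> q * ln (real q) / real q) + (\<Sum>q\<in>Q - B. 1 / real q) + 1)) *
        (\<Sum>m\<in>ints_over (Q \<inter> B) 1. \<Lambda> m / real m)"
proof -
  define C where "C = Rankin_const k"
  define C0 where "C0 = (\<Sum>v. real (v+1) ^ k * (3/4::real) ^ v)"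
  have fin_le: "(\<Sum>v\<in>A. real (v+1) ^ k * (3/4::real) ^ v) \<le> C0" if "finite A" for A
    unfolding C0_def using that by (intro sum_le_suminf summable_Rankin_const) auto
  have C0: "C0 > 0" using fin_le[of "{0}"] by simp
  have C: "C > 0" by (simp add: C_def Rankin_const_pos)
  have C_eq: "C = 2 * 2 ^ k + 8 * C0" by (simp add: C_def C0_def Rankin_const_def)
  define z where "z q = \<beta> q * ln (real q)" for q
  have z: "0 \<le> z q" "z q \<le> 1/4" for q
  proof -
    have "ln (real q) \<ge> 0" by (cases "q = 0") auto
    then show "0 \<le> z q" "z q \<le> 1/4" using \<beta> by (auto simp: z_def)
  qed
  define g where "g q v = exp (z q * real v)" for q v
  \<comment> \<open>Writing (3/2)/q = (2/q) * (3/4) extracts the decay in q, to the power j = 1 or j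
    = 2, and leaves a series independent of q.\<close>
  have tail: "real (v+1) ^ k * g q v / real q ^ v \<le> (2 / real q) ^ j * (real (v+1) ^ k * (3/4) ^ v)"
    if "q \<in> Q" "j \<le> v" for q v j
  proof -
    have q: "real q \<ge> 2" using Q that prime_ge_2_nat[of q] by auto
    have "exp (z q) \<le> 3/2" using exp_minus_one_le[OF z(1,2)[of q]] z(2)[of q] by linarith
    then have "g q v \<le> (3/2) ^ v"
      unfolding g_def by (metis exp_ge_zero exp_of_nat2_mult power_mono)
    then have "g q v / real q ^ v \<le> (3/2) ^ v / real q ^ v" using q by (intro divide_right_mono) auto
    also have "\<dots> = (2 / real q) ^ v * (3/4) ^ v"
      by (simp add: power_mult_distrib[symmetric] power_divide[symmetric])
    also have "\<dots> \<le> (2 / real q) ^ j * (3/4) ^ v"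
      using q that by (intro mult_right_mono power_decreasing) auto
    finally have "real (v+1) ^ k * (g q v / real q ^ v) \<le> real (v+1) ^ k * ((2 / real q) ^ j * (3/4) ^ v)"
      by (intro mult_left_mono) auto
    then show ?thesis by (simp add: mult_ac)
  qed
  \<comment> \<open>On \<open>B\<close> only the linear excess and a quadratic tail are paid; off
    \<open>B\<close> the full 1/q. The quadratic tails add up to at most \<open>C\<close>, which is
    the summand 1 in the exponent of the claim.\<close>
  define \<epsilon> where "\<epsilon> q = (if q \<in> B then C * (z q / real q) + 4 * C0 / real q ^ 2 else C / real q)" for q
  have "(\<Sum>m\<in>ints_over Q V. (\<Prod>q\<in>Q. g q (multiplicity q m)) * \<Lambda> m / real m)
   \<le> (\<Prod>q\<in>Q. 1 + \<epsilon> q) * (\<Sum>m\<in>ints_over (Q \<inter> B) 1. \<Lambda> m / real m)"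
  proof (rule sum_ints_over_le[where k = k])
    fix q assume q: "q \<in> Q" "q \<notin> B"
    have q2: "real q \<ge> 2" using Q q prime_ge_2_nat[of q] by auto
    have "(\<Sum>v=1..V. real (v+1) ^ k * g q v / real q ^ v) \<le> (\<Sum>v=1..V. (2 / real q) ^ 1 * (real (v+1) ^ k * (3/4) ^ v))"
      using q by (intro sum_mono tail) auto
    also have "\<dots> = 2 / real q * (\<Sum>v=1..V. real (v+1) ^ k * (3/4) ^ v)"
      by (simp add: sum_distrib_left)
    also have "\<dots> \<le> 2 / real q * C0" using q2 by (intro mult_left_mono fin_le) auto
    also have "\<dots> \<le> \<epsilon> q" using q q2 C0 by (simp add: \<epsilon>_def C_eq field_simps)
    finally show "(\<Sum>v=1..V. real (v+1) ^ k * g q v / real q ^ v) \<le> \<epsilon> q" .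
  next
    fix q assume q: "q \<in> Q" "q \<in> B"
    have q2: "real q \<ge> 2" using Q q prime_ge_2_nat[of q] by auto
    have "(\<Sum>v=2..V. real (v+1) ^ k * g q v / real q ^ v) \<le> (\<Sum>v=2..V. (2 / real q) ^ 2 * (real (v+1) ^ k * (3/4) ^ v))"
      using q by (intro sum_mono tail) auto
    also have "\<dots> = (2 / real q) ^ 2 * (\<Sum>v=2..V. real (v+1) ^ k * (3/4) ^ v)"
      by (simp add: sum_distrib_left)
    also have "\<dots> \<le> (2 / real q) ^ 2 * C0" using q2 by (intro mult_left_mono fin_le) auto
    finally have 1: "(\<Sum>v=2..V. real (v+1) ^ k * g q v / real q ^ v) \<le> 4 * C0 / real q ^ 2"
      by (simp add: power_divide)
    have "2 ^ k * (g q 1 - 1) \<le> 2 ^ k * (2 * z q)"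
      using exp_minus_one_le[OF z(1,2)[of q]] by (intro mult_left_mono) (auto simp: g_def)
    also have "\<dots> \<le> C * z q" using mult_right_mono[of "2 * 2 ^ k" C "z q"] C0 z(1)[of q] by (simp add: C_eq)
    finally have "2 ^ k * (g q 1 - 1) / real q \<le> C * (z q / real q)"
      using q2 by (simp add: divide_right_mono)
    then show "2 ^ k * (g q 1 - 1) / real q + (\<Sum>v=2..V. real (v+1) ^ k * g q v / real q ^ v) \<le> \<epsilon> q"
      using 1 q by (simp add: \<epsilon>_def)
  qed (use Q V \<Lambda>_nonneg \<Lambda> z in \<open>auto simp: g_def\<close>)
  also have "(\<Prod>q\<in>Q. 1 + \<epsilon> q) \<le> exp (C * ((\<Sum>q\<in>Q \<inter> B. \<beta> q * ln (real q) / real q) + (\<Sum>q\<in>Q - B. 1 / real q) + 1))"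
  proof -
    have \<epsilon>_nonneg: "\<epsilon> q \<ge> 0" for q using z(1)[of q] C C0 by (auto simp: \<epsilon>_def)
    have "(\<Prod>q\<in>Q. 1 + \<epsilon> q) \<le> (\<Prod>q\<in>Q. exp (\<epsilon> q))"
      using \<epsilon>_nonneg by (intro prod_mono) (auto intro: add_nonneg_nonneg)
    also have "\<dots> = exp (\<Sum>q\<in>Q. \<epsilon> q)" using Q by (simp add: exp_sum)
    also have "(\<Sum>q\<in>Q. \<epsilon> q) = (\<Sum>q\<in>Q \<inter> B. \<epsilon> q) + (\<Sum>q\<in>Q - B. \<epsilon> q)"
      using Q(1) by (metis Diff_disjoint Diff_Int2 Int_Diff_Un Int_Diff_disjoint finite_Diff finite_Int sum.union_disjoint)
    also have "(\<Sum>q\<in>Q - B. \<epsilon> q) = C * (\<Sum>q\<in>Q - B. 1 / real q)"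
      by (simp add: \<epsilon>_def sum_distrib_left)
    also have "(\<Sum>q\<in>Q \<inter> B. \<epsilon> q) = C * (\<Sum>q\<in>Q \<inter> B. \<beta> q * ln (real q) / real q) + 4 * C0 * (\<Sum>q\<in>Q \<inter> B. 1 / real q ^ 2)"
      by (simp add: \<epsilon>_def z_def sum_distrib_left sum.distrib)
    also have "4 * C0 * (\<Sum>q\<in>Q \<inter> B. 1 / real q ^ 2) \<le> 4 * C0 * 2"
    proof (intro mult_left_mono)
      have "(\<Sum>q\<in>Q \<inter> B. 1 / real q ^ 2) \<le> (\<Sum>q\<in>{1..Max (insert 1 (Q \<inter> B))}. 1 / real q ^ 2)"
      proof (intro sum_mono2)
        show "Q \<inter> B \<subseteq> {1..Max (insert 1 (Q \<inter> B))}" using Q prime_ge_1_nat by (auto intro!: Max_ge)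
      qed auto
      also have "\<dots> \<le> 2" by (rule sum_inverse_squares_le_2)
      finally show "(\<Sum>q\<in>Q \<inter> B. 1 / real q ^ 2) \<le> 2" .
    qed (use C0 in auto)
    also have "4 * C0 * 2 \<le> C" by (simp add: C_eq)
    finally show ?thesis by (simp add: algebra_simps)
  qed
  finally show ?thesis
    using \<Lambda>_nonneg by (simp add: g_def z_def C_def mult_right_mono sum_nonneg)
qed

section \<open>Volumes of unions of logarithmic boxes\<close>

declare One_nat_def [simp del]

abbreviation lborel_prod :: "nat \<Rightarrow> (nat \<Rightarrow> real) measure" where
  "lborel_prod k \<equiv> Pi\<^sub>M {1..k} (\<lambda>_. lborel)"

interpretation lborel_product: product_sigma_finite "\<lambda>_::nat. lborel :: real measure"
  by standard

lemma measurable_translation_PiM [measurable]: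
  "(\<lambda>\<omega>. \<lambda>i\<in>{1..k}. \<omega> i + c i) \<in> lborel_prod k \<rightarrow>\<^sub>M lborel_prod k"
  by (intro measurable_restrict) (auto intro!: borel_measurable_add measurable_compose[OF measurable_component_singleton])

text \<open>Points of the product space are undefined outside {1..k}, so the translate has to be
  restricted to stay in the space. It suffices to compare measures of boxes, where the
  one-dimensional invariance applies to each side.\<close>

lemma distr_translation_PiM:
  "distr (lborel_prod k) (lborel_prod k) (\<lambda>\<omega>. \<lambda>i\<in>{1..k}. \<omega> i + c i) = lborel_prod k"
proof (rule lborel_product.PiM_eqI)
  fix A :: "nat \<Rightarrow> real set"
  assume A: "\<And>i. i \<in> {1..k} \<Longrightarrow> A i \<in> sets lborel"
  have sets': "(\<lambda>x. x + c i) -` A i \<in> sets lborel" if "i \<in> {1..k}" for i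
    using A[OF that] measurable_sets[of "\<lambda>x. x + c i" lborel lborel "A i"] by simp
  have "(\<lambda>\<omega>. \<lambda>i\<in>{1..k}. \<omega> i + c i) -` Pi\<^sub>E {1..k} A \<inter> space (lborel_prod k)
      = Pi\<^sub>E {1..k} (\<lambda>i. (\<lambda>x. x + c i) -` A i)"
    by (auto simp: space_PiM PiE_iff)
  then have "emeasure (distr (lborel_prod k) (lborel_prod k) (\<lambda>\<omega>. \<lambda>i\<in>{1..k}. \<omega> i + c i)) (Pi\<^sub>E {1..k} A)
      = emeasure (lborel_prod k) (Pi\<^sub>E {1..k} (\<lambda>i. (\<lambda>x. x + c i) -` A i))"
    using A by (subst emeasure_distr) (auto intro!: sets_PiM_I_finite)
  also have "\<dots> = (\<Prod>i\<in>{1..k}. emeasure lborel ((\<lambda>x. x + c i) -` A i))"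
    using sets' by (intro lborel_product.emeasure_PiM) auto
  also have "\<dots> = (\<Prod>i\<in>{1..k}. emeasure lborel (A i))"
  proof (intro prod.cong refl)
    fix i assume i: "i \<in> {1..k}"
    have "emeasure lborel (A i) = emeasure (distr lborel borel (\<lambda>x. c i + x)) (A i)"
      by (simp add: lborel_distr_plus)
    also have "\<dots> = emeasure lborel ((\<lambda>x. c i + x) -` A i)"
      using A[OF i] by (subst emeasure_distr) auto
    also have "(\<lambda>x. c i + x) = (\<lambda>x. x + c i)" by (simp add: fun_eq_iff add.commute)
    finally show "emeasure lborel ((\<lambda>x. x + c i) -` A i) = emeasure lborel (A i)" by simp
  qed
  finally show "emeasure (distr (lborel_prod k) (lborel_prod k) (\<lambda>\<omega>. \<lambda>i\<in>{1..k}. \<omega> i + c i)) (Pi\<^sub>E {1..k} A)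
      = (\<Prod>i\<in>{1..k}. emeasure lborel (A i))" .
qed auto

lemma measure_translation_PiM:
  assumes "A \<in> sets (lborel_prod k)"
  shows "measure (lborel_prod k) ((\<lambda>\<omega>. \<lambda>i\<in>{1..k}. \<omega> i + c i) -` A \<inter> space (lborel_prod k))
    = measure (lborel_prod k) A"
  using measure_distr[OF measurable_translation_PiM assms, of c] unfolding distr_translation_PiM by (rule sym)

section \<open>The volume L as a function of a single integer\<close>

definition log_boxes :: "nat \<Rightarrow> (nat \<Rightarrow> nat) set \<Rightarrow> (nat \<Rightarrow> real) set" where
  "log_boxes k D = (\<Union>d\<in>D. Pi\<^sub>E {1..k} (\<lambda>i. {ln (real (d i) / 2)..<ln (real (d i))}))"

text \<open>For nondecreasing t this says that d_1 ... d_i divides the t_i-smooth part of m for every i,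
  as in the definition of L.\<close>
definition adm :: "nat \<Rightarrow> (nat \<Rightarrow> real) \<Rightarrow> nat \<Rightarrow> (nat \<Rightarrow> nat) set" where
  "adm k t m = {d. (\<forall>i\<in>{1..k}. 1 \<le> d i \<and> (\<forall>q\<in>prime_factors (d i). real q \<le> t i)) \<and> (\<Prod>i=1..k. d i) dvd m}"

text \<open>For t = y and m = a_1 ... a_k with a in P_*^k(y) this is L(a), see
  \<open>L_eq_L_smooth\<close>. Unlike L it makes sense for every m, prime powers included.\<close>

definition L_smooth :: "nat \<Rightarrow> (nat \<Rightarrow> real) \<Rightarrow> nat \<Rightarrow> real" where
  "L_smooth k t m = measure (lborel_prod k) (log_boxes k (adm k t m))"

text \<open>Tuples are functions on all of nat, so even a bounded \<open>D\<close> may be infinite.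
  The boxes depend only on the values on {1..k}, which leaves finitely many.\<close>

lemma log_boxes_finite_tuples:
  assumes "\<And>d i. d \<in> D \<Longrightarrow> i \<in> {1..k} \<Longrightarrow> d i \<le> N"
  shows "\<exists>D'. finite D' \<and> D' \<subseteq> (\<lambda>d. restrict d {1..k}) ` D \<and> log_boxes k D = log_boxes k D'"
proof (intro exI conjI)
  show "finite ((\<lambda>d. restrict d {1..k}) ` D)"
    by (rule finite_subset[of _ "Pi\<^sub>E {1..k} (\<lambda>_. {..N})"]) (use assms in \<open>auto intro!: finite_PiE\<close>)
  show "log_boxes k D = log_boxes k ((\<lambda>d. restrict d {1..k}) ` D)"
    unfolding log_boxes_def image_UN UN_simps by (auto simp: PiE_iff)
qed auto

lemma fmeasurable_log_boxes:
  assumes "\<And>d i. d \<in> D \<Longrightarrow> i \<in> {1..k} \<Longrightarrow> d i \<le> N"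
  shows "log_boxes k D \<in> fmeasurable (lborel_prod k)"
proof -
  obtain D' where D': "finite D'" "log_boxes k D = log_boxes k D'"
    using log_boxes_finite_tuples[of D k N] assms by blast
  have "Pi\<^sub>E {1..k} (\<lambda>i. {ln (real (d i) / 2)..<ln (real (d i))}) \<in> fmeasurable (lborel_prod k)" for d :: "nat \<Rightarrow> nat"
  proof (rule fmeasurableI)
    show "emeasure (lborel_prod k) (Pi\<^sub>E {1..k} (\<lambda>i. {ln (real (d i) / 2)..<ln (real (d i))})) < \<infinity>"
    proof (subst lborel_product.emeasure_PiM)
      have "emeasure lborel {a..<b} < top" for a b :: real
        by (cases "a \<le> b") auto
      then show "(\<Prod>i\<in>{1..k}. emeasure lborel {ln (real (d i) / 2)..<ln (real (d i))}) < \<infinity>"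
        by (auto simp: ennreal_prod_eq_top less_top[symmetric])
    qed auto
  qed (auto intro!: sets_PiM_I_finite)
  then have "log_boxes k D' \<in> fmeasurable (lborel_prod k)"
    unfolding log_boxes_def using D'(1) by (intro fmeasurable.finite_UN) auto
  then show ?thesis using D'(2) by simp
qed

lemma adm_le:
  assumes "d \<in> adm k t m" "i \<in> {1..k}" "m > 0"
  shows "d i \<le> m"
proof -
  have "d i dvd (\<Prod>i=1..k. d i)" using assms by (intro dvd_prodI) auto
  then show ?thesis using assms by (auto simp: adm_def intro!: dvd_imp_le intro: dvd_trans)
qed

lemma fmeasurable_adm: "m > 0 \<Longrightarrow> log_boxes k (adm k t m) \<in> fmeasurable (lborel_prod k)"
  by (rule fmeasurable_log_boxes[of _ _ m]) (auto intro: adm_le)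

lemma L_smooth_nonneg: "L_smooth k t m \<ge> 0"
  by (simp add: L_smooth_def)

text \<open>Removing the power q^(j_i) from each d_i leaves a tuple admissible for m and shifts the
  box by j_i ln q in coordinate i. As q does not divide m, the j_i add up to at most v, so at most
  (v+1)^k translates of the region for m cover the new region.\<close>

lemma L_smooth_mult_prime_power_le:
  assumes "prime q" "m > 0" "\<not> q dvd m"
  shows "L_smooth k t (m * q ^ v) \<le> real (v + 1) ^ k * L_smooth k t m"
proof -
  define M where "M = lborel_prod k"
  define J where "J = Pi\<^sub>E {1..k} (\<lambda>_. {0..v})"
  define A where "A = log_boxes k (adm k t m)"
  define tr where "tr j = (\<lambda>\<omega>. \<lambda>i\<in>{1..k}. \<omega> i + (- real (j i) * ln (real q)))" for j :: "nat \<Rightarrow> nat"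
  have A: "A \<in> fmeasurable M" unfolding A_def M_def using assms by (intro fmeasurable_adm)
  have finJ: "finite J" unfolding J_def by (intro finite_PiE) auto
  have q0: "q > 0" using assms(1) by (simp add: prime_gt_0_nat)
  have trA: "tr j -` A \<inter> space M \<in> fmeasurable M" "measure M (tr j -` A \<inter> space M) = measure M A" for j
  proof -
    have meas: "tr j \<in> M \<rightarrow>\<^sub>M M" unfolding tr_def M_def by (rule measurable_translation_PiM)
    show "measure M (tr j -` A \<inter> space M) = measure M A"
      unfolding M_def tr_def by (rule measure_translation_PiM) (use A in \<open>simp add: M_def fmeasurable_def\<close>)
    have "emeasure M (tr j -` A \<inter> space M) = emeasure (distr M M (tr j)) A"
      using A meas by (intro emeasure_distr[symmetric]) (auto simp: fmeasurable_def)
    also have "\<dots> = emeasure M A" unfolding M_def tr_def distr_translation_PiM ..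
    finally show "tr j -` A \<inter> space M \<in> fmeasurable M"
      using A meas by (auto simp: fmeasurable_def intro: measurable_sets)
  qed
  have sub: "log_boxes k (adm k t (m * q ^ v)) \<subseteq> (\<Union>j\<in>J. tr j -` A \<inter> space M)"
  proof
    fix \<omega> assume "\<omega> \<in> log_boxes k (adm k t (m * q ^ v))"
    then obtain d where d: "d \<in> adm k t (m * q ^ v)"
      and \<omega>: "\<omega> \<in> Pi\<^sub>E {1..k} (\<lambda>i. {ln (real (d i) / 2)..<ln (real (d i))})"
      by (auto simp: log_boxes_def)
    define j where "j = (\<lambda>i\<in>{1..k}. multiplicity q (d i))"
    define d' where "d' i = d i div q ^ multiplicity q (d i)" for i
    have dd': "d i = d' i * q ^ j i" if "i \<in> {1..k}" for i
      using that by (simp add: d'_def j_def multiplicity_dvd)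
    have d0: "d i > 0" if "i \<in> {1..k}" for i using d that unfolding adm_def by force
    have d'0: "d' i > 0" if "i \<in> {1..k}" for i using dd'[OF that] d0[OF that] by (cases "d' i") auto
    have nd: "\<not> q dvd d' i" if "i \<in> {1..k}" for i
      using multiplicity_decompose[of "d i" q] d0[OF that] assms(1) by (auto simp: d'_def)
    have prod_eq: "(\<Prod>i=1..k. d i) = (\<Prod>i=1..k. d' i) * q ^ (\<Sum>i=1..k. j i)"
    proof -
      have "(\<Prod>i=1..k. d i) = (\<Prod>i=1..k. d' i * q ^ j i)" using dd' by (intro prod.cong) auto
      then show ?thesis by (simp add: prod.distrib power_sum)
    qed
    have dvd: "(\<Prod>i=1..k. d' i) * q ^ (\<Sum>i=1..k. j i) dvd m * q ^ v"
      using d prod_eq by (auto simp: adm_def)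
    have cop: "coprime (\<Prod>i=1..k. d' i) (q ^ v)"
      using nd assms(1) by (intro prod_coprime_left) (auto intro: prime_imp_coprime coprime_commute[THEN iffD1])
    have "(\<Prod>i=1..k. d' i) dvd m"
      using dvd cop by (metis coprime_dvd_mult_left_iff dvd_mult_left)
    moreover have "real r \<le> t i" if "i \<in> {1..k}" "r \<in> prime_factors (d' i)" for i r
    proof -
      have "r \<in> prime_factors (d i)" using that d0[OF that(1)] dd'[OF that(1)]
        by (auto simp: in_prime_factors_iff)
      then show ?thesis using d that by (auto simp: adm_def)
    qed
    ultimately have d': "d' \<in> adm k t m" using d'0 by (auto simp: adm_def Suc_le_eq One_nat_def)
    have jv: "j i \<le> v" if "i \<in> {1..k}" for i
    proof -
      have "q ^ (\<Sum>i=1..k. j i) dvd m * q ^ v" using dvd by (metis dvd_mult_right)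
      moreover have "coprime (q ^ (\<Sum>i=1..k. j i)) m" using assms by (simp add: prime_imp_coprime)
      ultimately have "q ^ (\<Sum>i=1..k. j i) dvd q ^ v" by (simp add: coprime_dvd_mult_right_iff)
      then have "(\<Sum>i=1..k. j i) \<le> v" using assms(1) by (metis not_prime_unit not_prime_0 power_dvd_imp_le prime_gt_1_nat)
      moreover have "j i \<le> (\<Sum>i=1..k. j i)" using that by (intro member_le_sum) auto
      ultimately show ?thesis by simp
    qed
    have "tr j \<omega> \<in> Pi\<^sub>E {1..k} (\<lambda>i. {ln (real (d' i) / 2)..<ln (real (d' i))})"
    proof
      fix i assume i: "i \<in> {1..k}"
      have "ln (real (d i)) = ln (real (d' i)) + real (j i) * ln (real q)"
        using dd'[OF i] d'0[OF i] q0 by (simp add: ln_mult ln_realpow)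
      moreover have "ln (real (d i) / 2) = ln (real (d i)) - ln 2" "ln (real (d' i) / 2) = ln (real (d' i)) - ln 2"
        using d0[OF i] d'0[OF i] by (simp_all add: ln_div)
      moreover have "\<omega> i \<in> {ln (real (d i) / 2)..<ln (real (d i))}" using \<omega> i by auto
      ultimately show "tr j \<omega> i \<in> {ln (real (d' i) / 2)..<ln (real (d' i))}" using i by (auto simp: tr_def)
    qed (auto simp: tr_def)
    then have "tr j \<omega> \<in> A" using d' by (auto simp: A_def log_boxes_def)
    moreover have "\<omega> \<in> space M" using \<omega> by (auto simp: M_def space_PiM PiE_iff)
    moreover have "j \<in> J" using jv by (auto simp: J_def j_def)
    ultimately show "\<omega> \<in> (\<Union>j\<in>J. tr j -` A \<inter> space M)" by blast
  qed
  have "L_smooth k t (m * q ^ v) \<le> measure M (\<Union>j\<in>J. tr j -` A \<inter> space M)"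
    unfolding L_smooth_def M_def[symmetric]
  proof (rule measure_mono_fmeasurable[OF sub])
    show "log_boxes k (adm k t (m * q ^ v)) \<in> sets M"
      using fmeasurable_adm[of "m * q ^ v" k t] assms q0 by (auto simp: M_def fmeasurable_def)
    show "(\<Union>j\<in>J. tr j -` A \<inter> space M) \<in> fmeasurable M" using finJ trA by (intro fmeasurable.finite_UN) auto
  qed
  also have "\<dots> \<le> (\<Sum>j\<in>J. measure M (tr j -` A \<inter> space M))"
    using finJ trA by (intro measure_UNION_le) (auto simp: fmeasurable_def)
  also have "\<dots> = real (card J) * measure M A" using trA by simp
  also have "card J = (v + 1) ^ k" by (simp add: J_def card_PiE One_nat_def)
  finally show ?thesis by (simp add: L_smooth_def A_def M_def)
qed

text \<open>A box of side ln 2 containing u occupies volume (ln 2)^k of the cube of radius ln 2 about u, so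
  the point mass at u may be spread over that cube.\<close>
lemma sum_primes_in_log_boxes_le:
  assumes D: "\<And>d i. d \<in> D \<Longrightarrow> i \<in> {1..k} \<Longrightarrow> 1 \<le> d i \<and> d i \<le> N"
    and Q: "finite Q" "\<And>q. q \<in> Q \<Longrightarrow> prime q"
  shows "(\<Sum>p\<in>{p\<in>Pi\<^sub>E {1..k} (\<lambda>_. Q). (\<lambda>i\<in>{1..k}. s i - ln (real (p i))) \<in> log_boxes k D}.
      \<Prod>i=1..k. ln (real (p i)) / real (p i)) \<le> (24 / ln 2) ^ k * measure (lborel_prod k) (log_boxes k D)"
proof -
  define M where "M = lborel_prod k"
  define U where "U = log_boxes k D"
  define u where "u p = (\<lambda>i\<in>{1..k}. s i - ln (real (p i)))" for p :: "nat \<Rightarrow> nat"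
  define w where "w p = (\<Prod>i=1..k. ln (real (p i)) / real (p i))" for p :: "nat \<Rightarrow> nat"
  define cube where "cube p = Pi\<^sub>E {1..k} (\<lambda>i. {u p i - ln 2..u p i + ln 2})" for p
  define PP where "PP = {p\<in>Pi\<^sub>E {1..k} (\<lambda>_. Q). u p \<in> U}"
  have finPP: "finite PP" unfolding PP_def using Q(1) by (intro finite_subset[OF _ finite_PiE[of "{1..k}" "\<lambda>_. Q"]]) auto
  have U: "U \<in> fmeasurable M" unfolding U_def M_def using D by (intro fmeasurable_log_boxes) auto
  have cube: "cube p \<in> sets M" for p unfolding cube_def M_def by (auto intro!: sets_PiM_I_finite)
  have inter: "U \<inter> cube p \<in> fmeasurable M" for p using U cube by (intro fmeasurable_Int_fmeasurable) auto
  have w_nonneg: "w p \<ge> 0" if "p \<in> Pi\<^sub>E {1..k} (\<lambda>_. Q)" for p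
    unfolding w_def
  proof (intro prod_nonneg)
    fix i assume "i \<in> {1..k}"
    then have "prime (p i)" using that by (intro Q(2)) auto
    then show "0 \<le> ln (real (p i)) / real (p i)" using prime_ge_1_nat[of "p i"] by simp
  qed
  have vol: "ln 2 ^ k \<le> measure M (U \<inter> cube p)" if p: "p \<in> PP" for p
  proof -
    obtain d where d: "d \<in> D" "u p \<in> Pi\<^sub>E {1..k} (\<lambda>i. {ln (real (d i) / 2)..<ln (real (d i))})"
      using p unfolding PP_def U_def log_boxes_def by blast
    define Bx where "Bx = Pi\<^sub>E {1..k} (\<lambda>i. {ln (real (d i) / 2)..<ln (real (d i))})"
    have ln_half: "ln (real (d i) / 2) = ln (real (d i)) - ln 2" if "i \<in> {1..k}" for i
      using D[OF d(1) that] by (simp add: ln_div)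
    have "Bx \<subseteq> cube p"
      unfolding Bx_def cube_def
    proof (rule PiE_mono)
      fix i assume i: "i \<in> {1..k}"
      have "u p i \<in> {ln (real (d i) / 2)..<ln (real (d i))}" using d(2) i by auto
      then show "{ln (real (d i) / 2)..<ln (real (d i))} \<subseteq> {u p i - ln 2..u p i + ln 2}"
        using ln_half[OF i] by auto
    qed
    moreover have "Bx \<subseteq> U" using d by (auto simp: Bx_def U_def log_boxes_def)
    moreover have Bx_sets: "Bx \<in> sets M" unfolding Bx_def M_def by (auto intro!: sets_PiM_I_finite)
    ultimately have "measure M Bx \<le> measure M (U \<inter> cube p)"
      using inter by (intro measure_mono_fmeasurable) auto
    moreover have "measure M Bx = ln 2 ^ k"
    proof -
      have "emeasure M Bx = (\<Prod>i\<in>{1..k}. ennreal (ln 2))"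
        unfolding Bx_def M_def
        by (subst lborel_product.emeasure_PiM) (auto simp: ln_half intro!: prod.cong)
      also have "\<dots> = ennreal (ln 2 ^ k)" by (simp add: ennreal_power)
      finally show ?thesis by (simp add: measure_def)
    qed
    ultimately show ?thesis by simp
  qed
  have integ: "integrable M (indicator (U \<inter> cube p) :: _ \<Rightarrow> real)" for p
    using inter[of p] by (simp add: fmeasurable_def)
  have "ln 2 ^ k * (\<Sum>p\<in>PP. w p) \<le> (\<Sum>p\<in>PP. w p * measure M (U \<inter> cube p))"
    unfolding sum_distrib_left using vol w_nonneg by (intro sum_mono) (auto simp: PP_def mult.commute intro!: mult_left_mono)
  also have "\<dots> = (\<Sum>p\<in>PP. w p * (\<integral>v. indicator (U \<inter> cube p) v \<partial>M))"
    using inter by (intro sum.cong refl) (simp add: fmeasurable_def Int_absorb2 sets.sets_into_space)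
  also have "\<dots> = (\<integral>v. (\<Sum>p\<in>PP. w p * indicator (U \<inter> cube p) v) \<partial>M)"
    using integ by (subst Bochner_Integration.integral_sum) auto
  also have "\<dots> \<le> (\<integral>v. 24 ^ k * indicator U v \<partial>M)"
  proof (rule integral_mono)
    show "integrable M (\<lambda>v. \<Sum>p\<in>PP. w p * indicator (U \<inter> cube p) v)" using integ by auto
    show "integrable M (\<lambda>v. 24 ^ k * indicator U v :: real)" using U by (auto simp: fmeasurable_def)
    fix v assume v: "v \<in> space M"
    show "(\<Sum>p\<in>PP. w p * indicator (U \<inter> cube p) v) \<le> 24 ^ k * indicator U v"
    proof (cases "v \<in> U")
      case True
      \<comment> \<open>For a fixed v in the region, v in \<open>cube p\<close> confines each p_i
        separately to an interval of logarithmic length 2 ln 2. The weighted sum over p therefore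
        factors, and each factor is at most 24.\<close>
      define Qi where "Qi i = {q\<in>Q. \<bar>s i - ln (real q) - v i\<bar> \<le> ln 2}" for i
      have "(\<Sum>p\<in>PP. w p * indicator (U \<inter> cube p) v) = (\<Sum>p\<in>{p\<in>PP. v \<in> cube p}. w p)"
        using True finPP by (intro sum.mono_neutral_cong_right) (auto simp: indicator_def)
      also have "\<dots> \<le> (\<Sum>p\<in>Pi\<^sub>E {1..k} Qi. w p)"
      proof (intro sum_mono2)
        show "finite (Pi\<^sub>E {1..k} Qi)" using Q by (intro finite_PiE) (auto simp: Qi_def)
        show "{p\<in>PP. v \<in> cube p} \<subseteq> Pi\<^sub>E {1..k} Qi"
        proof
          fix p assume p: "p \<in> {p\<in>PP. v \<in> cube p}"
          then have pQ: "p \<in> Pi\<^sub>E {1..k} (\<lambda>_. Q)" and vc: "v \<in> cube p" by (auto simp: PP_def)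
          show "p \<in> Pi\<^sub>E {1..k} Qi"
          proof (rule PiE_I)
            fix i assume i: "i \<in> {1..k}"
            have "v i \<in> {u p i - ln 2..u p i + ln 2}" using vc i unfolding cube_def by blast
            then show "p i \<in> Qi i" using i pQ by (auto simp: Qi_def u_def abs_le_iff)
          qed (use pQ in auto)
        qed
        show "0 \<le> w p" if "p \<in> Pi\<^sub>E {1..k} Qi - {p\<in>PP. v \<in> cube p}" for p
          using that by (intro w_nonneg) (auto simp: Qi_def PiE_iff)
      qed
      also have "\<dots> = (\<Prod>i=1..k. \<Sum>q\<in>Qi i. ln (real q) / real q)"
        unfolding w_def using Q by (subst prod_sum_PiE) (auto simp: Qi_def)
      also have "\<dots> \<le> (\<Prod>i=1..k. 24)"
      proof (intro prod_mono conjI)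
        fix i
        show "0 \<le> (\<Sum>q\<in>Qi i. ln (real q) / real q)"
          using Q prime_ge_1_nat by (intro sum_nonneg) (force simp: Qi_def)
        define a where "a = exp (s i - v i - ln 2)"
        show "(\<Sum>q\<in>Qi i. ln (real q) / real q) \<le> 24"
        proof (rule sum_primes_ln_over_id_interval_le[of a])
          fix q assume q: "q \<in> Qi i"
          then have pr: "prime q" using Q by (auto simp: Qi_def)
          then have q0: "real q > 0" by (simp add: prime_gt_0_nat)
          have "s i - v i - ln 2 \<le> ln (real q)" "ln (real q) \<le> s i - v i - ln 2 + 2 * ln 2"
            using q by (auto simp: Qi_def abs_le_iff)
          then have "exp (s i - v i - ln 2) \<le> exp (ln (real q))" "exp (ln (real q)) \<le> exp (s i - v i - ln 2 + 2 * ln 2)"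
            by (simp_all only: exp_le_cancel_iff)
          then have "a \<le> real q" "real q \<le> a * exp (2 * ln 2)"
            unfolding a_def using q0 by (simp_all only: exp_ln exp_add)
          moreover have "exp (2 * ln 2) = (4::real)" by (simp add: exp_double)
          ultimately show "prime q \<and> a \<le> real q \<and> real q \<le> 4 * a" using pr by (simp add: mult.commute)
        qed (use Q in \<open>auto simp: a_def Qi_def\<close>)
      qed
      finally show ?thesis using True by simp
    qed (auto simp: sum_nonneg)
  qed
  also have "\<dots> = 24 ^ k * measure M U"
    using U by (simp add: fmeasurable_def Int_absorb2 sets.sets_into_space)
  finally have "(\<Sum>p\<in>PP. w p) \<le> (24 / ln 2) ^ k * measure M U"
    by (simp add: field_simps power_divide)
  then show ?thesis unfolding PP_def w_def u_def U_def M_def .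
qed

section \<open>Tuples in P_* and squarefree integers\<close>

definition primes_upto :: "real \<Rightarrow> nat set" where
  "primes_upto z = {q. prime q \<and> real q \<le> z}"

lemma finite_primes_upto [simp]: "finite (primes_upto z)"
  by (rule finite_subset[of _ "{..nat \<lfloor>z\<rfloor>}"]) (auto simp: primes_upto_def le_nat_floor)

lemma prime_primes_upto: "q \<in> primes_upto z \<Longrightarrow> prime q"
  by (simp add: primes_upto_def)

definition lower_end :: "(nat \<Rightarrow> real) \<Rightarrow> nat \<Rightarrow> real" where
  "lower_end y i = (if i = 1 then 1 else y (i - 1))"

lemma P_star_k_iff:
  "a \<in> P_star_k k y \<longleftrightarrow> (\<forall>i\<in>{1..k}. a i \<in> P_star (lower_end y i) (y i)) \<and> (\<forall>i. i \<notin> {1..k} \<longrightarrow> a i = 1)"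
  by (simp add: P_star_k_def lower_end_def)

text \<open>On squarefree m this is the inverse of a \<mapsto> a_1 ... a_k.\<close>
definition block :: "nat \<Rightarrow> (nat \<Rightarrow> real) \<Rightarrow> nat \<Rightarrow> nat \<Rightarrow> nat" where
  "block k y m i = (if i \<in> {1..k} then \<Prod>{q\<in>prime_factors m. lower_end y i < real q \<and> real q \<le> y i} else 1)"

lemma mono_upto:
  fixes y :: "nat \<Rightarrow> real"
  assumes "\<forall>i\<in>{1..<k}. y i \<le> y (i + 1)" "1 \<le> i" "i \<le> j" "j \<le> k"
  shows "y i \<le> y j"
  using assms(3,4)
proof (induction j rule: dec_induct)
  case (step j)
  then have "y j \<le> y (j + 1)" using assms(1,2) by auto
  then show ?case using step by (simp add: One_nat_def)
qed auto

lemma L_nonneg: "L k a \<ge> 0"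
  by (simp add: L_def)

lemma prod_primes_properties:
  assumes "finite A" "\<And>q. q \<in> A \<Longrightarrow> prime (q::nat)"
  shows "prime_factors (\<Prod>A) = A" "squarefree (\<Prod>A)" "\<Prod>A > 0"
proof -
  have "prime_factorization (\<Prod>A) = mset_set A"
    using prime_factorization_prod_mset_primes[of "mset_set A"] assms by (simp add: prod_unfold_prod_mset)
  then show "prime_factors (\<Prod>A) = A" using assms by simp
  show "\<Prod>A > 0" using assms by (auto intro!: prod_pos prime_gt_0_nat)
  show "squarefree (\<Prod>A)"
    using assms by (intro squarefree_prod_coprime) (auto simp: primes_coprime squarefree_prime)
qed

lemma ints_over_one_eq_prod:
  assumes "m \<in> ints_over Q 1"
  shows "\<Prod>(prime_factors m) = m"
proof -
  have m: "m > 0" "prime_factors m \<subseteq> Q" "\<forall>q\<in>Q. multiplicity q m \<le> 1"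
    using assms by (auto simp: ints_over_def)
  have "m = (\<Prod>q\<in>prime_factors m. q ^ multiplicity q m)" using m(1) by (rule prime_factorization_nat)
  also have "\<dots> = \<Prod>(prime_factors m)"
  proof (intro prod.cong refl)
    fix q assume q: "q \<in> prime_factors m"
    then have "multiplicity q m \<le> 1" using m by auto
    moreover have "multiplicity q m > 0"
      using q m(1) by (simp add: prime_factors_multiplicity)
    ultimately have "multiplicity q m = 1" by simp
    then show "q ^ multiplicity q m = q" by simp
  qed
  finally show ?thesis ..
qed

context
  fixes k :: nat and y :: "nat \<Rightarrow> real"
  assumes k: "k \<ge> 1" and y1: "y 1 \<ge> 1" and mono: "\<forall>i\<in>{1..<k}. y i \<le> y (i + 1)"
begin

lemmas ymono = mono_upto[OF mono]

lemma lower_end_ge: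
  assumes "i \<in> {1..k}" "j \<in> {1..k}" "i < j"
  shows "y i \<le> lower_end y j"
  using assms ymono[of i "j - 1"] by (auto simp: lower_end_def)

text \<open>The intervals (y_{i-1}, y_i] are disjoint. Two different tuples are allowed because
  injectivity of the product compares a block of one tuple with the blocks of another.\<close>

lemma P_star_k_coprime:
  assumes "a \<in> P_star_k k y" "a' \<in> P_star_k k y" "i \<in> {1..k}" "j \<in> {1..k}" "i \<noteq> j"
  shows "coprime (a i) (a' j)"
proof (rule ccontr)
  assume "\<not> coprime (a i) (a' j)"
  then have "gcd (a i) (a' j) \<noteq> 1" by (simp add: coprime_iff_gcd_eq_1)
  then obtain q where "prime q" "q dvd gcd (a i) (a' j)" using prime_factor_nat by blast
  then have q: "prime q" "q dvd a i" "q dvd a' j" by auto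
  have "a i \<in> P_star (lower_end y i) (y i)" "a' j \<in> P_star (lower_end y j) (y j)"
    using assms by (auto simp: P_star_k_iff)
  then have "lower_end y i < real q" "real q \<le> y i" "lower_end y j < real q" "real q \<le> y j"
    using q by (auto simp: P_star_def in_prime_factors_iff)
  moreover have "i < j \<or> j < i" using assms(5) by auto
  ultimately show False using lower_end_ge[of i j] lower_end_ge[of j i] assms(3,4) by auto
qed

lemma P_star_k_pos: "a \<in> P_star_k k y \<Longrightarrow> i \<in> {1..k} \<Longrightarrow> a i > 0"
  by (auto simp: P_star_k_iff P_star_def)

lemma inj_on_prod_P_star_k: "inj_on (\<lambda>a. \<Prod>i=1..k. a i) (P_star_k k y)"
proof (rule inj_onI)
  fix a a' assume a: "a \<in> P_star_k k y" "a' \<in> P_star_k k y" and eq: "(\<Prod>i=1..k. a i) = (\<Prod>i=1..k. a' i)"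
  have dvd: "b i dvd b' i"
    if b: "b \<in> P_star_k k y" "b' \<in> P_star_k k y" "(\<Prod>i=1..k. b i) = (\<Prod>i=1..k. b' i)" and i: "i \<in> {1..k}" for b b' i
  proof -
    have "b i dvd (\<Prod>i=1..k. b i)" using i by (intro dvd_prodI) auto
    also have "\<dots> = b' i * (\<Prod>j\<in>{1..k}-{i}. b' j)" unfolding b(3) using i by (intro prod.remove) auto
    finally have "b i dvd b' i * (\<Prod>j\<in>{1..k}-{i}. b' j)" .
    moreover have "coprime (b i) (\<Prod>j\<in>{1..k}-{i}. b' j)"
      using P_star_k_coprime[OF b(1,2) i] by (intro prod_coprime_right) auto
    ultimately show ?thesis by (simp add: coprime_dvd_mult_left_iff)
  qed
  show "a = a'"
  proof
    fix i show "a i = a' i"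
      using dvd[OF a eq, of i] dvd[OF a(2,1) eq[symmetric], of i] a
      by (cases "i \<in> {1..k}") (auto simp: P_star_k_iff intro: dvd_antisym)
  qed
qed

lemma block_P_star_k: "m > 0 \<Longrightarrow> block k y m \<in> P_star_k k y"
  unfolding P_star_k_iff
proof (intro conjI ballI allI impI)
  fix i assume i: "i \<in> {1..k}"
  show "block k y m i \<in> P_star (lower_end y i) (y i)"
  proof -
    define A where "A = {q\<in>prime_factors m. lower_end y i < real q \<and> real q \<le> y i}"
    have "finite A" "\<And>q. q \<in> A \<Longrightarrow> prime q" by (auto simp: A_def in_prime_factors_iff)
    note A = prod_primes_properties[OF this]
    have "block k y m i = \<Prod>A" using i by (simp add: block_def A_def)
    then show ?thesis unfolding P_star_def mem_Collect_eq using A by (simp add: A_def)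
  qed
qed (auto simp: block_def)

lemma prod_block:
  assumes "m \<in> ints_over (primes_upto (y k)) 1"
  shows "(\<Prod>i=1..k. block k y m i) = m"
proof -
  define A where "A i = {q\<in>prime_factors m. lower_end y i < real q \<and> real q \<le> y i}" for i
  have "(\<Prod>i=1..k. block k y m i) = (\<Prod>i\<in>{1..k}. \<Prod>(A i))"
    by (intro prod.cong) (auto simp: block_def A_def)
  also have "\<dots> = \<Prod>(\<Union>i\<in>{1..k}. A i)"
  proof (rule prod.UNION_disjoint[symmetric])
    show "\<forall>i\<in>{1..k}. \<forall>j\<in>{1..k}. i \<noteq> j \<longrightarrow> A i \<inter> A j = {}"
    proof (intro ballI impI)
      fix i j assume ij: "i \<in> {1..k}" "j \<in> {1..k}" "i \<noteq> j"
      then have "i < j \<or> j < i" by auto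
      then show "A i \<inter> A j = {}"
        using lower_end_ge[of i j] lower_end_ge[of j i] ij(1,2) by (fastforce simp: A_def)
    qed
  qed (auto simp: A_def)
  also have "(\<Union>i\<in>{1..k}. A i) = prime_factors m"
  proof (intro equalityI subsetI)
    fix q assume q: "q \<in> prime_factors m"
    have qk: "real q \<le> y k" using q assms by (auto simp: ints_over_def primes_upto_def)
    \<comment> \<open>The least i with q \<le> y_i names the block of q; minimality gives y_{i-1} <
      q, and for i = 1 the convention y_0 = 1 does.\<close>
    define i where "i = (LEAST i. 1 \<le> i \<and> real q \<le> y i)"
    have i: "1 \<le> i \<and> real q \<le> y i" unfolding i_def by (rule LeastI[of _ k]) (use k qk in auto)
    have ik: "i \<le> k" unfolding i_def by (rule Least_le) (use k qk in auto)
    have "lower_end y i < real q"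
    proof (cases "i = 1")
      case True
      then show ?thesis using q prime_gt_1_nat[of q] by (simp add: lower_end_def in_prime_factors_iff)
    next
      case False
      then have "\<not> (1 \<le> i - 1 \<and> real q \<le> y (i - 1))" unfolding i_def[symmetric]
        using not_less_Least[of "i - 1" "\<lambda>i. 1 \<le> i \<and> real q \<le> y i"] i by (auto simp: i_def[symmetric])
      then show ?thesis using False i by (auto simp: lower_end_def)
    qed
    then show "q \<in> (\<Union>i\<in>{1..k}. A i)" using q i ik by (auto simp: A_def)
  qed (auto simp: A_def)
  also have "\<Prod>(prime_factors m) = m" using assms by (rule ints_over_one_eq_prod)
  finally show ?thesis .
qed

lemma bij_betw_prod_P_star_k:
  "bij_betw (\<lambda>a. \<Prod>i=1..k. a i) (P_star_k k y) (ints_over (primes_upto (y k)) 1)"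
  unfolding bij_betw_def
proof (intro conjI equalityI subsetI)
  fix m assume "m \<in> (\<lambda>a. \<Prod>i=1..k. a i) ` P_star_k k y"
  then obtain a where a: "a \<in> P_star_k k y" "m = (\<Prod>i=1..k. a i)" by blast
  have m0: "m > 0" using a P_star_k_pos by (auto intro!: prod_pos)
  have sq: "squarefree m" unfolding a(2)
    using P_star_k_coprime[OF a(1) a(1)] a(1) by (intro squarefree_prod_coprime) (auto simp: P_star_k_iff P_star_def)
  have "multiplicity q m \<le> 1" if "prime q" for q
  proof (rule ccontr)
    assume "\<not> multiplicity q m \<le> 1"
    then have "q ^ 2 dvd m" by (intro multiplicity_dvd') auto
    then show False using sq squarefreeD[of m q] that not_prime_unit by blast
  qed
  moreover have "q \<in> primes_upto (y k)" if "q \<in> prime_factors m" for q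
  proof -
    have q: "prime q" "q dvd (\<Prod>i=1..k. a i)" using that a by (auto simp: in_prime_factors_iff)
    then obtain i where i: "i \<in> {1..k}" "q dvd a i" by (auto simp: prime_dvd_prod_iff)
    then have "q \<in> prime_factors (a i)" using P_star_k_pos[OF a(1) i(1)] q by (auto simp: in_prime_factors_iff)
    then have "real q \<le> y i" using a(1) i by (auto simp: P_star_k_iff P_star_def)
    then show ?thesis using ymono[of i k] i q by (auto simp: primes_upto_def)
  qed
  ultimately show "m \<in> ints_over (primes_upto (y k)) 1"
    using m0 prime_primes_upto by (auto simp: ints_over_def)
next
  fix m assume m: "m \<in> ints_over (primes_upto (y k)) 1"
  then have "m > 0" by (auto simp: ints_over_def)
  then show "m \<in> (\<lambda>a. \<Prod>i=1..k. a i) ` P_star_k k y"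
    using block_P_star_k[of m] prod_block[OF m] by (intro image_eqI[of _ _ "block k y m"]) simp_all
qed (rule inj_on_prod_P_star_k)

lemma finite_P_star_k: "finite (P_star_k k y)"
  using bij_betw_finite[OF bij_betw_prod_P_star_k]
    finite_ints_over[of "primes_upto (y k)" 1, OF finite_primes_upto prime_primes_upto] by (rule iffD2)

text \<open>A prime of d_i divides d_1 ... d_i, hence some a_j with j \<le> i, and is at most y_i.
  Conversely, if the primes of d_1, ..., d_i are at most y_i, they are coprime to a_{i+1}, ..., a_k,
  and these factors cancel from the divisibility for the full product.\<close>

lemma L_eq_L_smooth:
  assumes a: "a \<in> P_star_k k y"
  shows "L k a = L_smooth k y (\<Prod>i=1..k. a i)"
proof -
  have "{d. (\<forall>i\<in>{1..k}. 1 \<le> d i) \<and> (\<forall>i\<in>{1..k}. (\<Prod>j=1..i. d j) dvd (\<Prod>j=1..i. a j))}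
      = adm k y (\<Prod>i=1..k. a i)" (is "?A = _")
  proof (intro equalityI subsetI)
    fix d assume d: "d \<in> ?A"
    have "real q \<le> y i" if i: "i \<in> {1..k}" and q: "q \<in> prime_factors (d i)" for i q
    proof -
      have "q dvd (\<Prod>j=1..i. d j)" using q i by (intro dvd_trans[OF _ dvd_prodI[of "{1..i}" i d]]) (auto simp: in_prime_factors_iff)
      also have "\<dots> dvd (\<Prod>j=1..i. a j)" using d i by auto
      finally obtain j where j: "j \<in> {1..i}" "q dvd a j" using q by (auto simp: prime_dvd_prod_iff in_prime_factors_iff)
      have jk: "j \<in> {1..k}" using j i by auto
      have "q \<in> prime_factors (a j)" using P_star_k_pos[OF a jk] q j by (auto simp: in_prime_factors_iff)
      then have "real q \<le> y j" using a jk by (auto simp: P_star_k_iff P_star_def)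
      also have "\<dots> \<le> y i" using ymono[of j i] j i by auto
      finally show ?thesis .
    qed
    then show "d \<in> adm k y (\<Prod>i=1..k. a i)" using d k by (auto simp: adm_def)
  next
    fix d assume d: "d \<in> adm k y (\<Prod>i=1..k. a i)"
    have "(\<Prod>j=1..i. d j) dvd (\<Prod>j=1..i. a j)" if i: "i \<in> {1..k}" for i
    proof -
      have split: "(\<Prod>j=1..k. F j) = (\<Prod>j=1..i. F j) * (\<Prod>j\<in>{i<..k}. F j)" for F :: "nat \<Rightarrow> nat"
      proof -
        have "{1..k} = {1..i} \<union> {i<..k}" using i by auto
        then show ?thesis by (simp add: prod.union_disjoint ivl_disj_int)
      qed
      have "(\<Prod>j=1..i. d j) dvd (\<Prod>j=1..i. a j) * (\<Prod>j\<in>{i<..k}. a j)"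
        using d unfolding adm_def split by (auto dest: dvd_mult_left)
      moreover have "coprime (\<Prod>j=1..i. d j) (\<Prod>j\<in>{i<..k}. a j)"
      proof (intro prod_coprime_left prod_coprime_right, rule ccontr)
        fix j l assume jl: "j \<in> {1..i}" "l \<in> {i<..k}" and "\<not> coprime (d j) (a l)"
        then have "gcd (d j) (a l) \<noteq> 1" by (simp add: coprime_iff_gcd_eq_1)
        then obtain q where "prime q" "q dvd gcd (d j) (a l)" using prime_factor_nat by blast
        then have q: "prime q" "q dvd d j" "q dvd a l" by auto
        have jk: "j \<in> {1..k}" "l \<in> {1..k}" using jl i by auto
        have "d j > 0" using d jk(1) by (force simp: adm_def)
        then have "real q \<le> y j" using d jk q by (auto simp: adm_def in_prime_factors_iff)
        moreover have "lower_end y l < real q"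
          using a jk q P_star_k_pos[OF a jk(2)] by (auto simp: P_star_k_iff P_star_def in_prime_factors_iff)
        moreover have "y j \<le> lower_end y l" using jk jl by (intro lower_end_ge) auto
        ultimately show False by simp
      qed
      ultimately show ?thesis by (simp add: coprime_dvd_mult_left_iff)
    qed
    then show "d \<in> ?A" using d by (auto simp: adm_def)
  qed
  then show ?thesis unfolding L_def L_smooth_def log_boxes_def by simp
qed

lemma sum_P_star_k_eq:
  "(\<Sum>a\<in>P_star_k k y. L k a / real (\<Prod>i=1..k. a i))
    = (\<Sum>m\<in>ints_over (primes_upto (y k)) 1. L_smooth k y m / real m)"
proof -
  have "(\<Sum>a\<in>P_star_k k y. L k a / real (\<Prod>i=1..k. a i))
      = (\<Sum>a\<in>P_star_k k y. L_smooth k y (\<Prod>i=1..k. a i) / real (\<Prod>i=1..k. a i))"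
    by (intro sum.cong refl) (simp only: L_eq_L_smooth)
  then show ?thesis
    using sum.reindex_bij_betw[OF bij_betw_prod_P_star_k, of "\<lambda>m. L_smooth k y m / real m"] by simp
qed

end

section \<open>Extracting the largest primes\<close>

lemma smooth_rough_split:
  fixes w :: nat
  assumes "w > 0"
  obtains u v where "w = u * v" "\<And>q. q \<in> prime_factors u \<Longrightarrow> real q \<le> z" "\<And>q. q \<in> prime_factors v \<Longrightarrow> z < real q"
proof -
  define U where "U = filter_mset (\<lambda>q. real q \<le> z) (prime_factorization w)"
  define V where "V = filter_mset (\<lambda>q. \<not> real q \<le> z) (prime_factorization w)"
  have "w = prod_mset (prime_factorization w)" using assms by (simp add: prod_mset_prime_factorization_nat)
  also have "prime_factorization w = U + V" unfolding U_def V_def by (rule multiset_partition)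
  finally have eq: "w = prod_mset U * prod_mset V" by simp
  have UV: "prime_factorization (prod_mset U) = U" "prime_factorization (prod_mset V) = V"
    by (rule prime_factorization_prod_mset_primes; auto simp: U_def V_def in_prime_factors_iff)+
  show ?thesis
  proof (rule that[OF eq])
    show "real q \<le> z" if "q \<in> prime_factors (prod_mset U)" for q
      using that unfolding UV by (simp add: U_def)
    show "z < real q" if "q \<in> prime_factors (prod_mset V)" for q
      using that unfolding UV by (simp add: V_def)
  qed
qed

lemma sorting_bijection:
  fixes f :: "nat \<Rightarrow> nat"
  obtains \<sigma> where "bij_betw \<sigma> {1..n} {1..n}" "\<And>i j. 1 \<le> i \<Longrightarrow> i \<le> j \<Longrightarrow> j \<le> n \<Longrightarrow> f (\<sigma> i) \<le> f (\<sigma> j)"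
proof -
  define xs where "xs = sort_key f [1..<n+1]"
  have len: "length xs = n" by (simp add: xs_def)
  have "bij_betw (\<lambda>i. xs ! i) {..<n} {1..n}"
  proof (rule bij_betw_nth)
    show "{1..n} = set xs" by (auto simp: xs_def)
  qed (use len in \<open>auto simp: xs_def\<close>)
  moreover have "bij_betw (\<lambda>i. i - 1) {1..n} {..<n}"
    by (rule bij_betwI[where g = "\<lambda>i. i + 1"]) auto
  ultimately have bij: "bij_betw (\<lambda>i. xs ! (i - 1)) {1..n} {1..n}"
    using bij_betw_trans[of "\<lambda>i. i - 1" "{1..n}" "{..<n}" "\<lambda>i. xs ! i" "{1..n}"] by (simp add: comp_def)
  have "sorted (map f xs)" by (simp add: xs_def)
  then have "f (xs ! (i - 1)) \<le> f (xs ! (j - 1))" if "1 \<le> i" "i \<le> j" "j \<le> n" for i j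
    using sorted_nth_mono[of "map f xs" "i - 1" "j - 1"] that len by auto
  then show ?thesis using that bij by blast
qed

text \<open>With this value at k + 1, the complementary divisor n / (d_1 ... d_k) of an n in (X/2, X] lies
  between y_{k+1} and 2^(k+1) y_{k+1}.\<close>
definition y_ext :: "nat \<Rightarrow> (nat \<Rightarrow> real) \<Rightarrow> real \<Rightarrow> nat \<Rightarrow> real" where
  "y_ext k y X i = (if i \<le> k then y i else X / (2 ^ (k+1) * (\<Prod>i=1..k. y i)))"

definition localized :: "nat \<Rightarrow> (nat \<Rightarrow> real) \<Rightarrow> nat \<Rightarrow> bool" where
  "localized k y n \<longleftrightarrow>
     (\<exists>d::nat \<Rightarrow> nat. (\<forall>i\<in>{1..k}. 1 \<le> d i \<and> y i < real (d i) \<and> real (d i) \<le> 2 * y i) \<and> (\<Prod>i=1..k. d i) dvd n)"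

text \<open>For all other n the two largest of the k + 1 extracted primes differ, so the top one
  survives in the rough part b.\<close>

definition max_prime_square_dvd :: "nat \<Rightarrow> bool" where
  "max_prime_square_dvd n \<longleftrightarrow> (\<exists>p. prime p \<and> p ^ 2 dvd n \<and> (\<forall>q\<in>prime_factors n. q \<le> p))"

text \<open>Sorting by largest prime scrambles which divisor a prime belongs to, and \<sigma>
  records the origin. Pigeonhole arguments recover the comparison with y in both directions: an
  upper bound for P_j, and for each i some d'_j with j \<le> i that is large relative to P_i. The
  bound sqrt(y_i) is the strongest that also holds for the complementary divisor under the assumed
  lower bound on X.\<close>

lemma extract_largest_primes:
  fixes k n :: nat and y :: "nat \<Rightarrow> real" and X :: real and d :: "nat \<Rightarrow> nat"
  assumes k: "k \<ge> 1" and y1: "y 1 \<ge> 4" and mono: "\<forall>i\<in>{1..<k}. y i \<le> y (i + 1)"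
    and X: "2 ^ k * (\<Prod>i=1..k. y i) * sqrt (y k) \<le> X"
    and n: "X / 2 < real n" "real n \<le> X"
    and d: "\<forall>i\<in>{1..k}. 1 \<le> d i \<and> y i < real (d i) \<and> real (d i) \<le> 2 * y i" "(\<Prod>i=1..k. d i) dvd n"
    and no_tie: "\<not> max_prime_square_dvd n"
  shows "\<exists>\<sigma> P d' m b. \<sigma> \<in> {1..k} \<rightarrow> {1..k+1} \<and>
    (\<forall>j\<in>{1..k}. prime (P j) \<and> real (P j) \<le> 2 * y j \<and> y_ext k y X (\<sigma> j) < real (P j) * real (d' j) \<and>
        real (P j) * real (d' j) \<le> 2 ^ (k+1) * y_ext k y X (\<sigma> j)) \<and>
    d' \<in> adm k (\<lambda>i. 2 * y i) m \<and>
    (\<forall>i\<in>{1..k}. \<exists>j\<in>{1..i}. (\<forall>q\<in>prime_factors (d' j). q \<le> P i) \<and> sqrt (y i) / (2 * real (P i)) < real (d' j)) \<and>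
    n = (\<Prod>j=1..k. P j) * m * b \<and> b > 1 \<and> (\<forall>q\<in>prime_factors b. P k < q) \<and>
    m > 0 \<and> (\<forall>q\<in>prime_factors m. q \<le> P k)"
proof -
  note ymono = mono_upto[OF mono]
  have y4: "y i \<ge> 4" if "i \<in> {1..k}" for i using ymono[of 1 i] y1 that by auto
  define Y where "Y = (\<Prod>i=1..k. y i)"
  have Y: "Y > 0" unfolding Y_def using y4 by (intro prod_pos) (meson less_le_trans zero_less_numeral)
  define pd where "pd = (\<Prod>i=1..k. d i)"
  have pd: "Y \<le> real pd" "real pd \<le> 2 ^ k * Y"
  proof -
    have "0 \<le> y i \<and> y i \<le> real (d i)" if "i \<in> {1..k}" for i using d(1) y4[OF that] that by fastforce
    then have "(\<Prod>i=1..k. y i) \<le> (\<Prod>i=1..k. real (d i))" by (intro prod_mono)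
    then show "Y \<le> real pd" by (simp add: Y_def pd_def)
    have "(\<Prod>i=1..k. real (d i)) \<le> (\<Prod>i=1..k. 2 * y i)" using d by (intro prod_mono) auto
    then show "real pd \<le> 2 ^ k * Y" by (simp add: Y_def pd_def prod.distrib)
  qed
  define D where "D i = (if i \<le> k then d i else n div pd)" for i
  have prod_last: "(\<Prod>j=1..k+1. F j) = (\<Prod>j=1..k. F j) * F (k+1)" for F :: "nat \<Rightarrow> nat"
    by (simp add: One_nat_def)
  have prodD: "(\<Prod>i=1..k+1. D i) = n"
  proof -
    have "(\<Prod>i=1..k+1. D i) = (\<Prod>i=1..k. D i) * D (k+1)" by (rule prod_last)
    also have "(\<Prod>i=1..k. D i) = pd" unfolding pd_def D_def by (intro prod.cong) auto
    finally show ?thesis using d(2) by (simp add: D_def pd_def)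
  qed
  have "D (k+1) * pd = n" using d(2) by (simp add: D_def pd_def)
  then have n_last: "real n = real (D (k+1)) * real pd" by (metis of_nat_mult)
  define yy where "yy = y_ext k y X"
  have yy_last: "yy (k+1) = X / (2 ^ (k+1) * Y)" by (simp add: yy_def y_ext_def Y_def)
  have yy_ge: "yy j \<ge> sqrt (y i) / 2" if "1 \<le> i" "i \<le> k" "i \<le> j" "j \<le> k+1" for i j
  proof (cases "j \<le> k")
    case True
    have "sqrt (y i) \<le> y i" using y4[of i] that mult_left_mono[of 1 "y i" "y i"]
      by (intro real_le_lsqrt) (auto simp: power2_eq_square)
    then have "sqrt (y i) / 2 \<le> y i" using y4[of i] that by auto
    also have "\<dots> \<le> y j" using ymono[of i j] that True by auto
    finally show ?thesis using True by (simp add: yy_def y_ext_def)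
  next
    case False
    then have j: "j = k + 1" using that by simp
    have "sqrt (y i) / 2 \<le> sqrt (y k) / 2" using ymono[of i k] that by simp
    also have "\<dots> \<le> X / (2 ^ (k+1) * Y)" using X Y by (simp add: field_simps power_add Y_def)
    finally show ?thesis by (simp add: j yy_last)
  qed
  have D_bounds: "yy i < real (D i)" "real (D i) \<le> 2 ^ (k+1) * yy i" if "i \<in> {1..k+1}" for i
  proof -
    show "yy i < real (D i)"
    proof (cases "i \<le> k")
      case True
      then show ?thesis using d that by (auto simp: D_def yy_def y_ext_def)
    next
      case False
      then have i: "i = k+1" using that by simp
      have "X < 2 * real n" using n by simp
      also have "real n = real (D i) * real pd" using n_last i by simp
      also have "\<dots> \<le> real (D i) * (2 ^ k * Y)" using pd by (intro mult_left_mono) auto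
      finally show ?thesis unfolding i yy_last using Y by (simp add: field_simps power_add)
    qed
    show "real (D i) \<le> 2 ^ (k+1) * yy i"
    proof (cases "i \<le> k")
      case True
      then have "real (D i) \<le> 2 * y i" using d that by (auto simp: D_def)
      also have "\<dots> \<le> 2 ^ (k+1) * y i" using y4[of i] True that by (intro mult_right_mono) (auto simp: power_add)
      finally show ?thesis using True by (simp add: yy_def y_ext_def)
    next
      case False
      then have i: "i = k+1" using that by simp
      have "real (D i) * Y \<le> real (D i) * real pd" using pd by (intro mult_left_mono) auto
      also have "\<dots> = real n" using n_last i by simp
      also have "\<dots> \<le> X" by fact
      finally show ?thesis unfolding i yy_last using Y by (simp add: field_simps power_add)
    qed
  qed
  \<comment> \<open>Here y_1 \<ge> 4 enters: every factor exceeds sqrt(y_1)/2 \<ge> 1 and so has a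
    largest prime.\<close>
  have D1: "D i > 1" if "i \<in> {1..k+1}" for i
  proof -
    have "1 \<le> sqrt (y 1) / 2" using y1 real_le_rsqrt[of 2 "y 1"] by simp
    also have "\<dots> \<le> yy i" using yy_ge[of 1 i] that k by auto
    also have "\<dots> < real (D i)" using D_bounds[OF that] by simp
    finally show ?thesis by simp
  qed
  define f where "f i = Max (prime_factors (D i))" for i
  have f: "prime (f i)" "f i dvd D i" "\<And>q. q \<in> prime_factors (D i) \<Longrightarrow> q \<le> f i" if "i \<in> {1..k+1}" for i
  proof -
    have "prime_factors (D i) \<noteq> {}" using D1[OF that] by (auto simp: prime_factorization_empty_iff)
    then have "f i \<in> prime_factors (D i)" unfolding f_def by (intro Max_in) auto
    then show "prime (f i)" "f i dvd D i" by (auto simp: in_prime_factors_iff)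
    show "q \<le> f i" if "q \<in> prime_factors (D i)" for q unfolding f_def using that by (intro Max_ge) auto
  qed
  obtain \<sigma> where \<sigma>: "bij_betw \<sigma> {1..k+1} {1..k+1}"
    and sorted: "\<And>i j. 1 \<le> i \<Longrightarrow> i \<le> j \<Longrightarrow> j \<le> k+1 \<Longrightarrow> f (\<sigma> i) \<le> f (\<sigma> j)"
    using sorting_bijection[of "k+1" f] by blast
  have \<sigma>_in: "\<sigma> j \<in> {1..k+1}" if "j \<in> {1..k+1}" for j using \<sigma> that by (auto simp: bij_betw_def)
  have \<sigma>_inj: "inj_on \<sigma> {1..k+1}" using \<sigma> by (simp add: bij_betw_def)
  define P where "P j = f (\<sigma> j)" for j
  define d' where "d' j = D (\<sigma> j) div P j" for j
  have P: "prime (P j)" "D (\<sigma> j) = P j * d' j" "\<And>q. q \<in> prime_factors (D (\<sigma> j)) \<Longrightarrow> q \<le> P j"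
    if "j \<in> {1..k+1}" for j
    using f[OF \<sigma>_in[OF that]] by (auto simp: P_def d'_def)
  have P_le: "P i \<le> P j" if "1 \<le> i" "i \<le> j" "j \<le> k+1" for i j using sorted[OF that] by (simp add: P_def)
  have d'0: "d' j > 0" if "j \<in> {1..k+1}" for j
    using P(2)[OF that] D1[OF \<sigma>_in[OF that]] by (cases "d' j") auto
  have d'_smooth: "q \<le> P j" if "j \<in> {1..k+1}" "q \<in> prime_factors (d' j)" for j q
  proof (rule P(3)[OF that(1)])
    have "prime_factors (d' j) \<subseteq> prime_factors (D (\<sigma> j))"
    proof (rule dvd_prime_factors)
      show "D (\<sigma> j) \<noteq> 0" using D1[OF \<sigma>_in[OF that(1)]] by simp
      show "d' j dvd D (\<sigma> j)" unfolding P(2)[OF that(1)] by simp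
    qed
    then show "q \<in> prime_factors (D (\<sigma> j))" using that(2) by blast
  qed
  have n_eq: "n = (\<Prod>j=1..k. P j) * (\<Prod>j=1..k. d' j) * D (\<sigma> (k+1))"
  proof -
    have "n = (\<Prod>j=1..k+1. D (\<sigma> j))"
      using prod.reindex_bij_betw[OF \<sigma>, of D] prodD by simp
    also have "\<dots> = (\<Prod>j=1..k. D (\<sigma> j)) * D (\<sigma> (k+1))" by (rule prod_last)
    also have "(\<Prod>j=1..k. D (\<sigma> j)) = (\<Prod>j=1..k. P j * d' j)" using P(2) by (intro prod.cong) auto
    finally show ?thesis by (simp add: prod.distrib)
  qed
  \<comment> \<open>A tie at the top would put the square of the largest prime of n into the product
    of the two last factors. Ties among smaller primes are harmless.\<close>
  have P_strict: "P k < P (k+1)"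
  proof (rule ccontr)
    assume "\<not> P k < P (k+1)"
    then have eq: "P k = P (k+1)" using P_le[of k "k+1"] k by simp
    have "D (\<sigma> k) * D (\<sigma> (k+1)) dvd (\<Prod>j=1..k+1. D (\<sigma> j))"
    proof -
      have "D (\<sigma> k) dvd (\<Prod>j=1..k. D (\<sigma> j))" using k by (intro dvd_prodI) auto
      then show ?thesis unfolding prod_last by (intro mult_dvd_mono) auto
    qed
    moreover have "P k * P k dvd D (\<sigma> k) * D (\<sigma> (k+1))"
      using P(2)[of k] P(2)[of "k+1"] k eq by (intro mult_dvd_mono) auto
    moreover have prodn: "(\<Prod>j=1..k+1. D (\<sigma> j)) = n"
      using prod.reindex_bij_betw[OF \<sigma>, of D] prodD by simp
    ultimately have "P k ^ 2 dvd n" by (metis dvd_trans power2_eq_square)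
    moreover have "\<forall>q\<in>prime_factors n. q \<le> P k"
    proof
      fix q assume "q \<in> prime_factors n"
      then have q: "prime q" "q dvd (\<Prod>j=1..k+1. D (\<sigma> j))" using prodn by (auto simp: in_prime_factors_iff)
      then obtain j where j: "j \<in> {1..k+1}" "q dvd D (\<sigma> j)" by (auto simp: prime_dvd_prod_iff)
      then have "q \<in> prime_factors (D (\<sigma> j))" using q D1[OF \<sigma>_in[OF j(1)]] by (auto simp: in_prime_factors_iff)
      then have "q \<le> P j" using P(3)[OF j(1)] by simp
      also have "\<dots> \<le> P (k+1)" using P_le[of j "k+1"] j by auto
      finally show "q \<le> P k" using eq by simp
    qed
    ultimately have "max_prime_square_dvd n" using P(1)[of k] k by (auto simp: max_prime_square_dvd_def)
    then show False using no_tie by simp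
  qed
  have Dlast: "D (\<sigma> (k+1)) > 0" using D1[OF \<sigma>_in[of "k+1"]] by simp
  \<comment> \<open>The last factor may also contain primes up to P_k. They go into m, and the rest
    v serves as b; it is divisible by P_{k+1} > P_k, hence b > 1.\<close>
  obtain u v where uv: "D (\<sigma> (k+1)) = u * v" "\<And>q. q \<in> prime_factors u \<Longrightarrow> real q \<le> real (P k)"
      "\<And>q. q \<in> prime_factors v \<Longrightarrow> real (P k) < real q"
    using smooth_rough_split[OF Dlast, of "real (P k)"] by blast
  have uv0: "u > 0" "v > 0" using uv(1) Dlast by auto
  define m where "m = (\<Prod>j=1..k. d' j) * u"
  have m0: "m > 0" unfolding m_def using d'0 uv0 by (auto intro!: prod_pos)
  have v1: "v > 1"
  proof -
    have "P (k+1) dvd u * v" using P(2)[of "k+1"] uv(1) by (metis atLeastAtMost_iff dvd_triv_left le_add2 order_refl)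
    then have "P (k+1) dvd u \<or> P (k+1) dvd v" using P(1)[of "k+1"] by (simp add: prime_dvd_mult_iff)
    moreover have "\<not> P (k+1) dvd u"
      using uv(2)[of "P (k+1)"] P(1)[of "k+1"] uv0 P_strict by (auto simp: in_prime_factors_iff)
    ultimately have "P (k+1) dvd v" by simp
    then have "P (k+1) \<le> v" using uv0 by (intro dvd_imp_le)
    then show ?thesis using P(1)[of "k+1"] prime_gt_1_nat[of "P (k+1)"] by auto
  qed
  have m_smooth: "q \<le> P k" if "q \<in> prime_factors m" for q
  proof -
    have q: "prime q" "q dvd (\<Prod>j=1..k. d' j) \<or> q dvd u"
      using that by (auto simp: in_prime_factors_iff m_def prime_dvd_mult_iff)
    from q(2) show ?thesis
    proof
      assume "q dvd u"
      then show ?thesis using uv(2)[of q] q uv0 by (auto simp: in_prime_factors_iff)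
    next
      assume "q dvd (\<Prod>j=1..k. d' j)"
      then obtain j where j: "j \<in> {1..k}" "q dvd d' j" using q(1) by (auto simp: prime_dvd_prod_iff)
      then have "q \<le> P j" using d'_smooth[of j q] d'0[of j] q(1) by (auto simp: in_prime_factors_iff)
      also have "\<dots> \<le> P k" using P_le[of j k] j by auto
      finally show ?thesis .
    qed
  qed
  \<comment> \<open>The k + 2 - j positions j, ..., k+1 cannot all be sent to the k + 1 - j indices
    above j. So some l \<ge> j has \<sigma> l \<le> j, and P_j \<le> P_l \<le> 2 y_j. The index
    \<sigma> l is at most k, so the complementary divisor, which is not bounded in terms of y, is
    avoided.\<close>
  have P_le_2y: "real (P j) \<le> 2 * y j" if j: "j \<in> {1..k}" for j
  proof -
    have "\<exists>l\<in>{j..k+1}. \<sigma> l \<le> j"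
    proof (rule ccontr)
      assume "\<not> ?thesis"
      then have "\<sigma> ` {j..k+1} \<subseteq> {j+1..k+1}" using \<sigma>_in j by force
      then have "card (\<sigma> ` {j..k+1}) \<le> card {j+1..k+1}" by (intro card_mono) auto
      moreover have "card (\<sigma> ` {j..k+1}) = card {j..k+1}"
        using j by (intro card_image inj_on_subset[OF \<sigma>_inj]) auto
      ultimately show False using j by auto
    qed
    then obtain l where l: "l \<in> {j..k+1}" "\<sigma> l \<le> j" by blast
    have \<sigma>l: "\<sigma> l \<in> {1..k}" using \<sigma>_in[of l] l j by auto
    have "P j \<le> P l" using P_le[of j l] l j by auto
    also have "P l \<le> D (\<sigma> l)"
    proof (rule dvd_imp_le)
      have l': "l \<in> {1..k+1}" using l j by auto
      show "P l dvd D (\<sigma> l)" unfolding P(2)[OF l'] by simp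
      show "D (\<sigma> l) > 0" using D1[OF \<sigma>_in[OF l']] by simp
    qed
    finally have "real (P j) \<le> real (D (\<sigma> l))" by simp
    also have "\<dots> \<le> 2 * y (\<sigma> l)" using d \<sigma>l by (auto simp: D_def)
    also have "\<dots> \<le> 2 * y j" using ymono[of "\<sigma> l" j] \<sigma>l l j by auto
    finally show ?thesis .
  qed
  have adm: "d' \<in> adm k (\<lambda>i. 2 * y i) m"
  proof -
    have "real q \<le> 2 * y i" if "i \<in> {1..k}" "q \<in> prime_factors (d' i)" for i q
    proof -
      have "real q \<le> real (P i)" using d'_smooth[of i q] that by auto
      also note P_le_2y[OF that(1)]
      finally show ?thesis .
    qed
    moreover have "1 \<le> d' i" if "i \<in> {1..k}" for i using d'0[of i] that by (simp add: Suc_le_eq One_nat_def)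
    ultimately show ?thesis by (simp add: adm_def m_def)
  qed
  have ex_large: "\<exists>j\<in>{1..i}. (\<forall>q\<in>prime_factors (d' j). q \<le> P i) \<and> sqrt (y i) / (2 * real (P i)) < real (d' j)"
    if i: "i \<in> {1..k}" for i
  proof -
    have "\<exists>l\<in>{1..i}. \<sigma> l \<ge> i"
    proof (rule ccontr)
      assume "\<not> ?thesis"
      then have "\<sigma> ` {1..i} \<subseteq> {1..<i}" using \<sigma>_in i by force
      then have "card (\<sigma> ` {1..i}) \<le> card {1..<i}" by (intro card_mono) auto
      moreover have "card (\<sigma> ` {1..i}) = card {1..i}"
        using i by (intro card_image inj_on_subset[OF \<sigma>_inj]) auto
      ultimately show False using i by auto
    qed
    then obtain l where l: "l \<in> {1..i}" "\<sigma> l \<ge> i" by blast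
    have l': "l \<in> {1..k+1}" using l i by auto
    have Pl: "P l \<le> P i" using P_le[of l i] l i by auto
    have P0: "real (P i) > 0" using P(1)[of i] i prime_gt_0_nat[of "P i"] by auto
    have "sqrt (y i) / 2 \<le> yy (\<sigma> l)" using yy_ge[of i "\<sigma> l"] i l \<sigma>_in[OF l'] by auto
    also have "\<dots> < real (D (\<sigma> l))" using D_bounds[OF \<sigma>_in[OF l']] by simp
    also have "\<dots> = real (P l) * real (d' l)" using P(2)[OF l'] by simp
    also have "\<dots> \<le> real (P i) * real (d' l)" using Pl by (intro mult_right_mono) auto
    finally have "sqrt (y i) / (2 * real (P i)) < real (d' l)" using P0 by (simp add: field_simps)
    moreover have "\<forall>q\<in>prime_factors (d' l). q \<le> P i" using d'_smooth[OF l'] Pl by (meson order_trans)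
    ultimately show ?thesis using l by blast
  qed
  have "\<forall>j\<in>{1..k}. prime (P j) \<and> real (P j) \<le> 2 * y j \<and> y_ext k y X (\<sigma> j) < real (P j) * real (d' j) \<and>
        real (P j) * real (d' j) \<le> 2 ^ (k+1) * y_ext k y X (\<sigma> j)"
  proof
    fix j assume j: "j \<in> {1..k}"
    then have j': "j \<in> {1..k+1}" by auto
    have "real (D (\<sigma> j)) = real (P j) * real (d' j)" using P(2)[OF j'] by simp
    then show "prime (P j) \<and> real (P j) \<le> 2 * y j \<and> y_ext k y X (\<sigma> j) < real (P j) * real (d' j) \<and>
        real (P j) * real (d' j) \<le> 2 ^ (k+1) * y_ext k y X (\<sigma> j)"
      using P(1)[OF j'] P_le_2y[OF j] D_bounds[OF \<sigma>_in[OF j']] by (simp add: yy_def)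
  qed
  moreover have "\<sigma> \<in> {1..k} \<rightarrow> {1..k+1}" using \<sigma>_in by auto
  moreover have "n = (\<Prod>j=1..k. P j) * m * v" using n_eq uv(1) by (simp add: m_def)
  moreover have "\<forall>q\<in>prime_factors v. P k < q" using uv(3) by simp
  moreover have "\<forall>i\<in>{1..k}. \<exists>j\<in>{1..i}. (\<forall>q\<in>prime_factors (d' j). q \<le> P i) \<and>
      sqrt (y i) / (2 * real (P i)) < real (d' j)" using ex_large by (intro ballI)
  moreover have "\<forall>q\<in>prime_factors m. q \<le> P k" using m_smooth by (intro ballI)
  moreover note adm v1 m0
  ultimately show ?thesis
    by (rule_tac exI[of _ \<sigma>], rule_tac exI[of _ P], rule_tac exI[of _ d'], rule_tac exI[of _ m], rule_tac exI[of _ v])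
       (intro conjI)
qed

section \<open>The sum of L and its truncation\<close>

text \<open>This converts the size of a divisor d of m into a lower bound for the exponent of a
  Rankin weight at m that is supported on the primes of \<open>A\<close>.\<close>

lemma ln_le_sum_multiplicity:
  assumes "d dvd m" "m > 0" "finite A" "prime_factors d \<subseteq> A" "\<And>q. q \<in> A \<Longrightarrow> prime (q::nat)"
  shows "ln (real d) \<le> (\<Sum>q\<in>A. ln (real q) * real (multiplicity q m))"
proof -
  have d: "d > 0" using assms(1,2) by (rule dvd_pos_nat[rotated])
  have ln_nonneg: "ln (real q) \<ge> 0" if "q \<in> A" for q using assms(5)[OF that] prime_ge_1_nat[of q] by simp
  have "real d = (\<Prod>q\<in>prime_factors d. real q ^ multiplicity q d)"
    using prime_factorization_nat[OF d] by (metis (no_types, lifting) of_nat_power of_nat_prod prod.cong)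
  then have "ln (real d) = ln (\<Prod>q\<in>prime_factors d. real q ^ multiplicity q d)" by simp
  also have "\<dots> = (\<Sum>q\<in>prime_factors d. ln (real q ^ multiplicity q d))"
    by (rule ln_prod) (auto simp: in_prime_factors_iff prime_gt_0_nat)
  also have "\<dots> = (\<Sum>q\<in>prime_factors d. ln (real q) * real (multiplicity q d))"
    by (intro sum.cong refl) (auto simp: ln_realpow in_prime_factors_iff prime_gt_0_nat)
  also have "\<dots> \<le> (\<Sum>q\<in>prime_factors d. ln (real q) * real (multiplicity q m))"
    using assms(1,2,4) ln_nonneg by (intro sum_mono mult_left_mono) (auto intro: dvd_imp_multiplicity_le)
  also have "\<dots> \<le> (\<Sum>q\<in>A. ln (real q) * real (multiplicity q m))"
    using assms(3,4) ln_nonneg by (intro sum_mono2) auto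
  finally show ?thesis .
qed

definition L_sum :: "nat \<Rightarrow> (nat \<Rightarrow> real) \<Rightarrow> real" where
  "L_sum k y = (\<Sum>a\<in>P_star_k k y. L k a / real (\<Prod>i=1..k. a i))"

definition L_sum_trunc :: "real \<Rightarrow> nat \<Rightarrow> (nat \<Rightarrow> real) \<Rightarrow> real" where
  "L_sum_trunc c k y =
    (\<Sum>a\<in>{a\<in>P_star_k k y. \<forall>i\<in>{1..k}. real (a i) \<le> y i powr c}. L k a / real (\<Prod>i=1..k. a i))"

lemma L_sum_eq:
  assumes "k \<ge> 1" "y 1 \<ge> 1" "\<forall>i\<in>{1..<k}. y i \<le> y (i + 1)"
  shows "L_sum k y = (\<Sum>m\<in>ints_over (primes_upto (y k)) 1. L_smooth k y m / real m)"
  unfolding L_sum_def using sum_P_star_k_eq[OF assms] by simp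

text \<open>For each i the tuples with a_i > y_i^c are penalised with the Rankin exponent 1 / (4 ln
  y_i) on the primes up to y_i. The weight gains exp (-c/4), while its cost does not depend on c. A
  large c therefore makes all k exceptional parts together at most half of the sum, which can then
  be moved to the left.\<close>

lemma truncated_L_sum:
  assumes k: "k \<ge> 1"
  shows "\<exists>c. \<forall>y. y 1 \<ge> 2 \<and> (\<forall>i\<in>{1..<k}. y i \<le> y (i + 1)) \<longrightarrow>
    L_sum k y \<le> 2 * L_sum_trunc c k y"
proof -
  define C where "C = Rankin_const k"
  have C: "C > 0" by (simp add: C_def Rankin_const_pos)
  note Rankin = sum_Rankin_weight_le[where k = k, folded C_def]
  \<comment> \<open>The exponent is 3 + 1: the prime sum in the Rankin bound is 1/4 + 6 / (4 ln y_i)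
    \<le> 3 because ln y_i \<ge> 2/3.\<close>
  define E where "E = exp (4 * C)"
  have E: "E > 0" by (simp add: E_def)
  \<comment> \<open>Solves k exp (-c/4) E = 1/2, which is what the union over the k coordinates
    requires.\<close>
  define c where "c = 4 * ln (2 * real k * E)"
  have c: "real k * exp (- c / 4) * E = 1 / 2" using k E by (simp add: c_def exp_minus field_simps)
  show ?thesis
  proof (intro exI[of _ c] allI impI)
    fix y :: "nat \<Rightarrow> real"
    assume "y 1 \<ge> 2 \<and> (\<forall>i\<in>{1..<k}. y i \<le> y (i + 1))"
    then have y1: "y 1 \<ge> 1" "y 1 \<ge> 2" and mono: "\<forall>i\<in>{1..<k}. y i \<le> y (i + 1)" by auto
    note ymono = mono_upto[OF mono]
    note P_star_k_facts = P_star_k_pos[OF k y1(1) mono] L_eq_L_smooth[OF k y1(1) mono]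
      bij_betw_prod_P_star_k[OF k y1(1) mono] finite_P_star_k[OF k y1(1) mono]
    define Q where "Q = primes_upto (y k)"
    have Q: "finite Q" "\<forall>q\<in>Q. prime q" by (auto simp: Q_def dest: prime_primes_upto)
    define F where "F a = L k a / real (\<Prod>i=1..k. a i)" for a
    have F: "F a \<ge> 0" for a by (simp add: F_def L_nonneg prod_nonneg)
    define good where "good = {a\<in>P_star_k k y. \<forall>i\<in>{1..k}. real (a i) \<le> y i powr c}"
    define bad where "bad i = {a\<in>P_star_k k y. real (a i) > y i powr c}" for i
    have fin: "finite (P_star_k k y)" by (rule P_star_k_facts)
    have bad: "(\<Sum>a\<in>bad i. F a) \<le> exp (- c / 4) * E * L_sum k y" if i: "i \<in> {1..k}" for i
    proof -
      have yi: "y i \<ge> 2" using ymono[of 1 i] y1 i by auto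
      have "ln 2 \<le> ln (y i)" using yi by simp
      then have lny: "ln (y i) \<ge> 2/3" using ln2_ge_two_thirds by linarith
      define b where "b = 1 / (4 * ln (y i))"
      have b: "b > 0" using lny by (simp add: b_def)
      define \<beta> where "\<beta> q = (if prime q \<and> real q \<le> y i then b else 0)" for q :: nat
      define W where "W m = (\<Prod>q\<in>Q. exp (\<beta> q * ln (real q) * real (multiplicity q m)))" for m
      have W: "W m \<ge> 0" for m unfolding W_def by (intro prod_nonneg) auto
      have W_ge: "exp (c / 4) \<le> W (\<Prod>i=1..k. a i)" if a: "a \<in> bad i" for a
      proof -
        define m where "m = (\<Prod>i=1..k. a i)"
        have aP: "a \<in> P_star_k k y" using a by (auto simp: bad_def)
        have m0: "m > 0" unfolding m_def using P_star_k_facts(1)[OF aP] by (intro prod_pos) auto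
        have a0: "a i > 0" using P_star_k_facts(1)[OF aP i] .
        define A where "A = {q\<in>Q. real q \<le> y i}"
        have "ln (y i powr c) \<le> ln (real (a i))"
          using a a0 yi by (subst ln_le_cancel_iff) (auto simp: bad_def)
        then have "c * ln (y i) \<le> ln (real (a i))" using yi by (simp add: ln_powr)
        also have "\<dots> \<le> (\<Sum>q\<in>A. ln (real q) * real (multiplicity q m))"
        proof (rule ln_le_sum_multiplicity)
          show "a i dvd m" unfolding m_def using i by (intro dvd_prodI) auto
          show "prime_factors (a i) \<subseteq> A"
          proof
            fix q assume q: "q \<in> prime_factors (a i)"
            then have "real q \<le> y i" using aP i by (auto simp: P_star_k_iff P_star_def)
            moreover have "y i \<le> y k" using ymono[of i k] i by auto
            ultimately show "q \<in> A" using q by (auto simp: A_def Q_def primes_upto_def in_prime_factors_iff)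
          qed
        qed (use m0 Q in \<open>auto simp: A_def\<close>)
        finally have "b * (c * ln (y i)) \<le> b * (\<Sum>q\<in>A. ln (real q) * real (multiplicity q m))"
          using b by (intro mult_left_mono) auto
        moreover have "b * (c * ln (y i)) = c / 4" using lny by (simp add: b_def)
        moreover have "b * (\<Sum>q\<in>A. ln (real q) * real (multiplicity q m)) = (\<Sum>q\<in>Q. \<beta> q * ln (real q) * real (multiplicity q m))"
          unfolding sum_distrib_left A_def using Q
          by (intro sum.mono_neutral_cong_left) (auto simp: \<beta>_def)
        ultimately have "c / 4 \<le> (\<Sum>q\<in>Q. \<beta> q * ln (real q) * real (multiplicity q m))" by simp
        then show ?thesis unfolding W_def m_def[symmetric] exp_sum[OF Q(1), symmetric] by simp
      qed
      have "exp (c / 4) * (\<Sum>a\<in>bad i. F a) \<le> (\<Sum>a\<in>bad i. W (\<Prod>i=1..k. a i) * F a)"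
        unfolding sum_distrib_left using W_ge F by (intro sum_mono mult_right_mono) auto
      also have "\<dots> \<le> (\<Sum>a\<in>P_star_k k y. W (\<Prod>i=1..k. a i) * F a)"
        using fin F W by (intro sum_mono2) (auto simp: bad_def)
      also have "\<dots> = (\<Sum>a\<in>P_star_k k y. W (\<Prod>i=1..k. a i) * L_smooth k y (\<Prod>i=1..k. a i) / real (\<Prod>i=1..k. a i))"
        by (intro sum.cong refl) (simp only: F_def P_star_k_facts(2) times_divide_eq_right)
      also have "\<dots> = (\<Sum>m\<in>ints_over Q 1. W m * L_smooth k y m / real m)"
        using sum.reindex_bij_betw[OF P_star_k_facts(3), of "\<lambda>m. W m * L_smooth k y m / real m"] by (simp add: Q_def)
      \<comment> \<open>With \<open>B = UNIV\<close> no prime is discarded, so the right-hand side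
        reproduces the sum of L itself.\<close>
      also have "\<dots> \<le> exp (C * ((\<Sum>q\<in>Q \<inter> UNIV. \<beta> q * ln (real q) / real q) + (\<Sum>q\<in>Q - UNIV. 1 / real q) + 1)) *
          (\<Sum>m\<in>ints_over (Q \<inter> UNIV) 1. L_smooth k y m / real m)"
        unfolding W_def
      proof (rule Rankin)
        show "\<forall>q. 0 \<le> \<beta> q \<and> \<beta> q * ln (real q) \<le> 1/4"
        proof
          fix q
          have "b * ln (real q) \<le> b * ln (y i)" if "prime q" "real q \<le> y i"
            using that b yi prime_gt_0_nat[of q] by (intro mult_left_mono) auto
          moreover have "b * ln (y i) = 1/4" using lny by (simp add: b_def)
          ultimately show "0 \<le> \<beta> q \<and> \<beta> q * ln (real q) \<le> 1/4" using b by (auto simp: \<beta>_def)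
        qed
        show "\<forall>m q v. q \<in> Q \<longrightarrow> m > 0 \<longrightarrow> \<not> q dvd m \<longrightarrow>
            L_smooth k y (m * q ^ v) \<le> real (v+1) ^ k * L_smooth k y m"
          using Q(2) L_smooth_mult_prime_power_le by blast
      qed (use Q in \<open>auto simp: L_smooth_nonneg\<close>)
      also have "\<dots> = exp (C * ((\<Sum>q\<in>Q. \<beta> q * ln (real q) / real q) + 1)) * L_sum k y"
        using L_sum_eq[OF k y1(1) mono] by (simp add: Q_def)
      also have "\<dots> \<le> E * L_sum k y"
      proof (rule mult_right_mono)
        have "(\<Sum>q\<in>Q. \<beta> q * ln (real q) / real q) = b * (\<Sum>q\<in>{q\<in>Q. real q \<le> y i}. ln (real q) / real q)"
          unfolding sum_distrib_left using Q by (intro sum.mono_neutral_cong_right) (auto simp: \<beta>_def)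
        also have "\<dots> \<le> b * (ln (y i) + 6)"
          using b Q yi by (intro mult_left_mono sum_primes_ln_over_id_le) auto
        also have "\<dots> = 1/4 + 6 / (4 * ln (y i))" using lny by (simp add: b_def field_simps)
        also have "\<dots> \<le> 3"
          using lny by (simp add: field_simps)
        finally have "C * ((\<Sum>q\<in>Q. \<beta> q * ln (real q) / real q) + 1) \<le> C * 4"
          using C by (intro mult_left_mono) auto
        then show "exp (C * ((\<Sum>q\<in>Q. \<beta> q * ln (real q) / real q) + 1)) \<le> E" by (simp add: E_def mult.commute)
        show "L_sum k y \<ge> 0" unfolding L_sum_def using F by (intro sum_nonneg) (simp add: F_def)
      qed
      finally have le: "exp (c / 4) * (\<Sum>a\<in>bad i. F a) \<le> E * L_sum k y" .
      have "(\<Sum>a\<in>bad i. F a) = exp (- c / 4) * (exp (c / 4) * (\<Sum>a\<in>bad i. F a))"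
        by (simp add: mult.assoc[symmetric] exp_add[symmetric])
      also have "\<dots> \<le> exp (- c / 4) * (E * L_sum k y)" using le by (intro mult_left_mono) auto
      finally show ?thesis by (simp only: mult.assoc)
    qed
    have "L_sum k y = (\<Sum>a\<in>P_star_k k y. F a)" by (simp add: L_sum_def F_def)
    also have "\<dots> \<le> (\<Sum>a\<in>good \<union> (\<Union>i\<in>{1..k}. bad i). F a)"
      using fin F by (intro sum_mono2) (auto simp: good_def bad_def not_le)
    also have "\<dots> \<le> (\<Sum>a\<in>good. F a) + (\<Sum>a\<in>(\<Union>i\<in>{1..k}. bad i). F a)"
    proof -
      have fg: "finite good" "finite (\<Union>i\<in>{1..k}. bad i)" using fin by (auto simp: good_def bad_def)
      have "(\<Sum>a\<in>good \<inter> (\<Union>i\<in>{1..k}. bad i). F a) \<ge> 0" using F by (intro sum_nonneg) auto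
      then show ?thesis using sum.union_inter[OF fg, of F] by linarith
    qed
    also have "(\<Sum>a\<in>(\<Union>i\<in>{1..k}. bad i). F a) \<le> (\<Sum>i\<in>{1..k}. \<Sum>a\<in>bad i. F a)"
    proof -
      have finb: "finite (bad i)" for i using fin by (simp add: bad_def)
      have "(\<Sum>a\<in>(\<Union>i\<in>{1..k}. bad i). F a) \<le> (\<Sum>z\<in>Sigma {1..k} bad. F (snd z))"
        using finb F by (intro sum_le_included[where i = snd]) force+
      also have "\<dots> = (\<Sum>i\<in>{1..k}. \<Sum>a\<in>bad i. F a)"
        using finb by (subst sum.Sigma) (auto simp: split_def)
      finally show ?thesis .
    qed
    also have "\<dots> \<le> (\<Sum>i\<in>{1..k}. exp (- c / 4) * E * L_sum k y)" using bad by (intro sum_mono)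
    also have "\<dots> = (real k * exp (- c / 4) * E) * L_sum k y" by simp
    also have "\<dots> = L_sum k y / 2" unfolding c by simp
    finally show "L_sum k y \<le> 2 * L_sum_trunc c k y"
      by (simp add: L_sum_trunc_def good_def F_def)
  qed
qed

text \<open>The single integer m = 1 contributes a cube of side ln 2. This bound turns the main term
  into something with which exceptional sets can be compared.\<close>

lemma L_sum_ge:
  assumes k: "k \<ge> 1" and y1: "y 1 \<ge> 1" and mono: "\<forall>i\<in>{1..<k}. y i \<le> y (i + 1)"
  shows "ln 2 ^ k \<le> L_sum k y"
proof -
  have "ln 2 ^ k \<le> L_smooth k y 1"
  proof -
    define Bx :: "(nat \<Rightarrow> real) set" where "Bx = Pi\<^sub>E {1..k} (\<lambda>i. {ln (1 / 2)..<0})"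
    have "emeasure (lborel_prod k) Bx = (\<Prod>i\<in>{1..k}. ennreal (ln 2))"
      unfolding Bx_def by (subst lborel_product.emeasure_PiM) (auto simp: ln_div intro!: prod.cong)
    also have "\<dots> = ennreal (ln 2 ^ k)" by (simp add: ennreal_power)
    finally have "measure (lborel_prod k) Bx = ln 2 ^ k" by (simp add: measure_def)
    moreover have "measure (lborel_prod k) Bx \<le> L_smooth k y 1"
      unfolding L_smooth_def
    proof (rule measure_mono_fmeasurable)
      have "(\<lambda>_. 1) \<in> adm k y 1" by (auto simp: adm_def)
      moreover have "Bx = Pi\<^sub>E {1..k} (\<lambda>i. {ln (real ((\<lambda>_. 1 :: nat) i) / 2)..<ln (real ((\<lambda>_. 1 :: nat) i))})"
        by (simp add: Bx_def)
      ultimately show "Bx \<subseteq> log_boxes k (adm k y 1)" unfolding log_boxes_def by blast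
      show "Bx \<in> sets (lborel_prod k)" unfolding Bx_def by (auto intro!: sets_PiM_I_finite)
    qed (rule fmeasurable_adm, simp)
    ultimately show ?thesis by simp
  qed
  also have "\<dots> = (\<Sum>m\<in>{1}. L_smooth k y m / real m)" by simp
  also have "\<dots> \<le> (\<Sum>m\<in>ints_over (primes_upto (y k)) 1. L_smooth k y m / real m)"
    by (intro sum_mono2 finite_ints_over)
       (auto simp: ints_over_def L_smooth_nonneg dest: prime_primes_upto)
  also have "\<dots> = L_sum k y" using L_sum_eq[OF k y1 mono] by simp
  finally show ?thesis .
qed

text \<open>The extracted primes reach 2 y_i, whereas P_*^k stops at y_i. For primes in this set q
  \<le> 2 y_i and q \<le> y_i are equivalent, so both notions of admissibility agree; the other
  primes have a bounded sum of reciprocals and can be discarded.\<close>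

definition avoiding_primes :: "nat \<Rightarrow> (nat \<Rightarrow> real) \<Rightarrow> nat set" where
  "avoiding_primes k y = {q. \<forall>i\<in>{1..k}. \<not> (y i < real q \<and> real q \<le> 2 * y i)}"

lemma sum_avoiding_primes_le:
  assumes k: "k \<ge> 1" and y1: "y 1 \<ge> 1" and mono: "\<forall>i\<in>{1..<k}. y i \<le> y (i + 1)"
  shows "(\<Sum>m\<in>ints_over (primes_upto (2 * y k) \<inter> avoiding_primes k y) 1. L_smooth k (\<lambda>i. 2 * y i) m / real m)
    \<le> L_sum k y"
proof -
  define Q where "Q = primes_upto (2 * y k) \<inter> avoiding_primes k y"
  have QP: "Q \<subseteq> primes_upto (y k)"
  proof
    fix q assume "q \<in> Q"
    then have q: "prime q" "real q \<le> 2 * y k" "\<not> (y k < real q \<and> real q \<le> 2 * y k)"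
      using k unfolding Q_def primes_upto_def avoiding_primes_def by auto
    then show "q \<in> primes_upto (y k)" by (simp add: primes_upto_def)
  qed
  have "(\<Sum>m\<in>ints_over Q 1. L_smooth k (\<lambda>i. 2 * y i) m / real m)
      \<le> (\<Sum>m\<in>ints_over Q 1. L_smooth k y m / real m)"
  proof (intro sum_mono divide_right_mono)
    fix m assume m: "m \<in> ints_over Q 1"
    then have m0: "m > 0" by (auto simp: ints_over_def)
    have "adm k (\<lambda>i. 2 * y i) m \<subseteq> adm k y m"
    proof
      fix d assume d: "d \<in> adm k (\<lambda>i. 2 * y i) m"
      have "real q \<le> y i" if i: "i \<in> {1..k}" and q: "q \<in> prime_factors (d i)" for i q
      proof -
        have "d i dvd (\<Prod>i=1..k. d i)" using i by (intro dvd_prodI) auto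
        also have "\<dots> dvd m" using d by (auto simp: adm_def)
        finally have "q \<in> prime_factors m" using q m0 by (auto simp: in_prime_factors_iff)
        then have "q \<in> avoiding_primes k y" using m by (auto simp: ints_over_def Q_def)
        moreover have "real q \<le> 2 * y i" using d i q by (auto simp: adm_def)
        ultimately show ?thesis using i by (auto simp: avoiding_primes_def not_less)
      qed
      then show "d \<in> adm k y m" using d by (auto simp: adm_def)
    qed
    then have "log_boxes k (adm k (\<lambda>i. 2 * y i) m) \<subseteq> log_boxes k (adm k y m)"
      unfolding log_boxes_def by blast
    then show "L_smooth k (\<lambda>i. 2 * y i) m \<le> L_smooth k y m"
      unfolding L_smooth_def using fmeasurable_adm[OF m0, of k]
      by (intro measure_mono_fmeasurable) (auto simp: fmeasurable_def)
  qed auto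
  also have "\<dots> \<le> (\<Sum>m\<in>ints_over (primes_upto (y k)) 1. L_smooth k y m / real m)"
  proof (intro sum_mono2)
    show "finite (ints_over (primes_upto (y k)) 1)"
      by (intro finite_ints_over) (auto dest: prime_primes_upto)
    show "ints_over Q 1 \<subseteq> ints_over (primes_upto (y k)) 1"
    proof
      fix m assume m: "m \<in> ints_over Q 1"
      have "multiplicity q m \<le> 1" if "q \<in> primes_upto (y k)" for q
      proof (cases "q \<in> Q")
        case False
        then have "\<not> q dvd m"
          using not_dvd_ints_over[OF m] prime_primes_upto[OF that] by blast
        then show ?thesis by (simp add: not_dvd_imp_multiplicity_0)
      qed (use m in \<open>auto simp: ints_over_def\<close>)
      then show "m \<in> ints_over (primes_upto (y k)) 1"
        using m QP by (auto simp: ints_over_def)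
    qed
  qed (auto simp: L_smooth_nonneg)
  finally show ?thesis using L_sum_eq[OF k y1 mono] by (simp add: Q_def)
qed

section \<open>Integers divisible by the square of their largest prime\<close>

lemma card_multiples_le:
  assumes "p > 0" "x \<ge> 0"
  shows "real (card {n::nat. 1 \<le> n \<and> real n \<le> x \<and> p dvd n}) \<le> x / real p"
proof -
  have "{n::nat. 1 \<le> n \<and> real n \<le> x \<and> p dvd n} \<subseteq> (\<lambda>j. p * j) ` {1..nat \<lfloor>x / real p\<rfloor>}"
  proof
    fix n assume "n \<in> {n::nat. 1 \<le> n \<and> real n \<le> x \<and> p dvd n}"
    then have n: "1 \<le> n" "real n \<le> x" "p dvd n" by auto
    from n(3) obtain j where j: "n = p * j" by (rule dvdE)
    then have "real j \<le> x / real p" using assms n j by (simp add: field_simps)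
    then have "j \<le> nat \<lfloor>x / real p\<rfloor>" by (rule le_nat_floor)
    moreover have "1 \<le> j" using n j by (cases j) (auto simp: One_nat_def)
    ultimately show "n \<in> (\<lambda>j. p * j) ` {1..nat \<lfloor>x / real p\<rfloor>}" using j by auto
  qed
  then have "card {n::nat. 1 \<le> n \<and> real n \<le> x \<and> p dvd n} \<le> card ((\<lambda>j. p * j) ` {1..nat \<lfloor>x / real p\<rfloor>})"
    by (intro card_mono) auto
  also have "\<dots> \<le> nat \<lfloor>x / real p\<rfloor>" using card_image_le[of "{1..nat \<lfloor>x / real p\<rfloor>}" "\<lambda>j. p * j"] by simp
  finally have "real (card {n::nat. 1 \<le> n \<and> real n \<le> x \<and> p dvd n}) \<le> real (nat \<lfloor>x / real p\<rfloor>)" by simp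
  also have "\<dots> \<le> x / real p" using assms by (intro of_nat_floor) auto
  finally show ?thesis .
qed

lemma multiplicity_le_self:
  assumes "prime (q::nat)" "m > 0"
  shows "multiplicity q m \<le> m"
proof -
  have "multiplicity q m < q ^ multiplicity q m" using prime_gt_1_nat[OF assms(1)] by (intro power_gt_expt) (simp add: One_nat_def)
  also have "\<dots> \<le> m" using assms by (intro dvd_imp_le multiplicity_dvd)
  finally show ?thesis by simp
qed

text \<open>The threshold is w = (ln x)^(k+1). If the prime exceeds w, summing x/p^2 suffices.
  Otherwise n is w-smooth, and for n > sqrt x Rankin's trick shows this to be rarer than any fixed
  power of ln x. The power k + 1 is the total of the exponents \<open>e k i\<close>, so the count
  fits under the main term.\<close>

lemma card_max_prime_square_dvd_le:
  fixes k :: nat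
  shows "\<exists>x0. \<forall>x\<ge>x0. real (card {n. 1 \<le> n \<and> real n \<le> x \<and> max_prime_square_dvd n}) \<le> 4 * x / ln x ^ (k+1)"
proof -
  define C where "C = Rankin_const k"
  have C: "C > 0" by (simp add: C_def Rankin_const_pos)
  note Rankin = sum_Rankin_weight_le[where k = k, folded C_def]
  define K where "K = real k + 1"
  have K: "K > 0" by (simp add: K_def)
  \<comment> \<open>This says that the bound for the smooth n is at most x/w, with ln w = K ln ln x.
    The 8 is 2 * 4: ln n \<ge> ln x / 2 for n > sqrt x, and the Rankin exponent is 1 / (4 ln
    w).\<close>
  have ev1: "eventually (\<lambda>x. - ln x / (8 * (K * ln (ln x))) + C * (2 + K * ln (ln x)) + K * ln (ln x) \<le> 0) at_top"
    using C K by real_asymp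
  have ev2: "eventually (\<lambda>x::real. ln x ^ (k+1) * sqrt x \<le> x) at_top"
    by real_asymp
  have ev3: "eventually (\<lambda>x::real. ln x \<ge> 2 \<and> x \<ge> 1) at_top"
    by (intro eventually_conj eventually_ge_at_top) real_asymp
  obtain x0 where x0: "\<And>x. x \<ge> x0 \<Longrightarrow> - ln x / (8 * (K * ln (ln x))) + C * (2 + K * ln (ln x)) + K * ln (ln x) \<le> 0"
      "\<And>x. x \<ge> x0 \<Longrightarrow> ln x ^ (k+1) * sqrt x \<le> x" "\<And>x. x \<ge> x0 \<Longrightarrow> ln x \<ge> 2 \<and> x \<ge> 1"
    using eventually_conj[OF ev1 eventually_conj[OF ev2 ev3]] unfolding eventually_at_top_linorder by blast
  show ?thesis
  proof (intro exI[of _ x0] allI impI)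
    fix x assume "x \<ge> x0"
    note x0 = x0[OF this]
    have x: "ln x \<ge> 2" "x \<ge> 1" using x0(3) by auto
    define w where "w = ln x ^ (k+1)"
    have w2: "w \<ge> 2"
    proof -
      have "(2::real) ^ 1 \<le> 2 ^ (k+1)" by (intro power_increasing) auto
      also have "\<dots> \<le> ln x ^ (k+1)" using x by (intro power_mono) auto
      finally show ?thesis by (simp add: w_def)
    qed
    have lnw: "ln w = K * ln (ln x)" using x by (simp add: w_def K_def ln_realpow)
    have lnw0: "ln w > 0" using w2 by simp
    define T where "T = {n. 1 \<le> n \<and> real n \<le> x \<and> max_prime_square_dvd n}"
    \<comment> \<open>The maximum in the upper limit keeps the end points in order, as the
      telescoping bound for the tail of 1/p^2 requires.\<close>
    define T1 where "T1 = (\<Union>p\<in>{nat \<lfloor>w\<rfloor><..max (nat \<lfloor>x\<rfloor>) (nat \<lfloor>w\<rfloor>)}. {n. 1 \<le> n \<and> real n \<le> x \<and> p ^ 2 dvd n})"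
    define T2 where "T2 = {n. 1 \<le> n \<and> real n \<le> sqrt x}"
    define T3 where "T3 = {n. sqrt x < real n \<and> real n \<le> x \<and> prime_factors n \<subseteq> primes_upto w}"
    have finx: "finite {n. 1 \<le> n \<and> real n \<le> z \<and> R n}" for z and R :: "nat \<Rightarrow> bool"
      by (rule finite_subset[of _ "{..nat \<lfloor>z\<rfloor>}"]) (auto simp: le_nat_floor)
    have fin: "finite T1" "finite T2" "finite T3"
    proof -
      show "finite T1" unfolding T1_def using finx by (intro finite_UN_I) auto
      show "finite T2" unfolding T2_def using finx[of "sqrt x" "\<lambda>_. True"] by simp
      show "finite T3" unfolding T3_def
        by (rule finite_subset[of _ "{..nat \<lfloor>x\<rfloor>}"]) (auto simp: le_nat_floor)
    qed
    have "T \<subseteq> T1 \<union> T2 \<union> T3"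
    proof
      fix n assume n: "n \<in> T"
      then obtain p where p: "prime p" "p ^ 2 dvd n" "\<forall>q\<in>prime_factors n. q \<le> p"
        by (auto simp: T_def max_prime_square_dvd_def)
      show "n \<in> T1 \<union> T2 \<union> T3"
      proof (cases "real p \<le> w")
        case True
        have "prime_factors n \<subseteq> primes_upto w"
        proof
          fix q assume q: "q \<in> prime_factors n"
          then have "real q \<le> real p" using p(3) by simp
          then show "q \<in> primes_upto w" using q True by (simp add: primes_upto_def in_prime_factors_iff)
        qed
        then show ?thesis using n by (cases "real n \<le> sqrt x") (auto simp: T_def T2_def T3_def)
      next
        case False
        have "p dvd n" using p(2) by (metis dvd_mult_left power2_eq_square)
        then have "p \<le> n" using n by (intro dvd_imp_le) (auto simp: T_def)
        then have "real p \<le> x" using n by (auto simp: T_def)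
        then have "p \<le> nat \<lfloor>x\<rfloor>" by (rule le_nat_floor)
        moreover have "nat \<lfloor>w\<rfloor> < p" using False w2 by (simp add: nat_less_iff floor_less_iff)
        ultimately show ?thesis using n p(2) by (auto simp: T_def T1_def)
      qed
    qed
    then have "card T \<le> card (T1 \<union> T2 \<union> T3)" using fin by (intro card_mono) auto
    also have "\<dots> \<le> card T1 + card T2 + card T3"
      using card_Un_le[of "T1 \<union> T2" T3] card_Un_le[of T1 T2] by linarith
    finally have cardT: "real (card T) \<le> real (card T1) + real (card T2) + real (card T3)" by linarith
    have card1: "real (card T1) \<le> 2 * x / w"
    proof -
      define a where "a = nat \<lfloor>w\<rfloor>"
      define b where "b = max (nat \<lfloor>x\<rfloor>) a"
      have a: "1 \<le> a" using w2 by (simp add: a_def le_nat_floor)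
      have "real a = real_of_int \<lfloor>w\<rfloor>" using w2 by (simp add: a_def)
      then have aw: "w / 2 \<le> real a" using w2 real_of_int_floor_add_one_gt[of w] by linarith
      have "card T1 \<le> (\<Sum>p\<in>{a<..b}. card {n. 1 \<le> n \<and> real n \<le> x \<and> p ^ 2 dvd n})"
        unfolding T1_def a_def b_def by (intro card_UN_le) auto
      then have "real (card T1) \<le> real (\<Sum>p\<in>{a<..b}. card {n. 1 \<le> n \<and> real n \<le> x \<and> p ^ 2 dvd n})"
        by (simp only: of_nat_le_iff)
      also have "\<dots> = (\<Sum>p\<in>{a<..b}. real (card {n. 1 \<le> n \<and> real n \<le> x \<and> p ^ 2 dvd n}))"
        by (rule of_nat_sum)
      finally have "real (card T1) \<le> (\<Sum>p\<in>{a<..b}. real (card {n. 1 \<le> n \<and> real n \<le> x \<and> p ^ 2 dvd n}))" .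
      also have "\<dots> \<le> (\<Sum>p\<in>{a<..b}. x * (1 / real p ^ 2))"
      proof (intro sum_mono)
        fix p assume "p \<in> {a<..b}"
        then show "real (card {n. 1 \<le> n \<and> real n \<le> x \<and> p ^ 2 dvd n}) \<le> x * (1 / real p ^ 2)"
          using card_multiples_le[of "p ^ 2" x] x by simp
      qed
      also have "\<dots> = x * (\<Sum>p\<in>{a<..b}. 1 / real p ^ 2)" by (simp add: sum_distrib_left)
      also have "\<dots> \<le> x * (1 / real a - 1 / real b)"
        using x a by (intro mult_left_mono sum_inverse_squares_tail_le) (auto simp: b_def)
      also have "\<dots> \<le> x * (1 / (w / 2))"
      proof (intro mult_left_mono)
        have "1 / real a \<le> 1 / (w / 2)" using a aw w2 by (intro divide_left_mono) auto
        moreover have "1 / real b \<ge> 0" by simp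
        ultimately show "1 / real a - 1 / real b \<le> 1 / (w / 2)" by linarith
      qed (use x in auto)
      finally show ?thesis by (simp add: mult.commute)
    qed
    have card2: "real (card T2) \<le> x / w"
    proof -
      have "card T2 \<le> card {1..nat \<lfloor>sqrt x\<rfloor>}"
        by (intro card_mono) (auto simp: T2_def le_nat_floor)
      then have "real (card T2) \<le> real (nat \<lfloor>sqrt x\<rfloor>)" by simp
      also have "\<dots> \<le> sqrt x" using x by (intro of_nat_floor) auto
      also have "\<dots> \<le> x / w"
      proof -
        have "w * sqrt x \<le> x" using x0(2) unfolding w_def .
        then show ?thesis using w2 by (simp add: field_simps)
      qed
      finally show ?thesis .
    qed
    have card3: "real (card T3) \<le> x / w"
    proof -
      define Q where "Q = primes_upto w"
      have Q: "finite Q" "\<forall>q\<in>Q. prime q" by (auto simp: Q_def dest: prime_primes_upto)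
      define V where "V = nat \<lfloor>x\<rfloor> + 1"
      define b where "b = 1 / (4 * ln w)"
      have b: "b > 0" using lnw0 by (simp add: b_def)
      define \<beta> where "\<beta> q = (if q \<in> Q then b else 0)" for q :: nat
      define W where "W m = (\<Prod>q\<in>Q. exp (\<beta> q * ln (real q) * real (multiplicity q m)))" for m
      have sub: "T3 \<subseteq> ints_over Q V"
      proof
        fix n assume n: "n \<in> T3"
        have n0: "n > 0" using n x by (cases n) (auto simp: T3_def)
        have "n \<le> nat \<lfloor>x\<rfloor>" using n by (auto simp: T3_def le_nat_floor)
        then have "multiplicity q n \<le> V" if "q \<in> Q" for q
          using multiplicity_le_self[of q n] n0 Q that by (auto simp: V_def)
        then show "n \<in> ints_over Q V" using n n0 by (auto simp: ints_over_def T3_def Q_def)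
      qed
      have one_le: "1 \<le> x * exp (- ln x / (8 * ln w)) * (W n * 1 / real n)" if n: "n \<in> T3" for n
      proof -
        have n0: "n > 0" using n sub by (auto simp: ints_over_def)
        have "ln (sqrt x) \<le> ln (real n)" using n n0 x by (subst ln_le_cancel_iff) (auto simp: T3_def)
        then have "ln x / 2 \<le> ln (real n)" using x by (simp add: ln_sqrt)
        also have "\<dots> \<le> (\<Sum>q\<in>Q. ln (real q) * real (multiplicity q n))"
          using n n0 Q by (intro ln_le_sum_multiplicity) (auto simp: T3_def Q_def)
        finally have "b * (ln x / 2) \<le> b * (\<Sum>q\<in>Q. ln (real q) * real (multiplicity q n))"
          using b by (intro mult_left_mono) auto
        also have "\<dots> = (\<Sum>q\<in>Q. \<beta> q * ln (real q) * real (multiplicity q n))"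
          by (simp add: \<beta>_def sum_distrib_left mult_ac)
        finally have "exp (b * (ln x / 2)) \<le> W n" unfolding W_def exp_sum[OF Q(1), symmetric] by simp
        moreover have "b * (ln x / 2) = ln x / (8 * ln w)" by (simp add: b_def)
        ultimately have "exp (ln x / (8 * ln w)) \<le> W n" by simp
        then have "exp (- ln x / (8 * ln w)) * exp (ln x / (8 * ln w)) \<le> exp (- ln x / (8 * ln w)) * W n"
          by (intro mult_left_mono) auto
        then have 1: "1 \<le> exp (- ln x / (8 * ln w)) * W n" by (simp add: exp_add[symmetric])
        have "1 \<le> x / real n" using n n0 by (auto simp: T3_def)
        then have "1 * 1 \<le> (x / real n) * (exp (- ln x / (8 * ln w)) * W n)"
          using 1 by (intro mult_mono) auto
        then show ?thesis by (simp add: mult_ac)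
      qed
      have "real (card T3) = (\<Sum>n\<in>T3. 1)" by simp
      also have "\<dots> \<le> (\<Sum>n\<in>T3. x * exp (- ln x / (8 * ln w)) * (W n * 1 / real n))"
        using one_le by (intro sum_mono) auto
      also have "\<dots> = x * exp (- ln x / (8 * ln w)) * (\<Sum>n\<in>T3. W n * 1 / real n)"
        by (simp add: sum_distrib_left)
      also have "\<dots> \<le> x * exp (- ln x / (8 * ln w)) * (\<Sum>n\<in>ints_over Q V. W n * 1 / real n)"
      proof -
        have "W n \<ge> 0" for n unfolding W_def by (intro prod_nonneg) auto
        then show ?thesis using sub x Q by (intro mult_left_mono sum_mono2 finite_ints_over) auto
      qed
      \<comment> \<open>Here \<Lambda> = 1 and \<open>B = {}\<close>: every prime is paid for in
        full and only m = 1 remains. The crude bound of the prime reciprocals by a harmonic sum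
        costs a power of w, hence of ln x, which the saving dwarfs.\<close>
      also have "\<dots> \<le> x * exp (- ln x / (8 * ln w)) *
          (exp (C * ((\<Sum>q\<in>Q \<inter> {}. \<beta> q * ln (real q) / real q) + (\<Sum>q\<in>Q - {}. 1 / real q) + 1)) *
          (\<Sum>m\<in>ints_over (Q \<inter> {}) 1. 1 / real m))"
        unfolding W_def
      proof (intro mult_left_mono Rankin)
        show "\<forall>q. 0 \<le> \<beta> q \<and> \<beta> q * ln (real q) \<le> 1/4"
        proof
          fix q
          have "b * ln (real q) \<le> b * ln w" if "q \<in> Q"
            using that b w2 prime_gt_0_nat[of q] by (intro mult_left_mono) (auto simp: Q_def primes_upto_def)
          moreover have "b * ln w = 1/4" using lnw0 by (simp add: b_def)
          ultimately show "0 \<le> \<beta> q \<and> \<beta> q * ln (real q) \<le> 1/4" using b by (auto simp: \<beta>_def)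
        qed
      qed (use Q x in \<open>auto simp: V_def\<close>)
      also have "\<dots> = x * exp (- ln x / (8 * ln w)) * exp (C * ((\<Sum>q\<in>Q. 1 / real q) + 1))" by simp
      also have "\<dots> \<le> x * exp (- ln x / (8 * ln w)) * exp (C * (2 + ln w))"
      proof -
        define a where "a = nat \<lfloor>w\<rfloor>"
        have a: "a \<ge> 1" "real a \<le> w" using w2 by (auto simp: a_def le_nat_floor)
        have "(\<Sum>q\<in>Q. 1 / real q) \<le> (\<Sum>j=1..a. 1 / real j)"
          by (intro sum_mono2) (auto simp: Q_def primes_upto_def a_def le_nat_floor dest: prime_ge_1_nat)
        also have "\<dots> = harm a" by (simp add: harm_def inverse_eq_divide)
        also have "\<dots> \<le> 1 + ln (real a)" by (rule harm_le[OF a(1)])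
        also have "\<dots> \<le> 1 + ln w" using a by simp
        finally have "C * ((\<Sum>q\<in>Q. 1 / real q) + 1) \<le> C * (2 + ln w)"
          using C by (intro mult_left_mono) auto
        then show ?thesis using x by (intro mult_left_mono) auto
      qed
      also have "\<dots> = x * exp (- ln x / (8 * ln w) + C * (2 + ln w))" by (simp only: exp_add mult.assoc)
      also have "\<dots> \<le> x * exp (- ln w)"
        using x0(1) x unfolding lnw by (intro mult_left_mono) auto
      also have "\<dots> = x / w" using w2 by (simp add: exp_minus field_simps)
      finally show ?thesis .
    qed
    have "real (card T) \<le> 2 * x / w + x / w + x / w" using cardT card1 card2 card3 by linarith
    also have "\<dots> = 4 * x / w" by (simp add: add_divide_distrib[symmetric])
    finally show "real (card {n. 1 \<le> n \<and> real n \<le> x \<and> max_prime_square_dvd n}) \<le> 4 * x / ln x ^ (k+1)"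
      by (simp add: T_def w_def)
  qed
qed

section \<open>Scales\<close>

lemma dyadic_interval_left:
  fixes r :: real
  assumes "r \<ge> 1"
  obtains s :: nat where "2 ^ s \<le> r" "r < 2 ^ (s+1)"
proof -
  obtain N where N: "r < 2 ^ N" using real_arch_pow[of 2 r] by auto
  define M where "M = (LEAST N. r < 2 ^ N)"
  have M: "r < 2 ^ M" unfolding M_def by (rule LeastI[of _ N]) (rule N)
  have "M \<noteq> 0" using M assms by (cases M) auto
  then obtain s where s: "M = s + 1" by (metis Suc_eq_plus1 not0_implies_Suc)
  have "\<not> r < 2 ^ s" using not_less_Least[of s "\<lambda>N. r < 2 ^ N"] s by (simp add: M_def)
  then show ?thesis using that[of s] M s by auto
qed

text \<open>The half-open side matters: v < P d \<le> 2v is exactly the condition that ln v - ln P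
  lies in the box [ln (d/2), ln d).\<close>

lemma dyadic_interval_right:
  fixes r :: real
  assumes "r > 1" "r \<le> 2 ^ n"
  obtains s :: nat where "2 ^ s < r" "r \<le> 2 ^ (s+1)" "s < n"
proof -
  define M where "M = (LEAST N. r \<le> 2 ^ N)"
  have M: "r \<le> 2 ^ M" unfolding M_def by (rule LeastI[of _ n]) (rule assms)
  have Mn: "M \<le> n" unfolding M_def by (rule Least_le) (rule assms)
  have "M \<noteq> 0" using M assms by (cases M) auto
  then obtain s where s: "M = s + 1" by (metis Suc_eq_plus1 not0_implies_Suc)
  have "\<not> r \<le> 2 ^ s" using not_less_Least[of s "\<lambda>N. r \<le> 2 ^ N"] s by (simp add: M_def)
  then show ?thesis using that[of s] M s Mn by auto
qed

text \<open>A prime P_i of scale s_i lies between sqrt(T_i) and T_i, where ln T_i = ln (2 y_i) / 2^(s_i). The Rankin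
  exponent attached to y_i is then 1 / (4 k ln T_i), applied to the primes up to T_i.\<close>
definition scale_exponent :: "nat \<Rightarrow> (nat \<Rightarrow> real) \<Rightarrow> (nat \<Rightarrow> nat) \<Rightarrow> nat \<Rightarrow> real" where
  "scale_exponent k y s q =
     (\<Sum>i=1..k. if 2 ^ s i * ln (real q) \<le> ln (2 * y i) then 2 ^ s i / (4 * real k * ln (2 * y i)) else 0)"

definition scale_weight :: "nat \<Rightarrow> (nat \<Rightarrow> real) \<Rightarrow> (nat \<Rightarrow> nat) \<Rightarrow> nat \<Rightarrow> real" where
  "scale_weight k y s m =
     (\<Prod>q\<in>primes_upto (2 * y k). exp (scale_exponent k y s q * ln (real q) * real (multiplicity q m)))"

lemma scale_weight_nonneg: "scale_weight k y s m \<ge> 0"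
  unfolding scale_weight_def by (intro prod_nonneg) auto

text \<open>The constant does not depend on s: at every scale the exponent is inversely proportional
  to the logarithm of the largest prime it affects, so each i adds at most a constant over k. This
  uniformity permits the later summation over s.\<close>

lemma sum_scale_weight_le:
  assumes k: "k \<ge> 1"
  shows "\<exists>E>0. \<forall>y s V. y 1 \<ge> 32 \<and> (\<forall>i\<in>{1..<k}. y i \<le> y (i + 1)) \<and> V \<ge> 1 \<longrightarrow>
    (\<Sum>m\<in>ints_over (primes_upto (2 * y k)) V. scale_weight k y s m * L_smooth k (\<lambda>i. 2 * y i) m / real m)
      \<le> E * L_sum k y"
proof -
  define C where "C = Rankin_const k"
  have C: "C > 0" by (simp add: C_def Rankin_const_pos)
  note Rankin = sum_Rankin_weight_le[where k = k, folded C_def]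
  \<comment> \<open>The 3 bounds the weighted sum over the retained primes, 2k the reciprocals of
    the primes in the k intervals (y_i, 2 y_i], and the last 1 comes from the Rankin
    estimate.\<close>
  define E where "E = exp (C * (3 + 2 * real k + 1))"
  have E: "E > 0" by (simp add: E_def)
  show ?thesis
  proof (intro exI[of _ E] conjI allI impI)
    show "E > 0" by fact
    fix y :: "nat \<Rightarrow> real" and s :: "nat \<Rightarrow> nat" and V :: nat
    assume "y 1 \<ge> 32 \<and> (\<forall>i\<in>{1..<k}. y i \<le> y (i + 1)) \<and> V \<ge> 1"
    then have y1: "y 1 \<ge> 1" "y 1 \<ge> 32" and mono: "\<forall>i\<in>{1..<k}. y i \<le> y (i + 1)" and V: "V \<ge> 1" by auto
    have y32: "y i \<ge> 32" if "i \<in> {1..k}" for i using mono_upto[OF mono, of 1 i] y1 that by auto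
    define Q where "Q = primes_upto (2 * y k)"
    have Q: "finite Q" "\<forall>q\<in>Q. prime q" by (auto simp: Q_def dest: prime_primes_upto)
    define B where "B = avoiding_primes k y"
    define \<beta> where "\<beta> = scale_exponent k y s"
    define b where "b i = 2 ^ s i / (4 * real k * ln (2 * y i))" for i
    have lnt: "ln (2 * y i) > 0" if "i \<in> {1..k}" for i using y32[OF that] by simp
    have b: "b i > 0" if "i \<in> {1..k}" for i using lnt[OF that] k by (simp add: b_def)
    have \<beta>_eq: "\<beta> q = (\<Sum>i=1..k. if 2 ^ s i * ln (real q) \<le> ln (2 * y i) then b i else 0)" for q
      unfolding \<beta>_def scale_exponent_def b_def ..
    have ln_nonneg: "ln (real q) \<ge> 0" for q by (cases "q = 0") auto
    have sumB: "(\<Sum>q\<in>Q \<inter> B. \<beta> q * ln (real q) / real q) \<le> 3"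
    proof -
      have "(\<Sum>q\<in>Q \<inter> B. \<beta> q * ln (real q) / real q) \<le> (\<Sum>q\<in>Q. \<beta> q * ln (real q) / real q)"
        using Q(1) ln_nonneg b
        by (intro sum_mono2 divide_nonneg_nonneg mult_nonneg_nonneg) (auto simp: \<beta>_eq less_imp_le intro!: sum_nonneg)
      also have "\<dots> = (\<Sum>q\<in>Q. \<Sum>i=1..k. if 2 ^ s i * ln (real q) \<le> ln (2 * y i) then b i * (ln (real q) / real q) else 0)"
        unfolding \<beta>_eq sum_distrib_right sum_divide_distrib by (intro sum.cong refl) auto
      also have "\<dots> = (\<Sum>i=1..k. \<Sum>q\<in>Q. if 2 ^ s i * ln (real q) \<le> ln (2 * y i) then b i * (ln (real q) / real q) else 0)"
        by (rule sum.swap)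
      also have "\<dots> \<le> (\<Sum>i=1..k. 10 / (4 * real k))"
      proof (intro sum_mono)
        fix i assume i: "i \<in> {1..k}"
        define T where "T = exp (ln (2 * y i) / 2 ^ s i)"
        define A where "A = {q\<in>Q. 2 ^ s i * ln (real q) \<le> ln (2 * y i)}"
        have A: "prime q \<and> real q \<le> T" if "q \<in> A" for q
        proof -
          have pr: "prime q" using that Q by (auto simp: A_def)
          then have q0: "real q > 0" by (simp add: prime_gt_0_nat)
          have "ln (real q) \<le> ln (2 * y i) / 2 ^ s i" using that by (simp add: A_def field_simps)
          then have "exp (ln (real q)) \<le> T" unfolding T_def by simp
          then show ?thesis using pr q0 by simp
        qed
        have "(\<Sum>q\<in>Q. if 2 ^ s i * ln (real q) \<le> ln (2 * y i) then b i * (ln (real q) / real q) else 0)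
            = b i * (\<Sum>q\<in>A. ln (real q) / real q)"
          unfolding sum_distrib_left A_def using Q(1) by (rule sum.inter_filter[symmetric])
        also have "\<dots> \<le> b i * (10 * ln T)"
        \<comment> \<open>At fine scales ln T may be tiny and cannot absorb the additive 6 of
          Mertens' bound; but a nonempty \<open>A\<close> forces T \<ge> 2, and then 6 \<le> 9 ln
          T.\<close>
        proof (cases "A = {}")
          case True
          then show ?thesis using b[OF i] lnt[OF i] by (simp add: T_def)
        next
          case False
          then obtain q where "q \<in> A" by blast
          then have T2: "T \<ge> 2" using A[of q] prime_ge_2_nat[of q] by force
          have "ln 2 \<le> ln T" using T2 by (subst ln_le_cancel_iff) auto
          then have lnT: "ln T \<ge> 2/3" using ln2_ge_two_thirds by linarith
          have "(\<Sum>q\<in>A. ln (real q) / real q) \<le> ln T + 6"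
            using A T2 Q(1) by (intro sum_primes_ln_over_id_le) (auto simp: A_def)
          also have "\<dots> \<le> 10 * ln T" using lnT by linarith
          finally show ?thesis using b[OF i] by (intro mult_left_mono) auto
        qed
        also have "\<dots> = 10 / (4 * real k)" using lnt[OF i] k by (simp add: T_def b_def)
        finally show "(\<Sum>q\<in>Q. if 2 ^ s i * ln (real q) \<le> ln (2 * y i) then b i * (ln (real q) / real q) else 0) \<le> 10 / (4 * real k)" .
      qed
      also have "\<dots> = 10 / 4" using k by simp
      finally show ?thesis by simp
    qed
    have sumQB: "(\<Sum>q\<in>Q - B. 1 / real q) \<le> 2 * real k"
    proof -
      define I where "I i = {q::nat. y i < real q \<and> real q \<le> 2 * y i}" for i
      have I_sub: "I i \<subseteq> {nat \<lfloor>y i\<rfloor><..nat \<lfloor>2 * y i\<rfloor>}" if "i \<in> {1..k}" for i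
        using y32[OF that] by (auto simp: I_def le_nat_floor nat_less_iff floor_less_iff)
      have finI: "finite (I i)" if "i \<in> {1..k}" for i using I_sub[OF that] by (rule finite_subset) auto
      have "(\<Sum>q\<in>Q - B. 1 / real q) \<le> (\<Sum>z\<in>Sigma {1..k} I. 1 / real (snd z))"
      proof (rule sum_le_included[where i = snd])
        show "\<forall>x\<in>Q - B. \<exists>z\<in>Sigma {1..k} I. snd z = x \<and> 1 / real x \<le> 1 / real (snd z)"
          by (force simp: B_def avoiding_primes_def I_def)
      qed (use Q finI in auto)
      also have "\<dots> = (\<Sum>i\<in>{1..k}. \<Sum>q\<in>I i. 1 / real q)"
        using finI by (subst sum.Sigma) (auto simp: split_def)
      also have "\<dots> \<le> (\<Sum>i\<in>{1..k}. 2)"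
      proof (intro sum_mono)
        fix i assume i: "i \<in> {1..k}"
        have "(\<Sum>q\<in>I i. 1 / real q) \<le> (\<Sum>q\<in>I i. 1 / y i)"
          using y32[OF i] by (intro sum_mono divide_left_mono) (auto simp: I_def)
        also have "\<dots> = real (card (I i)) / y i" by simp
        also have "\<dots> \<le> (2 * y i) / y i"
        proof (rule divide_right_mono)
          have "card (I i) \<le> card {nat \<lfloor>y i\<rfloor><..nat \<lfloor>2 * y i\<rfloor>}" using I_sub[OF i] by (intro card_mono) auto
          also have "\<dots> = nat \<lfloor>2 * y i\<rfloor> - nat \<lfloor>y i\<rfloor>" by simp
          also have "\<dots> \<le> nat \<lfloor>2 * y i\<rfloor>" by simp
          finally have "real (card (I i)) \<le> real (nat \<lfloor>2 * y i\<rfloor>)" by simp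
          also have "\<dots> \<le> 2 * y i" using y32[OF i] by (intro of_nat_floor) auto
          finally show "real (card (I i)) \<le> 2 * y i" .
        qed (use y32[OF i] in auto)
        also have "\<dots> = 2" using y32[OF i] by simp
        finally show "(\<Sum>q\<in>I i. 1 / real q) \<le> 2" .
      qed
      finally show ?thesis by simp
    qed
    have \<beta>_le: "0 \<le> \<beta> q \<and> \<beta> q * ln (real q) \<le> 1/4" for q
    proof
      show "0 \<le> \<beta> q" unfolding \<beta>_eq using b by (intro sum_nonneg) (auto simp: less_imp_le)
      have "\<beta> q * ln (real q) = (\<Sum>i=1..k. (if 2 ^ s i * ln (real q) \<le> ln (2 * y i) then b i else 0) * ln (real q))"
        unfolding \<beta>_eq sum_distrib_right ..
      also have "\<dots> \<le> (\<Sum>i=1..k. 1 / (4 * real k))"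
      proof (intro sum_mono)
        fix i assume i: "i \<in> {1..k}"
        show "(if 2 ^ s i * ln (real q) \<le> ln (2 * y i) then b i else 0) * ln (real q) \<le> 1 / (4 * real k)"
        proof (cases "2 ^ s i * ln (real q) \<le> ln (2 * y i)")
          case True
          have "b i * ln (real q) = (2 ^ s i * ln (real q)) / (4 * real k * ln (2 * y i))" by (simp add: b_def)
          also have "\<dots> \<le> ln (2 * y i) / (4 * real k * ln (2 * y i))"
            using True lnt[OF i] by (intro divide_right_mono) auto
          also have "\<dots> = 1 / (4 * real k)" using lnt[OF i] by simp
          finally show ?thesis using True by simp
        qed auto
      qed
      also have "\<dots> = 1 / 4" using k by simp
      finally show "\<beta> q * ln (real q) \<le> 1/4" .
    qed
    have "(\<Sum>m\<in>ints_over Q V. scale_weight k y s m * L_smooth k (\<lambda>i. 2 * y i) m / real m)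
      \<le> exp (C * ((\<Sum>q\<in>Q \<inter> B. \<beta> q * ln (real q) / real q) + (\<Sum>q\<in>Q - B. 1 / real q) + 1)) *
        (\<Sum>m\<in>ints_over (Q \<inter> B) 1. L_smooth k (\<lambda>i. 2 * y i) m / real m)"
      unfolding scale_weight_def Q_def[symmetric] \<beta>_def[symmetric]
    proof (rule Rankin)
      show "\<forall>m q v. q \<in> Q \<longrightarrow> m > 0 \<longrightarrow> \<not> q dvd m \<longrightarrow>
          L_smooth k (\<lambda>i. 2 * y i) (m * q ^ v) \<le> real (v+1) ^ k * L_smooth k (\<lambda>i. 2 * y i) m"
        using Q(2) L_smooth_mult_prime_power_le by blast
      show "\<forall>q. 0 \<le> \<beta> q \<and> \<beta> q * ln (real q) \<le> 1/4" using \<beta>_le by (rule allI)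
    qed (use Q V in \<open>auto simp: L_smooth_nonneg\<close>)
    also have "\<dots> \<le> E * L_sum k y"
    proof (rule mult_mono)
      show "exp (C * ((\<Sum>q\<in>Q \<inter> B. \<beta> q * ln (real q) / real q) + (\<Sum>q\<in>Q - B. 1 / real q) + 1)) \<le> E"
        unfolding E_def using sumB sumQB C by (simp add: mult_left_mono add_mono)
      show "(\<Sum>m\<in>ints_over (Q \<inter> B) 1. L_smooth k (\<lambda>i. 2 * y i) m / real m) \<le> L_sum k y"
        unfolding Q_def B_def by (rule sum_avoiding_primes_le[OF k y1(1) mono])
      show "0 \<le> (\<Sum>m\<in>ints_over (Q \<inter> B) 1. L_smooth k (\<lambda>i. 2 * y i) m / real m)"
        by (intro sum_nonneg) (auto simp: L_smooth_nonneg)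
    qed (use E in auto)
    finally show "(\<Sum>m\<in>ints_over (primes_upto (2 * y k)) V.
        scale_weight k y s m * L_smooth k (\<lambda>i. 2 * y i) m / real m) \<le> E * L_sum k y"
      by (simp add: Q_def)
  qed
qed

text \<open>With u = 2^s, replacing ln p by ln yi costs at most (2u)^\<alpha> \<le> 4 u^2. The large
  divisor d pays through exp (u/(16k)), up to a factor 2. This is at least (u/(48k))^3, the 48 being
  3 * 16: two powers of u cover the loss, the third leaves the factor (1/2)^s needed for summing
  over s.\<close>

lemma scale_loss_le:
  fixes k s :: nat and u p yi d \<alpha> :: real
  assumes k: "k \<ge> 1" and yi: "yi \<ge> 32" and p: "p \<ge> 2"
    and s: "2 ^ s * ln p \<le> ln (2 * yi)" "ln (2 * yi) < 2 ^ (s+1) * ln p"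
    and d: "sqrt yi / (2 * p) < d" and \<alpha>: "0 \<le> \<alpha>" "\<alpha> \<le> 2"
  shows "ln p powr (- \<alpha>) \<le> 8 * (48 * real k) ^ 3 *
    (ln yi powr (- \<alpha>) * ((1/2) ^ s * exp (2 ^ s / (4 * real k * ln (2 * yi)) * ln d)))"
proof -
  define u :: real where "u = 2 ^ s"
  define l where "l = ln (2 * yi)"
  have u: "u \<ge> 1" by (simp add: u_def)
  have k': "real k \<ge> 1" using k by simp
  have lnp: "ln p > 0" using p by simp
  \<comment> \<open>The source of the bound 32: with ln yi = l - ln 2, the inequality ln yi / 2 - ln
    2 \<ge> l/4 holds precisely when l \<ge> 6 ln 2.\<close>
  have l_ge: "l \<ge> 6 * ln 2"
  proof -
    have "ln ((2::real) ^ 6) \<le> ln (2 * yi)" using yi by (subst ln_le_cancel_iff) auto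
    then show ?thesis using ln_realpow[of 2 6] by (simp add: l_def)
  qed
  have ln2: "ln 2 > (0::real)" by simp
  have l0: "l > 0" using l_ge ln2 by linarith
  have lny: "ln yi > 0" using yi by simp
  have l_eq: "l = ln 2 + ln yi" using yi by (simp add: l_def ln_mult)
  have "ln p powr (- \<alpha>) \<le> (ln yi / (2 * u)) powr (- \<alpha>)"
  proof (rule powr_mono2')
    have "ln yi \<le> l" using l_eq ln2 by linarith
    also have "l < 2 * u * ln p" using s(2) by (simp add: l_def u_def power_add)
    finally show "ln yi / (2 * u) \<le> ln p" using u by (simp add: field_simps)
  qed (use \<alpha> lny u in auto)
  also have "\<dots> = ln yi powr (- \<alpha>) * (2 * u) powr \<alpha>"
    using lny u by (simp add: powr_divide powr_minus field_simps)
  also have "\<dots> \<le> ln yi powr (- \<alpha>) * (4 * u ^ 2)"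
  proof (rule mult_left_mono)
    have "(2 * u) powr \<alpha> \<le> (2 * u) powr 2" using u \<alpha> by (intro powr_mono) auto
    also have "\<dots> = 4 * u ^ 2" using u by (simp add: powr_numeral power2_eq_square)
    finally show "(2 * u) powr \<alpha> \<le> 4 * u ^ 2" .
  qed auto
  also have "\<dots> \<le> ln yi powr (- \<alpha>) * (8 * (48 * real k) ^ 3 * ((1/2) ^ s * exp (u / (4 * real k * l) * ln d)))"
  proof (rule mult_left_mono)
    have "ln (sqrt yi / (2 * p)) \<le> ln d" using d yi p by (subst ln_le_cancel_iff) (auto intro: less_trans[rotated])
    then have "ln yi / 2 - ln 2 - ln p \<le> ln d" using yi p by (simp add: ln_div ln_mult ln_sqrt)
    moreover have "ln p \<le> l / u" using s(1) u by (simp add: l_def u_def field_simps)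
    ultimately have "l / 4 - l / u \<le> ln d" using l_eq l_ge by linarith
    then have "u / (4 * real k * l) * (l / 4 - l / u) \<le> u / (4 * real k * l) * ln d"
      using u k' l0 by (intro mult_left_mono) auto
    moreover have "u / (4 * real k * l) * (l / 4 - l / u) = u / (16 * real k) - 1 / (4 * real k)"
      using u k' l0 by (simp add: field_simps)
    ultimately have "exp (u / (16 * real k) - 1 / (4 * real k)) \<le> exp (u / (4 * real k * l) * ln d)" by simp
    moreover have "exp (u / (16 * real k)) * (1/2) \<le> exp (u / (16 * real k) - 1 / (4 * real k))"
    proof -
      have "1 / (4 * real k) \<le> 1 / 4" using k' by (simp add: field_simps)
      then have "1 / 2 \<le> 1 + (- (1 / (4 * real k)))" by linarith
      also have "\<dots> \<le> exp (- (1 / (4 * real k)))" by (rule exp_ge_add_one_self)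
      finally have "exp (u / (16 * real k)) * (1/2) \<le> exp (u / (16 * real k)) * exp (- (1 / (4 * real k)))"
        by (intro mult_left_mono) auto
      then show ?thesis by (simp add: exp_add[symmetric])
    qed
    moreover have "(u / (48 * real k)) ^ 3 \<le> exp (u / (16 * real k))"
    proof -
      have "u / (48 * real k) \<le> exp (u / (48 * real k))" using exp_ge_add_one_self[of "u / (48 * real k)"] by linarith
      then have "(u / (48 * real k)) ^ 3 \<le> exp (u / (48 * real k)) ^ 3" using u k' by (intro power_mono) auto
      also have "\<dots> = exp (u / (16 * real k))" by (simp add: exp_of_nat_mult[symmetric])
      finally show ?thesis .
    qed
    ultimately have ge: "(u / (48 * real k)) ^ 3 / 2 \<le> exp (u / (4 * real k * l) * ln d)" by linarith
    have "4 * u ^ 2 = 8 * (48 * real k) ^ 3 * ((1/2) ^ s * ((u / (48 * real k)) ^ 3 / 2))"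
    proof -
      have "(1/2) ^ s = 1 / u" by (simp add: u_def power_divide)
      then show ?thesis using u k' by (simp add: power_divide power2_eq_square power3_eq_cube)
    qed
    also have "\<dots> \<le> 8 * (48 * real k) ^ 3 * ((1/2) ^ s * exp (u / (4 * real k * l) * ln d))"
      using ge by (intro mult_left_mono) auto
    finally show "4 * u ^ 2 \<le> 8 * (48 * real k) ^ 3 * ((1/2) ^ s * exp (u / (4 * real k * l) * ln d))" .
  qed auto
  finally show ?thesis by (simp add: u_def l_def mult_ac)
qed

text \<open>Different i may point to the same large divisor d'_j. This does no harm, since each such
  divisor divides m itself and \<open>scale_exponent\<close> is a sum over i, so that the k gains
  multiply on the same m. The upper limit for s_i comes from P_i \<ge> 2 and makes the set of scales
  finite.\<close>

lemma ex_scale: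
  fixes P :: "nat \<Rightarrow> nat"
  assumes k: "k \<ge> 1" and y1: "y 1 \<ge> 32" and mono: "\<forall>i\<in>{1..<k}. y i \<le> y (i + 1)"
    and m: "m > 0" and P: "\<forall>j\<in>{1..k}. prime (P j) \<and> real (P j) \<le> 2 * y j"
    and adm: "d' \<in> adm k (\<lambda>i. 2 * y i) m"
    and large: "\<forall>i\<in>{1..k}. \<exists>j\<in>{1..i}. (\<forall>q\<in>prime_factors (d' j). q \<le> P i) \<and> sqrt (y i) / (2 * real (P i)) < real (d' j)"
  shows "\<exists>s\<in>Pi\<^sub>E {1..k} (\<lambda>_. {0..nat \<lceil>ln (2 * y k) / ln 2\<rceil>}).
    (\<Prod>i=1..k. ln (real (P i)) powr (- e k i)) \<le> (8 * (48 * real k) ^ 3) ^ k *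
      ((\<Prod>i=1..k. ln (y i) powr (- e k i)) * ((\<Prod>i=1..k. (1/2) ^ s i) * scale_weight k y s m))"
proof -
  note ymono = mono_upto[OF mono]
  have y32: "y i \<ge> 32" if "i \<in> {1..k}" for i using ymono[of 1 i] y1 that by auto
  have P2: "real (P i) \<ge> 2" if "i \<in> {1..k}" for i using P that prime_ge_2_nat[of "P i"] by auto
  have lnP: "ln (real (P i)) \<ge> ln 2" if "i \<in> {1..k}" for i using P2[OF that] by simp
  have "\<exists>s::nat. 2 ^ s * ln (real (P i)) \<le> ln (2 * y i) \<and> ln (2 * y i) < 2 ^ (s+1) * ln (real (P i))" if i: "i \<in> {1..k}" for i
  proof -
    have pos: "ln (real (P i)) > 0" using P2[OF i] by simp
    have "ln (real (P i)) \<le> ln (2 * y i)" using P i P2[OF i] y32[OF i] by (subst ln_le_cancel_iff) auto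
    then have "ln (2 * y i) / ln (real (P i)) \<ge> 1" using pos by simp
    then obtain s :: nat where "2 ^ s \<le> ln (2 * y i) / ln (real (P i))" "ln (2 * y i) / ln (real (P i)) < 2 ^ (s+1)"
      by (rule dyadic_interval_left)
    then show ?thesis using pos by (auto simp: field_simps intro!: exI[of _ s])
  qed
  then obtain s0 where s0: "\<And>i. i \<in> {1..k} \<Longrightarrow> 2 ^ s0 i * ln (real (P i)) \<le> ln (2 * y i) \<and> ln (2 * y i) < 2 ^ (s0 i+1) * ln (real (P i))"
    by metis
  define s :: "nat \<Rightarrow> nat" where "s = restrict s0 {1..k}"
  have s: "2 ^ s i * ln (real (P i)) \<le> ln (2 * y i)" "ln (2 * y i) < 2 ^ (s i+1) * ln (real (P i))" if "i \<in> {1..k}" for i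
    using s0[OF that] that by (auto simp: s_def)
  have s_mem: "s \<in> Pi\<^sub>E {1..k} (\<lambda>_. {0..nat \<lceil>ln (2 * y k) / ln 2\<rceil>})"
  proof (rule PiE_I)
    fix i assume i: "i \<in> {1..k}"
    have "real (s i) \<le> 2 ^ s i" using of_nat_less_two_power[of "s i", where ?'a = real] by linarith
    also have "2 ^ s i \<le> ln (2 * y i) / ln 2"
    proof -
      have "2 ^ s i * ln 2 \<le> 2 ^ s i * ln (real (P i))" using lnP[OF i] by (intro mult_left_mono) auto
      also note s(1)[OF i]
      finally show ?thesis by (simp add: field_simps)
    qed
    also have "\<dots> \<le> ln (2 * y k) / ln 2"
      using ymono[of i k] i y32[OF i] by (intro divide_right_mono) auto
    finally have "real (s i) \<le> ln (2 * y k) / ln 2" .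
    then have "int (s i) \<le> \<lceil>ln (2 * y k) / ln 2\<rceil>"
      by (metis le_ceiling_iff less_le_trans of_int_of_nat_eq ceiling_mono ceiling_of_nat)
    then show "s i \<in> {0..nat \<lceil>ln (2 * y k) / ln 2\<rceil>}" by auto
  qed (auto simp: s_def)
  define Q where "Q = primes_upto (2 * y k)"
  have Q: "finite Q" "\<forall>q\<in>Q. prime q" by (auto simp: Q_def dest: prime_primes_upto)
  have "\<exists>j. \<forall>i\<in>{1..k}. j i \<in> {1..i} \<and> (\<forall>q\<in>prime_factors (d' (j i)). q \<le> P i) \<and>
      sqrt (y i) / (2 * real (P i)) < real (d' (j i))"
    by (rule bchoice) (use large in blast)
  then obtain j where j: "\<And>i. i \<in> {1..k} \<Longrightarrow> j i \<in> {1..i} \<and> (\<forall>q\<in>prime_factors (d' (j i)). q \<le> P i) \<and>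
      sqrt (y i) / (2 * real (P i)) < real (d' (j i))"
    by blast
  define b where "b i = 2 ^ s i / (4 * real k * ln (2 * y i))" for i
  have b: "b i \<ge> 0" if "i \<in> {1..k}" for i using y32[OF that] by (simp add: b_def)
  have weight: "(\<Prod>i=1..k. exp (b i * ln (real (d' (j i))))) \<le> scale_weight k y s m"
  proof -
    have "(\<Sum>i=1..k. b i * ln (real (d' (j i))))
        \<le> (\<Sum>i=1..k. b i * (\<Sum>q\<in>{q\<in>Q. 2 ^ s i * ln (real q) \<le> ln (2 * y i)}. ln (real q) * real (multiplicity q m)))"
    proof (intro sum_mono mult_left_mono ln_le_sum_multiplicity)
      fix i assume i: "i \<in> {1..k}"
      have ji: "j i \<in> {1..k}" using j[OF i] i by auto
      have "d' (j i) dvd (\<Prod>i=1..k. d' i)" using ji by (intro dvd_prodI) auto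
      then show "d' (j i) dvd m" using adm by (auto simp: adm_def intro: dvd_trans)
      show "prime_factors (d' (j i)) \<subseteq> {q\<in>Q. 2 ^ s i * ln (real q) \<le> ln (2 * y i)}"
      proof
        fix q assume q: "q \<in> prime_factors (d' (j i))"
        then have qP: "q \<le> P i" and pr: "prime q" using j[OF i] by (auto simp: in_prime_factors_iff)
        have q0: "real q > 0" using pr by (simp add: prime_gt_0_nat)
        have "2 ^ s i * ln (real q) \<le> 2 ^ s i * ln (real (P i))"
          using qP q0 by (intro mult_left_mono) auto
        also note s(1)[OF i]
        finally have 1: "2 ^ s i * ln (real q) \<le> ln (2 * y i)" .
        have "real q \<le> real (P i)" using qP by simp
        also have "\<dots> \<le> 2 * y i" using P i by auto
        also have "\<dots> \<le> 2 * y k" using ymono[of i k] i by auto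
        finally show "q \<in> {q\<in>Q. 2 ^ s i * ln (real q) \<le> ln (2 * y i)}" using 1 pr by (simp add: Q_def primes_upto_def)
      qed
    qed (use Q m b in auto)
    also have "\<dots> = (\<Sum>i=1..k. \<Sum>q\<in>Q. (if 2 ^ s i * ln (real q) \<le> ln (2 * y i) then b i else 0) * ln (real q) * real (multiplicity q m))"
      unfolding sum_distrib_left using Q(1)
      by (intro sum.cong refl sum.mono_neutral_cong_left) auto
    also have "\<dots> = (\<Sum>q\<in>Q. \<Sum>i=1..k. (if 2 ^ s i * ln (real q) \<le> ln (2 * y i) then b i else 0) * ln (real q) * real (multiplicity q m))"
      by (rule sum.swap)
    also have "\<dots> = (\<Sum>q\<in>Q. scale_exponent k y s q * ln (real q) * real (multiplicity q m))"
      unfolding scale_exponent_def b_def sum_distrib_right ..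
    finally show ?thesis
      unfolding scale_weight_def Q_def[symmetric] exp_sum[OF Q(1), symmetric] by (simp add: exp_sum[symmetric])
  qed
  have "(\<Prod>i=1..k. ln (real (P i)) powr (- e k i)) \<le> (\<Prod>i=1..k. 8 * (48 * real k) ^ 3 *
    (ln (y i) powr (- e k i) * ((1/2) ^ s i * exp (b i * ln (real (d' (j i)))))))"
  proof (intro prod_mono conjI)
    fix i assume i: "i \<in> {1..k}"
    show "ln (real (P i)) powr (- e k i) \<le> 8 * (48 * real k) ^ 3 *
      (ln (y i) powr (- e k i) * ((1/2) ^ s i * exp (b i * ln (real (d' (j i))))))"
      unfolding b_def using k y32[OF i] P2[OF i] s[OF i] j[OF i] by (intro scale_loss_le) (auto simp: e_def)
  qed auto
  also have "\<dots> = (8 * (48 * real k) ^ 3) ^ k * ((\<Prod>i=1..k. ln (y i) powr (- e k i)) *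
      ((\<Prod>i=1..k. (1/2) ^ s i) * (\<Prod>i=1..k. exp (b i * ln (real (d' (j i)))))))"
    by (simp add: prod.distrib)
  also have "\<dots> \<le> (8 * (48 * real k) ^ 3) ^ k * ((\<Prod>i=1..k. ln (y i) powr (- e k i)) *
      ((\<Prod>i=1..k. (1/2) ^ s i) * scale_weight k y s m))"
    using weight by (intro mult_left_mono) (auto intro!: prod_nonneg)
  finally show ?thesis using s_mem by blast
qed

text \<open>The origin of the exponents (1, ..., 1, 2): passing from 1/p to ln p / p leaves one
  logarithm per prime, and P_k carries the sieve's logarithm in addition.\<close>

lemma prod_ln_over_id:
  fixes P :: "nat \<Rightarrow> nat"
  assumes k: "k \<ge> 1" and P: "\<And>i. i \<in> {1..k} \<Longrightarrow> P i \<ge> 2"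
  shows "1 / (real (\<Prod>i=1..k. P i) * ln (real (P k)))
    = (\<Prod>i=1..k. ln (real (P i)) / real (P i)) * (\<Prod>i=1..k. ln (real (P i)) powr (- e k i))"
proof -
  have "(\<Prod>i=1..k. ln (real (P i)) / real (P i)) * (\<Prod>i=1..k. ln (real (P i)) powr (- e k i))
      = (\<Prod>i=1..k. (1 / real (P i)) * (if i = k then 1 / ln (real (P k)) else 1))"
    unfolding prod.distrib[symmetric]
  proof (intro prod.cong refl)
    fix i assume i: "i \<in> {1..k}"
    have l: "ln (real (P i)) > 0" using P[OF i] by simp
    have "ln (real (P i)) powr (- 2) = 1 / ln (real (P i)) ^ 2"
      using l by (simp add: powr_minus_divide)
    moreover have "ln (real (P i)) powr (- 1) = 1 / ln (real (P i))"
      using l by (simp add: powr_minus_divide)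
    ultimately show "ln (real (P i)) / real (P i) * ln (real (P i)) powr (- e k i)
        = (1 / real (P i)) * (if i = k then 1 / ln (real (P k)) else 1)"
      using l by (cases "i = k") (auto simp: e_def power2_eq_square)
  qed
  also have "\<dots> = (\<Prod>i=1..k. 1 / real (P i)) * (1 / ln (real (P k)))"
    unfolding prod.distrib using k by simp
  also have "\<dots> = 1 / (real (\<Prod>i=1..k. P i) * ln (real (P k)))" by (simp add: prod_dividef)
  finally show ?thesis ..
qed

section \<open>Counting\<close>

lemma card_UN_le_real:
  assumes "finite I" "\<And>i. i \<in> I \<Longrightarrow> real (card (f i)) \<le> g i"
  shows "real (card (\<Union>i\<in>I. f i)) \<le> (\<Sum>i\<in>I. g i)"
proof -
  have "real (card (\<Union>i\<in>I. f i)) \<le> real (\<Sum>i\<in>I. card (f i))"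
    using card_UN_le[OF assms(1), of f] by (simp only: of_nat_le_iff)
  also have "\<dots> = (\<Sum>i\<in>I. real (card (f i)))" by (rule of_nat_sum)
  also have "\<dots> \<le> (\<Sum>i\<in>I. g i)" using assms(2) by (rule sum_mono)
  finally show ?thesis .
qed

text \<open>An integer b > 1 in the set has a prime factor between p and X/c, which gives the
  condition X/c > p of the sieve bound. Otherwise the set is empty.\<close>

lemma card_rough_multiples_le:
  assumes "prime p" "c > 0" "X > 0"
  shows "real (card ((\<lambda>b. c * b) ` {b\<in>rough (real p) (X / real c). b > 1})) \<le> 50 * (X / real c) / ln (real p)"
proof (cases "{b\<in>rough (real p) (X / real c). b > 1} = {}")
  case True
  have "ln (real p) > 0" using prime_gt_1_nat[OF assms(1)] by simp
  then show ?thesis unfolding True using assms by simp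
next
  case False
  then obtain b where b: "b \<in> rough (real p) (X / real c)" "b > 1" by blast
  obtain q where q: "prime q" "q dvd b" using b(2) prime_factor_nat[of b] by auto
  have "real p < real q" using b q by (auto simp: rough_def in_prime_factors_iff)
  also have "real q \<le> real b" using q b by (auto intro: dvd_imp_le)
  also have "\<dots> \<le> X / real c" using b by (simp add: rough_def)
  finally have pX: "X / real c > real p" .
  have "card ((\<lambda>b. c * b) ` {b\<in>rough (real p) (X / real c). b > 1}) \<le> card {b\<in>rough (real p) (X / real c). b > 1}"
    by (intro card_image_le) auto
  also have "\<dots> \<le> card (rough (real p) (X / real c))" by (intro card_mono) auto
  finally have "real (card ((\<lambda>b. c * b) ` {b\<in>rough (real p) (X / real c). b > 1})) \<le> real (card (rough (real p) (X / real c)))"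
    by simp
  also have "\<dots> \<le> 50 * (X / real c) / ln (real p)"
    using prime_ge_2_nat[OF assms(1)] pX by (intro card_rough_le) auto
  finally show ?thesis .
qed

text \<open>Each n is covered by data \<sigma>, \<rho>, s, m, P, b. The first two have boundedly
  many values, s is summed against (1/2)^s, m against the Rankin weight, P against the volume of
  boxes, and b by the sieve. The tuple d' is never summed over: only membership of the point in the
  union of boxes is kept.\<close>

lemma card_localized_no_tie_le:
  assumes k: "k \<ge> 1"
  shows "\<exists>C\<ge>0. \<forall>X y. y 1 \<ge> 32 \<and> (\<forall>i\<in>{1..<k}. y i \<le> y (i + 1)) \<and> 2 ^ k * (\<Prod>i=1..k. y i) * sqrt (y k) \<le> X \<longrightarrow>
    real (card {n. X / 2 < real n \<and> real n \<le> X \<and>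
      localized k y n \<and> \<not> max_prime_square_dvd n}) \<le> C * (X * ((\<Prod>i=1..k. ln (y i) powr (- e k i)) * L_sum k y))"
proof -
  obtain E where E: "E > 0" and weight_sum: "\<And>y s V. y 1 \<ge> 32 \<Longrightarrow> (\<forall>i\<in>{1..<k}. y i \<le> y (i + 1)) \<Longrightarrow> V \<ge> 1 \<Longrightarrow>
    (\<Sum>m\<in>ints_over (primes_upto (2 * y k)) V. scale_weight k y s m * L_smooth k (\<lambda>i. 2 * y i) m / real m)
      \<le> E * L_sum k y"
    using sum_scale_weight_le[OF k] by blast
  define A where "A = (8 * (48 * real k) ^ 3) ^ k"
  have A: "A \<ge> 0" by (simp add: A_def)
  \<comment> \<open>From the left: the choices of \<sigma>, those of \<rho>, the sum over scales,
    the sieve constant, the loss \<open>A\<close> from \<open>ex_scale\<close>, the sum over the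
    P_i, and the Rankin constant.\<close>
  define C where "C = real (k+1) ^ k * (real (k+1) ^ k * (2 ^ k * (50 * A * (24 / ln 2) ^ k * E)))"
  have C: "C \<ge> 0" using A E by (simp add: C_def)
  show ?thesis
  proof (intro exI[of _ C] conjI allI impI)
    show "C \<ge> 0" by fact
    fix X :: real and y :: "nat \<Rightarrow> real"
    assume "y 1 \<ge> 32 \<and> (\<forall>i\<in>{1..<k}. y i \<le> y (i + 1)) \<and> 2 ^ k * (\<Prod>i=1..k. y i) * sqrt (y k) \<le> X"
    then have y1: "y 1 \<ge> 32" "y 1 \<ge> 4" "y 1 \<ge> 1" and mono: "\<forall>i\<in>{1..<k}. y i \<le> y (i + 1)"
      and X: "2 ^ k * (\<Prod>i=1..k. y i) * sqrt (y k) \<le> X" by auto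
    have y32: "y i \<ge> 32" if "i \<in> {1..k}" for i using mono_upto[OF mono, of 1 i] y1 that by auto
    define Y where "Y = (\<Prod>i=1..k. y i)"
    have Y: "Y > 0" unfolding Y_def using y32 by (intro prod_pos) (meson less_le_trans zero_less_numeral)
    have "0 < 2 ^ k * Y * sqrt (y k)" using Y y32[of k] k by simp
    then have X0: "X > 0" using X by (simp add: Y_def)
    define N where "N = {n. X / 2 < real n \<and> real n \<le> X \<and>
      localized k y n \<and> \<not> max_prime_square_dvd n}"
    define t where "t = (\<lambda>i. 2 * y i)"
    define Q where "Q = primes_upto (2 * y k)"
    have Q: "finite Q" "\<forall>q\<in>Q. prime q" by (auto simp: Q_def dest: prime_primes_upto)
    define V where "V = nat \<lfloor>X\<rfloor> + 1"
    define yy where "yy = y_ext k y X"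
    have yy: "yy i > 0" if "i \<in> {1..k+1}" for i
    proof (cases "i \<le> k")
      case True
      then show ?thesis using y32[of i] that by (simp add: yy_def y_ext_def)
    next
      case False
      then show ?thesis using X0 Y by (simp add: yy_def y_ext_def Y_def)
    qed
    define TT where "TT = (\<Prod>i=1..k. ln (y i) powr (- e k i))"
    have TT: "TT \<ge> 0" unfolding TT_def by (intro prod_nonneg) auto
    define Sg where "Sg = Pi\<^sub>E {1..k} (\<lambda>_. {1..k+1})"
    \<comment> \<open>P_i d'_i is known only up to a factor 2^(k+1), while a box has side ln 2. The
      index \<rho>_i selects one of the k + 1 dyadic pieces, so the point ln (2^(\<rho>_i)
      yy(\<sigma>_i)) - ln P_i falls into the box of d'.\<close>
    define Rh where "Rh = Pi\<^sub>E {1..k} (\<lambda>_. {0..k})"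
    define Sc where "Sc = Pi\<^sub>E {1..k} (\<lambda>_. {0..nat \<lceil>ln (2 * y k) / ln 2\<rceil>})"
    define Ms where "Ms = ints_over Q V"
    have fin: "finite Sg" "finite Rh" "finite Sc" "finite Ms"
      unfolding Sg_def Rh_def Sc_def Ms_def using Q
      by (auto intro!: finite_PiE finite_ints_over)
    define reg where "reg \<sigma> \<rho> m = {P\<in>Pi\<^sub>E {1..k} (\<lambda>_. Q).
        (\<lambda>i\<in>{1..k}. ln (2 ^ \<rho> i * yy (\<sigma> i)) - ln (real (P i))) \<in> log_boxes k (adm k t m)}"
      for \<sigma> \<rho> :: "nat \<Rightarrow> nat" and m
    define h :: "(nat \<Rightarrow> nat) \<Rightarrow> real" where "h s = (\<Prod>i=1..k. (1/2) ^ s i)" for s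
    \<comment> \<open>The scale inequality is built into the index set because it was derived from
      d', which is no longer available when P is summed.\<close>
    define good where "good \<sigma> \<rho> s m = {P\<in>reg \<sigma> \<rho> m.
        (\<Prod>i=1..k. ln (real (P i)) powr (- e k i)) \<le> A * (TT * (h s * scale_weight k y s m))}"
      for \<sigma> \<rho> s :: "nat \<Rightarrow> nat" and m
    define fib where "fib m P = (\<lambda>b. ((\<Prod>i=1..k. P i) * m) * b) ` {b\<in>rough (real (P k)) (X / real ((\<Prod>i=1..k. P i) * m)). b > 1}"
      for m and P :: "nat \<Rightarrow> nat"
    have h: "h s \<ge> 0" for s unfolding h_def by (intro prod_nonneg) auto
    have reg_fin: "finite (reg \<sigma> \<rho> m)" for \<sigma> \<rho> m
      unfolding reg_def using Q(1) by (intro finite_subset[OF _ finite_PiE[of "{1..k}" "\<lambda>_. Q"]]) auto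
    have good_fin: "finite (good \<sigma> \<rho> s m)" for \<sigma> \<rho> s m
      unfolding good_def using reg_fin by simp
    have cover: "N \<subseteq> (\<Union>\<sigma>\<in>Sg. \<Union>\<rho>\<in>Rh. \<Union>s\<in>Sc. \<Union>m\<in>Ms. \<Union>P\<in>good \<sigma> \<rho> s m. fib m P)"
    proof
      fix n assume n: "n \<in> N"
      then obtain d where d: "\<forall>i\<in>{1..k}. 1 \<le> d i \<and> y i < real (d i) \<and> real (d i) \<le> 2 * y i" "(\<Prod>i=1..k. d i) dvd n"
        unfolding N_def localized_def by blast
      have n': "X / 2 < real n" "real n \<le> X" "\<not> max_prime_square_dvd n" using n by (auto simp: N_def)
      obtain \<sigma> P d' m b where \<sigma>: "\<sigma> \<in> {1..k} \<rightarrow> {1..k+1}"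
        and P: "\<forall>j\<in>{1..k}. prime (P j) \<and> real (P j) \<le> 2 * y j \<and> yy (\<sigma> j) < real (P j) * real (d' j) \<and>
          real (P j) * real (d' j) \<le> 2 ^ (k+1) * yy (\<sigma> j)"
        and adm: "d' \<in> adm k (\<lambda>i. 2 * y i) m"
        and large: "\<forall>i\<in>{1..k}. \<exists>j\<in>{1..i}. (\<forall>q\<in>prime_factors (d' j). q \<le> P i) \<and> sqrt (y i) / (2 * real (P i)) < real (d' j)"
        and n_eq: "n = (\<Prod>j=1..k. P j) * m * b" and b: "b > 1" "\<forall>q\<in>prime_factors b. P k < q"
        and m: "m > 0" "\<forall>q\<in>prime_factors m. q \<le> P k"
        using extract_largest_primes[OF k y1(2) mono X n'(1,2) d n'(3)] unfolding yy_def by blast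
      have P0: "real (P i) > 0" if "i \<in> {1..k}" for i using P that prime_gt_0_nat[of "P i"] by auto
      obtain s where s: "s \<in> Sc"
        and s_le: "(\<Prod>i=1..k. ln (real (P i)) powr (- e k i)) \<le> A * (TT * (h s * scale_weight k y s m))"
        using ex_scale[OF k y1(1) mono m(1) _ adm large] P unfolding Sc_def A_def TT_def h_def by blast
      have "\<exists>r\<in>{0..k}. 2 ^ r * yy (\<sigma> i) < real (P i) * real (d' i) \<and> real (P i) * real (d' i) \<le> 2 ^ (r+1) * yy (\<sigma> i)"
        if i: "i \<in> {1..k}" for i
      proof -
        have pos: "yy (\<sigma> i) > 0" using \<sigma> i by (intro yy) blast
        define z where "z = real (P i) * real (d' i) / yy (\<sigma> i)"
        have "z > 1" "z \<le> 2 ^ (k+1)" using P i pos by (auto simp: z_def field_simps)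
        then obtain r where r: "2 ^ r < z" "z \<le> 2 ^ (r+1)" "r < k+1" by (rule dyadic_interval_right)
        then show ?thesis using pos by (intro bexI[of _ r]) (auto simp: z_def field_simps)
      qed
      then obtain \<rho> where \<rho>: "\<And>i. i \<in> {1..k} \<Longrightarrow> \<rho> i \<in> {0..k} \<and> 2 ^ \<rho> i * yy (\<sigma> i) < real (P i) * real (d' i) \<and>
          real (P i) * real (d' i) \<le> 2 ^ (\<rho> i+1) * yy (\<sigma> i)"
        by metis
      \<comment> \<open>Restriction to {1..k} makes the functions members of the finite extensional
        sets indexing the union.\<close>
      define \<sigma>' where "\<sigma>' = restrict \<sigma> {1..k}"
      define \<rho>' where "\<rho>' = restrict \<rho> {1..k}"
      define P' where "P' = restrict P {1..k}"
      have eqs: "\<sigma>' i = \<sigma> i" "\<rho>' i = \<rho> i" "P' i = P i" if "i \<in> {1..k}" for i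
        using that by (auto simp: \<sigma>'_def \<rho>'_def P'_def)
      have prodP': "(\<Prod>i=1..k. P' i) = (\<Prod>i=1..k. P i)" using eqs by (intro prod.cong) auto
      have "\<sigma>' \<in> Sg" using \<sigma> by (auto simp: Sg_def \<sigma>'_def)
      moreover have "\<rho>' \<in> Rh" using \<rho> by (auto simp: Rh_def \<rho>'_def)
      moreover note s
      moreover have "m \<in> Ms"
      proof -
        have PkQ: "real (P k) \<le> 2 * y k" using P k by auto
        have "prime_factors m \<subseteq> Q"
        proof
          fix q assume q: "q \<in> prime_factors m"
          then have "real q \<le> real (P k)" using m(2) by simp
          then show "q \<in> Q" using q PkQ by (simp add: Q_def primes_upto_def in_prime_factors_iff)
        qed
        moreover have "multiplicity q m \<le> V" if "q \<in> Q" for q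
        proof -
          have "m dvd n" using n_eq by simp
          moreover have "n > 0" using n'(1) X0 by (cases n) auto
          ultimately have "m \<le> n" by (intro dvd_imp_le)
          moreover have "n \<le> nat \<lfloor>X\<rfloor>" using n'(2) by (rule le_nat_floor)
          moreover have "multiplicity q m \<le> m" using Q(2) that m(1) by (intro multiplicity_le_self) auto
          ultimately show ?thesis by (simp add: V_def)
        qed
        ultimately show ?thesis using m(1) by (auto simp: Ms_def ints_over_def)
      qed
      moreover have "P' \<in> good \<sigma>' \<rho>' s m"
      proof -
        have "P' \<in> Pi\<^sub>E {1..k} (\<lambda>_. Q)"
        proof (rule PiE_I)
          fix i assume i: "i \<in> {1..k}"
          have "real (P i) \<le> 2 * y i" using P i by auto
          also have "\<dots> \<le> 2 * y k" using mono_upto[OF mono, of i k] i by auto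
          finally show "P' i \<in> Q" using P i by (auto simp: eqs Q_def primes_upto_def)
        qed (auto simp: P'_def)
        moreover have "(\<lambda>i\<in>{1..k}. ln (2 ^ \<rho>' i * yy (\<sigma>' i)) - ln (real (P' i))) \<in> log_boxes k (adm k t m)"
        proof -
          have "(\<lambda>i\<in>{1..k}. ln (2 ^ \<rho>' i * yy (\<sigma>' i)) - ln (real (P' i)))
              \<in> Pi\<^sub>E {1..k} (\<lambda>i. {ln (real (d' i) / 2)..<ln (real (d' i))})"
          proof (rule PiE_I)
            fix i assume i: "i \<in> {1..k}"
            have pos: "yy (\<sigma> i) > 0" using \<sigma> i by (intro yy) blast
            define v where "v = 2 ^ \<rho> i * yy (\<sigma> i)"
            have v: "v > 0" using pos by (simp add: v_def)
            have vle: "v < real (P i) * real (d' i)" "real (P i) * real (d' i) \<le> 2 * v"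
              using \<rho>[OF i] by (auto simp: v_def power_add)
            have d0: "real (d' i) > 0" using vle(1) v by (cases "d' i = 0") auto
            have lnv: "ln v - ln (real (P i)) = ln (v / real (P i))" using v P0[OF i] by (simp add: ln_div)
            have "v / real (P i) < real (d' i)" "real (d' i) / 2 \<le> v / real (P i)"
              using vle P0[OF i] by (simp_all add: field_simps)
            then have "ln (v / real (P i)) < ln (real (d' i))" "ln (real (d' i) / 2) \<le> ln (v / real (P i))"
              using v P0[OF i] d0 by simp_all
            then show "(\<lambda>i\<in>{1..k}. ln (2 ^ \<rho>' i * yy (\<sigma>' i)) - ln (real (P' i))) i \<in> {ln (real (d' i) / 2)..<ln (real (d' i))}"
              using i lnv by (simp add: eqs v_def)
          qed auto
          then show ?thesis using adm unfolding log_boxes_def t_def by blast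
        qed
        moreover have "(\<Prod>i=1..k. ln (real (P' i)) powr (- e k i)) = (\<Prod>i=1..k. ln (real (P i)) powr (- e k i))"
          using eqs by (intro prod.cong) auto
        ultimately show ?thesis using s_le by (simp add: good_def reg_def)
      qed
      moreover have "n \<in> fib m P'"
      proof -
        define c where "c = (\<Prod>i=1..k. P i) * m"
        have c0: "c > 0" using m(1) P by (auto simp: c_def intro!: prod_pos prime_gt_0_nat)
        have "real n = real c * real b" using n_eq by (simp add: c_def)
        then have "real b \<le> X / real c" using n'(2) c0 by (simp add: field_simps)
        then have "b \<in> rough (real (P k)) (X / real c)" using b by (auto simp: rough_def)
        then show ?thesis unfolding fib_def prodP' using b(1) n_eq k eqs[of k] by (auto simp: c_def)
      qed
      ultimately show "n \<in> (\<Union>\<sigma>\<in>Sg. \<Union>\<rho>\<in>Rh. \<Union>s\<in>Sc. \<Union>m\<in>Ms. \<Union>P\<in>good \<sigma> \<rho> s m. fib m P)" by blast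
    qed
    have fib_le: "real (card (fib m P)) \<le> 50 * X / real m * ((\<Prod>i=1..k. ln (real (P i)) / real (P i)) *
        (\<Prod>i=1..k. ln (real (P i)) powr (- e k i)))" if "m \<in> Ms" "P \<in> reg \<sigma> \<rho> m" for \<sigma> \<rho> m P
    proof -
      have pr: "prime (P i)" if "i \<in> {1..k}" for i using \<open>P \<in> reg \<sigma> \<rho> m\<close> Q(2) that by (auto simp: reg_def PiE_iff)
      have m0: "m > 0" using that(1) by (auto simp: Ms_def ints_over_def)
      have c0: "(\<Prod>i=1..k. P i) * m > 0" using m0 pr by (auto intro!: prod_pos prime_gt_0_nat)
      have "real (card (fib m P)) \<le> 50 * (X / real ((\<Prod>i=1..k. P i) * m)) / ln (real (P k))"
        unfolding fib_def using pr[of k] k c0 X0 by (intro card_rough_multiples_le) auto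
      also have "\<dots> = 50 * X / real m * (1 / (real (\<Prod>i=1..k. P i) * ln (real (P k))))"
        by simp
      also have "1 / (real (\<Prod>i=1..k. P i) * ln (real (P k)))
          = (\<Prod>i=1..k. ln (real (P i)) / real (P i)) * (\<Prod>i=1..k. ln (real (P i)) powr (- e k i))"
        using pr prime_ge_2_nat by (intro prod_ln_over_id[OF k]) auto
      finally show ?thesis .
    qed
    have per_m: "real (card (\<Union>P\<in>good \<sigma> \<rho> s m. fib m P))
        \<le> 50 * A * TT * h s * X * (24 / ln 2) ^ k * (scale_weight k y s m * L_smooth k t m / real m)"
      if m: "m \<in> Ms" for \<sigma> \<rho> s m
    proof -
      have m0: "m > 0" using m by (auto simp: Ms_def ints_over_def)
      define w where "w P = (\<Prod>i=1..k. ln (real (P i)) / real (P i))" for P :: "nat \<Rightarrow> nat"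
      have w: "w P \<ge> 0" if "P \<in> reg \<sigma> \<rho> m" for P
      proof -
        have "prime (P i)" if "i \<in> {1..k}" for i using \<open>P \<in> reg \<sigma> \<rho> m\<close> Q(2) that by (auto simp: reg_def PiE_iff)
        then have "real (P i) \<ge> 1" if "i \<in> {1..k}" for i using that prime_ge_1_nat[of "P i"] by simp
        then show ?thesis unfolding w_def by (intro prod_nonneg) auto
      qed
      define R where "R = A * (TT * (h s * scale_weight k y s m))"
      have R: "R \<ge> 0" using A TT h scale_weight_nonneg by (simp add: R_def)
      have "real (card (\<Union>P\<in>good \<sigma> \<rho> s m. fib m P)) \<le> (\<Sum>P\<in>good \<sigma> \<rho> s m. 50 * X / real m * R * w P)"
      proof (rule card_UN_le_real[OF good_fin])
        fix P assume P: "P \<in> good \<sigma> \<rho> s m"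
        then have Pr: "P \<in> reg \<sigma> \<rho> m" and PR: "(\<Prod>i=1..k. ln (real (P i)) powr (- e k i)) \<le> R"
          by (auto simp: good_def R_def)
        have "real (card (fib m P)) \<le> 50 * X / real m * (w P * (\<Prod>i=1..k. ln (real (P i)) powr (- e k i)))"
          using fib_le[OF m Pr] by (simp only: w_def)
        also have "\<dots> \<le> 50 * X / real m * (w P * R)"
          using PR w[OF Pr] X0 by (intro mult_left_mono) auto
        finally show "real (card (fib m P)) \<le> 50 * X / real m * R * w P" by (simp add: mult_ac)
      qed
      also have "\<dots> = 50 * X / real m * R * (\<Sum>P\<in>good \<sigma> \<rho> s m. w P)" by (simp add: sum_distrib_left)
      also have "\<dots> \<le> 50 * X / real m * R * ((24 / ln 2) ^ k * L_smooth k t m)"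
      proof (rule mult_left_mono)
        have "(\<Sum>P\<in>good \<sigma> \<rho> s m. w P) \<le> (\<Sum>P\<in>reg \<sigma> \<rho> m. w P)"
          using reg_fin w by (intro sum_mono2) (auto simp: good_def)
        also have "\<dots> \<le> (24 / ln 2) ^ k * L_smooth k t m"
          unfolding reg_def w_def L_smooth_def
        proof (rule sum_primes_in_log_boxes_le)
          show "1 \<le> d i \<and> d i \<le> m" if "d \<in> adm k t m" "i \<in> {1..k}" for d i
            using adm_le[OF that m0] that by (auto simp: adm_def)
        qed (use Q in auto)
        finally show "(\<Sum>P\<in>good \<sigma> \<rho> s m. w P) \<le> (24 / ln 2) ^ k * L_smooth k t m" .
      qed (use X0 R in auto)
      also have "\<dots> = 50 * A * TT * h s * X * (24 / ln 2) ^ k * (scale_weight k y s m * L_smooth k t m / real m)"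
        by (simp add: R_def)
      finally show ?thesis .
    qed
    have Ls: "L_sum k y \<ge> 0" unfolding L_sum_def by (intro sum_nonneg divide_nonneg_nonneg L_nonneg of_nat_0_le_iff)
    define Z where "Z = 50 * A * (24 / ln 2) ^ k * E * (X * (TT * L_sum k y))"
    have Z: "Z \<ge> 0" unfolding Z_def using A E X0 TT Ls by simp
    have per_s: "real (card (\<Union>m\<in>Ms. \<Union>P\<in>good \<sigma> \<rho> s m. fib m P)) \<le> h s * Z" for \<sigma> \<rho> s
    proof -
      have "real (card (\<Union>m\<in>Ms. \<Union>P\<in>good \<sigma> \<rho> s m. fib m P))
        \<le> (\<Sum>m\<in>Ms. 50 * A * TT * h s * X * (24 / ln 2) ^ k * (scale_weight k y s m * L_smooth k t m / real m))"
        using per_m by (intro card_UN_le_real fin)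
      also have "\<dots> = 50 * A * TT * h s * X * (24 / ln 2) ^ k * (\<Sum>m\<in>Ms. scale_weight k y s m * L_smooth k t m / real m)"
        by (simp add: sum_distrib_left)
      also have "\<dots> \<le> 50 * A * TT * h s * X * (24 / ln 2) ^ k * (E * L_sum k y)"
      proof (rule mult_left_mono)
        show "(\<Sum>m\<in>Ms. scale_weight k y s m * L_smooth k t m / real m) \<le> E * L_sum k y"
          unfolding Ms_def Q_def t_def by (rule weight_sum) (use y1 mono in \<open>auto simp: V_def\<close>)
      qed (use A TT h[of s] X0 in auto)
      also have "\<dots> = h s * Z" by (simp add: Z_def mult_ac)
      finally show ?thesis .
    qed
    have sum_h: "(\<Sum>s\<in>Sc. h s) \<le> 2 ^ k"
    proof -
      define J where "J = {0..nat \<lceil>ln (2 * y k) / ln 2\<rceil>}"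
      have "(\<Sum>s\<in>Sc. h s) = (\<Prod>i=1..k. \<Sum>j\<in>J. (1/2::real) ^ j)"
        unfolding Sc_def h_def J_def[symmetric] by (subst prod_sum_PiE) (auto simp: J_def)
      also have "\<dots> \<le> (\<Prod>i=1..k. 2)"
      proof (intro prod_mono conjI)
        have "(\<Sum>j\<in>J. (1/2::real) ^ j) \<le> (\<Sum>j. (1/2::real) ^ j)"
          by (intro sum_le_suminf summable_geometric) (auto simp: J_def)
        also have "\<dots> = 2" by (simp add: suminf_geometric)
        finally show "(\<Sum>j\<in>J. (1/2::real) ^ j) \<le> 2" .
      qed (auto intro!: sum_nonneg)
      finally show ?thesis by simp
    qed
    have per_\<rho>: "real (card (\<Union>s\<in>Sc. \<Union>m\<in>Ms. \<Union>P\<in>good \<sigma> \<rho> s m. fib m P)) \<le> 2 ^ k * Z" for \<sigma> \<rho>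
    proof -
      have "real (card (\<Union>s\<in>Sc. \<Union>m\<in>Ms. \<Union>P\<in>good \<sigma> \<rho> s m. fib m P)) \<le> (\<Sum>s\<in>Sc. h s * Z)"
        using per_s by (intro card_UN_le_real fin)
      also have "\<dots> = (\<Sum>s\<in>Sc. h s) * Z" by (simp add: sum_distrib_right)
      also have "\<dots> \<le> 2 ^ k * Z" using sum_h Z by (rule mult_right_mono)
      finally show ?thesis .
    qed
    have "real (card N) \<le> real (card (\<Union>\<sigma>\<in>Sg. \<Union>\<rho>\<in>Rh. \<Union>s\<in>Sc. \<Union>m\<in>Ms. \<Union>P\<in>good \<sigma> \<rho> s m. fib m P))"
      using cover fin good_fin by (intro of_nat_mono card_mono finite_UN_I) (auto simp: fib_def)
    also have "\<dots> \<le> (\<Sum>\<sigma>\<in>Sg. \<Sum>\<rho>\<in>Rh. 2 ^ k * Z)"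
      using per_\<rho> by (intro card_UN_le_real fin)
    also have "\<dots> = real (card Sg) * (real (card Rh) * (2 ^ k * Z))" by simp
    also have "card Sg = (k+1) ^ k" by (simp add: Sg_def card_PiE)
    also have "card Rh = (k+1) ^ k" by (simp add: Rh_def card_PiE One_nat_def)
    also have "real ((k+1) ^ k) * (real ((k+1) ^ k) * (2 ^ k * Z)) = C * (X * (TT * L_sum k y))"
      by (simp add: C_def Z_def)
    finally show "real (card {n. X / 2 < real n \<and> real n \<le> X \<and>
      localized k y n \<and> \<not> max_prime_square_dvd n}) \<le> C * (X * ((\<Prod>i=1..k. ln (y i) powr (- e k i)) * L_sum k y))"
      by (simp add: N_def TT_def)
  qed
qed

section \<open>Dyadic summation over n and the final estimate\<close>

theorem theorem3p9:
  fixes k :: nat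
  assumes "k \<ge> 1"
  shows "\<exists>C' c M :: real. \<forall>x :: real. \<forall>y :: nat \<Rightarrow> real.
     x \<ge> 1 \<and> C' \<le> y 1 \<and> (\<forall>i\<in>{1..<k}. y i \<le> y (i + 1)) \<and>
     2 ^ k * (\<Prod>i=1..k. y i) \<le> x / y k \<longrightarrow>
     real (H k x y (\<lambda>i. 2 * y i)) / x \<le>
       M * ((\<Prod>i=1..k. ln (y i) powr (- e k i)) *
            (\<Sum>a \<in> {a \<in> P_star_k k y. \<forall>i\<in>{1..k}. real (a i) \<le> y i powr c}.
                L k a / real (\<Prod>i=1..k. a i)))"
proof -
  note k = assms
  obtain c where trunc: "\<And>y. y 1 \<ge> 2 \<Longrightarrow> (\<forall>i\<in>{1..<k}. y i \<le> y (i + 1)) \<Longrightarrow>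
    L_sum k y \<le> 2 * L_sum_trunc c k y"
    using truncated_L_sum[OF k] by blast
  obtain C where C: "C \<ge> 0" and no_tie: "\<And>X y. y 1 \<ge> 32 \<Longrightarrow> (\<forall>i\<in>{1..<k}. y i \<le> y (i + 1)) \<Longrightarrow>
    2 ^ k * (\<Prod>i=1..k. y i) * sqrt (y k) \<le> X \<Longrightarrow>
    real (card {n. X / 2 < real n \<and> real n \<le> X \<and>
      localized k y n \<and> \<not> max_prime_square_dvd n}) \<le> C * (X * ((\<Prod>i=1..k. ln (y i) powr (- e k i)) * L_sum k y))"
    using card_localized_no_tie_le[OF k] by blast
  obtain x0 where ties: "\<And>x. x \<ge> x0 \<Longrightarrow>
      real (card {n. 1 \<le> n \<and> real n \<le> x \<and> max_prime_square_dvd n}) \<le> 4 * x / ln x ^ (k+1)"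
    using card_max_prime_square_dvd_le[of k] by blast
  have "eventually (\<lambda>v::real. ln v ^ (k+1) \<le> sqrt v) at_top" by real_asymp
  then obtain x1 where x1: "\<And>v. v \<ge> x1 \<Longrightarrow> ln v ^ (k+1) \<le> sqrt v" unfolding eventually_at_top_linorder by blast
  \<comment> \<open>The 2 is the sum of the geometric series over the dyadic ranges; 5 = 4 + 1
    accounts for the n divisible by the square of their largest prime and for the very small n, both
    measured through the lower bound ln 2 ^ k for the sum of L.\<close>
  define M0 where "M0 = 2 * C + 5 / ln 2 ^ k"
  have M0: "M0 \<ge> 0" using C by (simp add: M0_def)
  show ?thesis
  \<comment> \<open>The 32 comes from the scale estimate. Since x \<ge> y_k \<ge> y_1, a lower bound
    on y_1 also makes x and y_k large enough for \<open>x0\<close> and \<open>x1\<close>. The factor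
    2 in \<open>2 * M0\<close> is the loss in the truncation.\<close>
  proof (rule exI[of _ "max 32 (max x0 x1)"], rule exI[of _ c], rule exI[of _ "2 * M0"], intro allI impI)
    fix x :: real and y :: "nat \<Rightarrow> real"
    assume asm: "x \<ge> 1 \<and> max 32 (max x0 x1) \<le> y 1 \<and> (\<forall>i\<in>{1..<k}. y i \<le> y (i + 1)) \<and>
      2 ^ k * (\<Prod>i=1..k. y i) \<le> x / y k"
    then have x: "x \<ge> 1" and y1: "y 1 \<ge> 32" "y 1 \<ge> x0" "y 1 \<ge> x1" "y 1 \<ge> 2" "y 1 \<ge> 1"
      and mono: "\<forall>i\<in>{1..<k}. y i \<le> y (i + 1)" and xy: "2 ^ k * (\<Prod>i=1..k. y i) \<le> x / y k" by auto
    note ymono = mono_upto[OF mono]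
    have y32: "y i \<ge> 32" if "i \<in> {1..k}" for i using ymono[of 1 i] y1 that by auto
    have yk: "y k \<ge> 32" "y k \<ge> x0" "y k \<ge> x1" using ymono[of 1 k] y1 k by auto
    define Y where "Y = (\<Prod>i=1..k. y i)"
    have Y: "Y \<ge> 1" unfolding Y_def using y32 by (intro prod_ge_1) force
    have xY: "2 ^ k * Y * y k \<le> x" using xy yk by (simp add: Y_def field_simps)
    have xyk: "x \<ge> y k"
    proof -
      have "1 * 1 \<le> 2 ^ k * Y" using Y by (intro mult_mono) auto
      then have "1 * y k \<le> 2 ^ k * Y * y k" using yk by (intro mult_right_mono) auto
      then show ?thesis using xY by simp
    qed
    define TL where "TL = (\<Prod>i=1..k. ln (y i) powr (- e k i)) * L_sum k y"
    have lnyk: "ln (y k) > 0" using yk by simp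
    \<comment> \<open>Every ln y_i is at most ln y_k, and the exponents \<open>e k i\<close> add up
      to k + 1.\<close>
    have TL_ge: "ln 2 ^ k / ln (y k) ^ (k+1) \<le> TL"
    proof -
      have "1 / ln (y k) ^ (k+1) = (\<Prod>i=1..k. ln (y k) powr (- e k i))"
      proof -
        have "(\<Sum>i=1..k. e k i) = (\<Sum>i=1..k. 1 + (if i = k then 1 else 0))" by (intro sum.cong) (auto simp: e_def)
        also have "\<dots> = real (k+1)" using k by (simp add: sum.distrib)
        finally have "(\<Sum>i=1..k. - e k i) = - real (k+1)" by (simp add: sum_negf)
        moreover have "(\<Prod>i=1..k. ln (y k) powr (- e k i)) = ln (y k) powr (\<Sum>i=1..k. - e k i)"
          using lnyk by (intro powr_sum[symmetric]) auto
        ultimately show ?thesis using lnyk by (simp only: powr_minus_divide powr_realpow)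
      qed
      also have "\<dots> \<le> (\<Prod>i=1..k. ln (y i) powr (- e k i))"
      proof (intro prod_mono conjI)
        fix i assume i: "i \<in> {1..k}"
        show "ln (y k) powr (- e k i) \<le> ln (y i) powr (- e k i)"
          using y32[OF i] ymono[of i k] i by (intro powr_mono2') (auto simp: e_def)
      qed auto
      finally have "1 / ln (y k) ^ (k+1) * ln 2 ^ k \<le> TL"
        unfolding TL_def using L_sum_ge[OF k y1(5) mono] by (intro mult_mono) (auto intro!: prod_nonneg)
      then show ?thesis by simp
    qed
    have TL: "TL \<ge> 0" using TL_ge lnyk by (meson divide_nonneg_nonneg ln_ge_zero less_imp_le order_trans zero_le_power one_le_numeral)
    have small_le: "x / ln (y k) ^ (k+1) \<le> x * TL / ln 2 ^ k"
    proof -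
      have "x * (ln 2 ^ k / ln (y k) ^ (k+1)) \<le> x * TL" using TL_ge x by (intro mult_left_mono) auto
      then have "x / ln (y k) ^ (k+1) * ln 2 ^ k \<le> x * TL" by simp
      then show ?thesis by (subst pos_le_divide_eq) auto
    qed
    have "sqrt (y k) \<ge> 1" using yk by simp
    \<comment> \<open>The range (x/2^(r+1), x/2^r] satisfies the size condition of
      \<open>no_tie\<close> as long as 2^r \<le> sqrt(y_k), because x \<ge> 2^k y_1 ... y_k y_k.
      Below x/2^(R+1) there are at most x/sqrt(y_k) integers, few enough since sqrt(y_k) \<ge> (ln
      y_k)^(k+1).\<close>
    then obtain R :: nat where R: "2 ^ R \<le> sqrt (y k)" "sqrt (y k) < 2 ^ (R+1)" by (rule dyadic_interval_left)
    define Hs where "Hs = {n::nat. 1 \<le> n \<and> real n \<le> x \<and>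
       localized k y n}"
    define T where "T = {n. 1 \<le> n \<and> real n \<le> x \<and> max_prime_square_dvd n}"
    \<comment> \<open>The condition \<open>1 dvd n\<close> gives the set the shape treated by
      \<open>card_multiples_le\<close>, with p = 1.\<close>
    define Sm where "Sm = {n::nat. 1 \<le> n \<and> real n \<le> x / 2 ^ (R+1) \<and> 1 dvd n}"
    define N where "N r = {n. x / 2 ^ r / 2 < real n \<and> real n \<le> x / 2 ^ r \<and>
      localized k y n \<and> \<not> max_prime_square_dvd n}" for r :: nat
    have finz: "finite {n::nat. real n \<le> z \<and> Z n}" for z Z
      by (rule finite_subset[of _ "{..nat \<lfloor>z\<rfloor>}"]) (auto simp: le_nat_floor)
    have fin: "finite T" "finite Sm" "finite (N r)" for r
    proof -
      show "finite T" unfolding T_def by (rule finite_subset[OF _ finz[of x "\<lambda>_. True"]]) auto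
      show "finite Sm" unfolding Sm_def by (rule finite_subset[OF _ finz[of "x / 2 ^ (R+1)" "\<lambda>_. True"]]) auto
      show "finite (N r)" unfolding N_def by (rule finite_subset[OF _ finz[of "x / 2 ^ r" "\<lambda>_. True"]]) auto
    qed
    have "Hs \<subseteq> T \<union> (Sm \<union> (\<Union>r\<in>{0..R}. N r))"
    proof
      fix n assume n: "n \<in> Hs"
      have n1: "1 \<le> n" "real n \<le> x" using n by (auto simp: Hs_def)
      show "n \<in> T \<union> (Sm \<union> (\<Union>r\<in>{0..R}. N r))"
      proof (cases "max_prime_square_dvd n \<or> real n \<le> x / 2 ^ (R+1)")
        case True
        then show ?thesis using n1 by (auto simp: T_def Sm_def)
      next
        case False
        have n0: "real n > 0" using n1 by simp
        have "x / real n \<ge> 1" using n1 n0 by simp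
        then obtain r :: nat where r: "2 ^ r \<le> x / real n" "x / real n < 2 ^ (r+1)" by (rule dyadic_interval_left)
        have "x / real n < 2 ^ (R+1)" using False n0 by (simp add: field_simps)
        then have "(2::real) ^ r < 2 ^ (R+1)" using r by linarith
        then have "r < R+1" by (rule power_less_imp_less_exp[rotated]) auto
        moreover have "n \<in> N r"
        proof -
          have "x / 2 ^ r / 2 < real n" "real n \<le> x / 2 ^ r"
            using r n0 by (simp_all add: field_simps power_add)
          then show ?thesis using n False by (auto simp: N_def Hs_def)
        qed
        ultimately show ?thesis by auto
      qed
    qed
    then have "card Hs \<le> card (T \<union> (Sm \<union> (\<Union>r\<in>{0..R}. N r)))" using fin by (intro card_mono) auto
    also have "\<dots> \<le> card T + (card Sm + card (\<Union>r\<in>{0..R}. N r))"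
      using card_Un_le[of T "Sm \<union> (\<Union>r\<in>{0..R}. N r)"] card_Un_le[of Sm "\<Union>r\<in>{0..R}. N r"] by linarith
    finally have "real (card Hs) \<le> real (card T) + (real (card Sm) + real (card (\<Union>r\<in>{0..R}. N r)))" by linarith
    moreover have "real (card T) \<le> 4 * (x * TL / ln 2 ^ k)"
    proof -
      have "real (card T) \<le> 4 * x / ln x ^ (k+1)" unfolding T_def using xyk yk by (intro ties) auto
      also have "\<dots> \<le> 4 * x / ln (y k) ^ (k+1)"
        using lnyk xyk yk x by (intro divide_left_mono power_mono mult_pos_pos zero_less_power) auto
      also have "\<dots> = 4 * (x / ln (y k) ^ (k+1))" by simp
      also have "\<dots> \<le> 4 * (x * TL / ln 2 ^ k)" using small_le by (intro mult_left_mono) auto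
      finally show ?thesis .
    qed
    moreover have "real (card Sm) \<le> x * TL / ln 2 ^ k"
    proof -
      have "real (card Sm) \<le> x / 2 ^ (R+1)" unfolding Sm_def using card_multiples_le[of 1 "x / 2 ^ (R+1)"] x by simp
      also have "\<dots> \<le> x / sqrt (y k)" using R x yk by (intro divide_left_mono) auto
      also have "\<dots> \<le> x / ln (y k) ^ (k+1)" using x1[of "y k"] yk lnyk x by (intro divide_left_mono) auto
      also note small_le
      finally show ?thesis .
    qed
    moreover have "real (card (\<Union>r\<in>{0..R}. N r)) \<le> 2 * C * (x * TL)"
    proof -
      have "real (card (\<Union>r\<in>{0..R}. N r)) \<le> (\<Sum>r\<in>{0..R}. C * (x / 2 ^ r * TL))"
      proof (rule card_UN_le_real)
        fix r assume r: "r \<in> {0..R}"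
        have "2 ^ r \<le> (2::real) ^ R" using r by (intro power_increasing) auto
        then have "2 ^ r \<le> sqrt (y k)" using R by linarith
        then have "2 ^ k * Y * sqrt (y k) * 2 ^ r \<le> 2 ^ k * Y * sqrt (y k) * sqrt (y k)"
          using Y yk by (intro mult_left_mono) auto
        also have "\<dots> = 2 ^ k * Y * y k" using yk by simp
        also note xY
        finally have "2 ^ k * Y * sqrt (y k) \<le> x / 2 ^ r" by (simp add: field_simps)
        then show "real (card (N r)) \<le> C * (x / 2 ^ r * TL)"
          unfolding N_def TL_def Y_def by (rule no_tie[OF y1(1) mono])
      qed auto
      also have "\<dots> = C * (x * TL) * (\<Sum>r\<in>{0..R}. (1/2) ^ r)"
        by (simp add: sum_distrib_left power_divide mult_ac)
      also have "\<dots> \<le> C * (x * TL) * 2"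
      proof (rule mult_left_mono)
        have "(\<Sum>r\<in>{0..R}. (1/2::real) ^ r) \<le> (\<Sum>r. (1/2::real) ^ r)"
          by (intro sum_le_suminf summable_geometric) auto
        then show "(\<Sum>r\<in>{0..R}. (1/2::real) ^ r) \<le> 2" by (simp add: suminf_geometric)
      qed (use C x TL in auto)
      finally show ?thesis by simp
    qed
    ultimately have "real (card Hs) \<le> 4 * (x * TL / ln 2 ^ k) + (x * TL / ln 2 ^ k + 2 * C * (x * TL))" by linarith
    also have "\<dots> = x * (M0 * TL)" by (simp add: M0_def field_simps)
    finally have "real (card Hs) / x \<le> M0 * TL" using x by (simp add: field_simps)
    moreover have "H k x y (\<lambda>i. 2 * y i) = card Hs" by (simp add: H_def Hs_def localized_def)
    moreover have "M0 * TL \<le> 2 * M0 * ((\<Prod>i=1..k. ln (y i) powr (- e k i)) *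
        L_sum_trunc c k y)"
    proof -
      have "TL \<le> (\<Prod>i=1..k. ln (y i) powr (- e k i)) *
          (2 * L_sum_trunc c k y)"
        unfolding TL_def using trunc[OF y1(4) mono] by (intro mult_left_mono prod_nonneg) auto
      then have "M0 * TL \<le> M0 * ((\<Prod>i=1..k. ln (y i) powr (- e k i)) *
          (2 * L_sum_trunc c k y))"
        using M0 by (rule mult_left_mono)
      then show ?thesis by (simp only: mult_ac)
    qed
    ultimately show "real (H k x y (\<lambda>i. 2 * y i)) / x \<le> 2 * M0 * ((\<Prod>i=1..k. ln (y i) powr (- e k i)) *
        (\<Sum>a\<in>{a\<in>P_star_k k y. \<forall>i\<in>{1..k}. real (a i) \<le> y i powr c}. L k a / real (\<Prod>i=1..k. a i)))"
      by (simp add: L_sum_trunc_def)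
  qed
qed

end
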